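(* Let $n\ge 2$, let $M$ be a connected $n$-dimensional manifold, let $\Psi\colon M\to(\widetilde M^{n+2},\widetilde g)$ be a spacelike immersion into an $(n+2)$-dimensional Lorentzian manifold with induced metric $g=\Psi^*\widetilde g$, and let $\xi\in\mathfrak X^\perp(M)$ be a lightlike normal vector field such that $A_\xi^2=\lambda^2\cdot\mathrm{Id}$, where $\lambda\in C^\infty(M)$ is a non-vanishing function on $M$. Let $(\mathcal T,\mathcal T^1,\widetilde g,\widetilde\nabla)$ be the associated tractor to the pair $(\Psi,\xi)$, and assume there is a lightlike normal vector field $\eta\in\mathfrak X^\perp(M)$ such that $\widetilde g(\xi,\eta)=-1$. Let $\omega$ be the one-form on $M$ with $\nabla^\perp\xi=\omega\otimes\xi$, and let $P=\frac1\lambda A_\xi$. Then the tractor connection $\widetilde\nabla$ is normal if and only if the following two conditions hold: 1. For every $X,Y\in\mathfrak X(M)$, $$(\nabla_XA_\xi)(Y)-(\nabla_YA_\xi)(X)=\omega(X)A_\xi Y-\omega(Y)A_\xi X.$$ 2. For every $X,Y\in\mathfrak X(M)$, the $P$-Ricci tensor satisfies $$\mathrm{Ric}^*(X,Y)=-\mathrm{trace}(A_\xi\circ A_\eta)\,g(X,PY)-(n-2)\,\lambda\,g(X,A_\eta Y).$$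
   Context: An immersion $\Psi\colon M^n\to(\widetilde M^{n+2},\widetilde g)$ into a Lorentzian manifold is spacelike if $g=\Psi^*\widetilde g$ is Riemannian. $\mathfrak X^\perp(M)$ denotes the normal vector fields along $\Psi$; a normal field is lightlike if it is nowhere zero and has zero $\widetilde g$-square. $\widetilde\nabla$ denotes the Levi-Civita connection of $\widetilde g$ and also the induced (pull-back) connection on $\Psi^*(T\widetilde M)$; $\nabla$ is the Levi-Civita connection of $g$, $\nabla^\perp$ the normal connection. The Gauss and Weingarten formulas are $\widetilde\nabla_XY=\nabla_XY+\mathrm{II}(X,Y)$ and $\widetilde\nabla_X\zeta=-A_\zeta X+\nabla^\perp_X\zeta$ for $X,Y\in\mathfrak X(M)$, $\zeta\in\mathfrak X^\perp(M)$, so $g(A_\zeta X,Y)=\widetilde g(\mathrm{II}(X,Y),\zeta)$. As the codimension is two and $\xi$ is lightlike, there is a unique one-form $\omega$ with $\nabla^\perp\xi=\omega\otimes\xi$. Curvature convention: $R(X,Y)Z=\nabla_X\nabla_YZ-\nabla_Y\nabla_XZ-\nabla_{[X,Y]}Z$ (likewise for other connections). $P$-Ricci tensor: $\mathrm{Ric}^*(X,Y)=\sum_{i=1}^n g(R(E_i,X)Y,PE_i)$ for a local $g$-orthonormal frame $(E_1,\dots,E_n)$, where $R$ is the curvature of $\nabla$ and $P=\frac1\lambda A_\xi$ (the case $P=\pm\mathrm{Id}$ is allowed). A tractor conformal bundle on $M$ is a rank $n+2$ real vector bundle $\mathcal T\to M$ with a bundle metric $h$ of signature $(n+1,1)$ and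 a lightlike line subbundle $\mathcal T^1$. A tractor connection is a linear connection $\nabla^{\mathcal T}$ with $\nabla^{\mathcal T}h=0$ such that for nonvanishing local sections $\sigma$ of $\mathcal T^1$ the map $\beta_\sigma\colon TM\to(\mathcal T^1)^\perp/\mathcal T^1$, $\beta_\sigma(X)=\nabla^{\mathcal T}_X\sigma+\mathcal T^1$, is a vector bundle isomorphism. Then $h^\sigma(X,Y)=h(\beta_\sigma(X),\beta_\sigma(Y))$ is a Riemannian metric whose conformal class does not depend on $\sigma$; the tractor bundle with connection is called standard for a conformal structure $c$ if this class is $c$. The associated tractor to $(\Psi,\xi)$ (when $A_\xi^2=\lambda^2\,\mathrm{Id}$ with $\lambda$ non-vanishing) is $\mathcal T=\Psi^*(T\widetilde M)$ with bundle metric $\widetilde g$, $\mathcal T^1=\mathrm{Span}(\xi)$ and the induced connection $\widetilde\nabla$; it is a standard tractor conformal bundle with tractor connection for the conformal class of $g$. Normality: a tractor connection $\nabla^{\mathcal T}$ with curvature $R^{\mathcal T}$ is normal if (i) $R^{\mathcal T}(X,Y)\sigma\in\Gamma(\mathcal T^1)$ for all $X,Y\in\mathfrak X(M)$, $\sigma\in\Gamma(\mathcal T^1)$, so that $R^{\mathcal T}(X,Y)$ induces an endomorphism of $(\mathcal T^1)^\perp/\mathcal T^1$; and (ii) $\sum_{i=1}^n h\big(R^{\mathcal T}(E_i,X)\beta_\sigma(Y),\beta_\sigma(E_i)\big)=0$ for all $X,Y\in\mathfrak X(M)$, where $(E_1,\dots,E_n)$ is a local orthonormal frame for $h^\sigma$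 (independent of the choice of $\sigma$). These conditions are used as the meaning of normality for all $n\ge 2$. *)

theory Defs
  imports "HOL-Analysis.Analysis"
begin

section \<open>Smooth maps between Euclidean spaces\<close>

text \<open>\<open>ck_on k S f\<close>, for open \<open>S\<close>, says that \<open>f\<close> is \<open>k\<close> times continuously differentiable on \<open>S\<close>
  (all iterated directional derivatives up to order \<open>k\<close> exist and are continuous).\<close>

primrec ck_on :: "nat \<Rightarrow> 'a::euclidean_space set \<Rightarrow> ('a \<Rightarrow> 'b::real_normed_vector) \<Rightarrow> bool" where
  "ck_on 0 S f \<longleftrightarrow> continuous_on S f"
| "ck_on (Suc k) S f \<longleftrightarrow>
     (\<forall>x\<in>S. f differentiable (at x)) \<and> (\<forall>v. ck_on k S (\<lambda>x. frechet_derivative f (at x) v))"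

definition smooth_on :: "'a::euclidean_space set \<Rightarrow> ('a \<Rightarrow> 'b::real_normed_vector) \<Rightarrow> bool" where
  "smooth_on S f \<longleftrightarrow> (\<forall>k. ck_on k S f)"


section \<open>Smooth manifolds\<close>

text \<open>An \<open>n\<close>-dimensional manifold is a whole type \<open>'p\<close>, Hausdorff and second countable, with a smooth
  atlas (not necessarily maximal) modelled on \<open>real ^ 'n\<close>, \<open>n = CARD('n)\<close>.
  A chart is a pair of its domain and its coordinate map; the values of the coordinate map outside
  the domain are irrelevant.\<close>

type_synonym ('p, 'n) chart = "'p set \<times> ('p \<Rightarrow> real ^ 'n)"

definition chart_inv :: "('p, 'n) chart \<Rightarrow> real ^ 'n \<Rightarrow> 'p" where
  "chart_inv c = inv_into (fst c) (snd c)"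

definition is_chart :: "('p::topological_space, 'n::finite) chart \<Rightarrow> bool" where
  "is_chart c \<longleftrightarrow> open (fst c) \<and> open (snd c ` fst c) \<and>
     homeomorphism (fst c) (snd c ` fst c) (snd c) (chart_inv c)"

definition smooth_atlas ::
  "('p::{t2_space,second_countable_topology}, 'n::finite) chart set \<Rightarrow> bool" where
  "smooth_atlas \<A> \<longleftrightarrow>
     (\<forall>c\<in>\<A>. is_chart c) \<and> (\<Union>c\<in>\<A>. fst c) = UNIV \<and>
     (\<forall>c\<in>\<A>. \<forall>d\<in>\<A>. smooth_on (snd c ` (fst c \<inter> fst d)) (snd d \<circ> chart_inv c))"

definition smooth_fun ::
  "('p, 'n::finite) chart set \<Rightarrow> 'p set \<Rightarrow> ('p \<Rightarrow> 'b::real_normed_vector) \<Rightarrow> bool" where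
  "smooth_fun \<A> U f \<longleftrightarrow> (\<forall>c\<in>\<A>. smooth_on (snd c ` (fst c \<inter> U)) (f \<circ> chart_inv c))"

definition smooth_map ::
  "('p::topological_space, 'n::finite) chart set \<Rightarrow> ('q::topological_space, 'm::finite) chart set
     \<Rightarrow> ('p \<Rightarrow> 'q) \<Rightarrow> bool" where
  "smooth_map \<A> \<B> \<Psi> \<longleftrightarrow> continuous_on UNIV \<Psi> \<and>
     (\<forall>c\<in>\<A>. \<forall>d\<in>\<B>. smooth_on (snd c ` (fst c \<inter> \<Psi> -` fst d)) (snd d \<circ> \<Psi> \<circ> chart_inv c))"

text \<open>At every point \<open>p\<close> one chart of the atlas is selected. The tangent space at \<open>p\<close> is \<open>real ^ 'n\<close>:
  a tangent vector is represented by its components in the chart \<open>chart_at \<A> p\<close>. Nothing is assumed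
  about the dependence of this chart on \<open>p\<close>, so smoothness of a vector field
  \<open>'p \<Rightarrow> real ^ 'n\<close> must not be read as smoothness of this map: it means that its components in every
  chart of the atlas are smooth (see \<open>tangent_bundle\<close> and \<open>smooth_section\<close> below).\<close>

definition chart_at :: "('p, 'n) chart set \<Rightarrow> 'p \<Rightarrow> ('p, 'n) chart" where
  "chart_at \<A> p = (SOME c. c \<in> \<A> \<and> p \<in> fst c)"

text \<open>Derivative of \<open>f\<close> at \<open>p\<close> along the tangent vector \<open>v\<close> at \<open>p\<close>. In particular
  \<open>dir_deriv \<A> (snd c) p v\<close> are the components of \<open>v\<close> in the chart \<open>c\<close>.\<close>

definition dir_deriv ::
  "('p, 'n::finite) chart set \<Rightarrow> ('p \<Rightarrow> 'b::real_normed_vector) \<Rightarrow> 'p \<Rightarrow> real ^ 'n \<Rightarrow> 'b" where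
  "dir_deriv \<A> f p v =
     frechet_derivative (f \<circ> chart_inv (chart_at \<A> p)) (at (snd (chart_at \<A> p) p)) v"

definition differential ::
  "('p, 'n::finite) chart set \<Rightarrow> ('q, 'm::finite) chart set \<Rightarrow> ('p \<Rightarrow> 'q)
     \<Rightarrow> 'p \<Rightarrow> real ^ 'n \<Rightarrow> real ^ 'm" where
  "differential \<A> \<B> \<Psi> p v = dir_deriv \<A> (snd (chart_at \<B> (\<Psi> p)) \<circ> \<Psi>) p v"


section \<open>Vector bundles\<close>

text \<open>A vector bundle of rank \<open>CARD('m)\<close> is given on the fibres \<open>real ^ 'm\<close> (one copy over each point)
  by a family of local trivializations \<open>(U, \<tau>)\<close>, where \<open>\<tau> p\<close> for \<open>p \<in> U\<close> is an isomorphism of the fibre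
  over \<open>p\<close> onto the model fibre, with smooth transition functions. Sections are maps
  \<open>'p \<Rightarrow> real ^ 'm\<close>, and smoothness refers to the trivializations.\<close>

type_synonym ('p, 'm) triv = "'p set \<times> ('p \<Rightarrow> real ^ 'm \<Rightarrow> real ^ 'm)"

definition vector_bundle ::
  "('p::topological_space, 'n::finite) chart set \<Rightarrow> ('p, 'm::finite) triv set \<Rightarrow> bool" where
  "vector_bundle \<A> \<V> \<longleftrightarrow>
     (\<Union>t\<in>\<V>. fst t) = UNIV \<and>
     (\<forall>(U, \<tau>)\<in>\<V>. open U \<and> (\<forall>p\<in>U. linear (\<tau> p) \<and> bij (\<tau> p))) \<and>
     (\<forall>(U, \<tau>)\<in>\<V>. \<forall>(V, \<kappa>)\<in>\<V>. \<forall>w. smooth_fun \<A> (U \<inter> V) (\<lambda>p. \<kappa> p (inv (\<tau> p) w)))"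

definition smooth_section ::
  "('p, 'n::finite) chart set \<Rightarrow> ('p, 'm::finite) triv set \<Rightarrow> 'p set \<Rightarrow> ('p \<Rightarrow> real ^ 'm) \<Rightarrow> bool"
  where
  "smooth_section \<A> \<V> W s \<longleftrightarrow> (\<forall>(U, \<tau>)\<in>\<V>. smooth_fun \<A> (U \<inter> W) (\<lambda>p. \<tau> p (s p)))"

definition tangent_bundle :: "('p, 'n::finite) chart set \<Rightarrow> ('p, 'n) triv set" where
  "tangent_bundle \<A> = (\<lambda>c. (fst c, \<lambda>p v. dir_deriv \<A> (snd c) p v)) ` \<A>"

abbreviation vector_field ::
  "('p, 'n::finite) chart set \<Rightarrow> 'p set \<Rightarrow> ('p \<Rightarrow> real ^ 'n) \<Rightarrow> bool" where
  "vector_field \<A> U X \<equiv> smooth_section \<A> (tangent_bundle \<A>) U X"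

definition pullback_bundle :: "('p \<Rightarrow> 'q) \<Rightarrow> ('q, 'm) triv set \<Rightarrow> ('p, 'm) triv set" where
  "pullback_bundle \<Psi> \<V> = (\<lambda>(U, \<tau>). (\<Psi> -` U, \<tau> \<circ> \<Psi>)) ` \<V>"

text \<open>The components of \<open>[X, Y]\<close> in a chart \<open>c = (c\<^sup>1, \<dots>, c\<^sup>n)\<close> are \<open>X (Y c\<^sup>k) - Y (X c\<^sup>k)\<close>.\<close>

definition lie_bracket ::
  "('p, 'n::finite) chart set \<Rightarrow> ('p \<Rightarrow> real ^ 'n) \<Rightarrow> ('p \<Rightarrow> real ^ 'n) \<Rightarrow> 'p \<Rightarrow> real ^ 'n" where
  "lie_bracket \<A> X Y p =
     (let c = snd (chart_at \<A> p) in
        dir_deriv \<A> (\<lambda>q. dir_deriv \<A> c q (Y q)) p (X p)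
      - dir_deriv \<A> (\<lambda>q. dir_deriv \<A> c q (X q)) p (Y p))"

definition one_form :: "('p::topological_space, 'n::finite) chart set \<Rightarrow> ('p \<Rightarrow> real ^ 'n \<Rightarrow> real) \<Rightarrow> bool"
  where
  "one_form \<A> \<omega> \<longleftrightarrow> (\<forall>p. linear (\<omega> p)) \<and>
     (\<forall>U X. open U \<and> vector_field \<A> U X \<longrightarrow> smooth_fun \<A> U (\<lambda>p. \<omega> p (X p)))"


section \<open>Bundle metrics\<close>

definition has_signature ::
  "(real ^ 'm::finite \<Rightarrow> real ^ 'm \<Rightarrow> real) \<Rightarrow> nat \<Rightarrow> nat \<Rightarrow> bool" where
  "has_signature b k l \<longleftrightarrow>
     bilinear b \<and> (\<forall>u v. b u v = b v u) \<and>
     (\<exists>P N. independent (P \<union> N) \<and> span (P \<union> N) = UNIV \<and> card P = k \<and> card N = l \<and>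
        (\<forall>u\<in>P \<union> N. \<forall>v\<in>P \<union> N. u \<noteq> v \<longrightarrow> b u v = 0) \<and>
        (\<forall>u\<in>P. b u u > 0) \<and> (\<forall>u\<in>N. b u u < 0))"

definition bundle_metric ::
  "('p::topological_space, 'n::finite) chart set \<Rightarrow> ('p, 'm::finite) triv set \<Rightarrow> nat \<Rightarrow> nat
     \<Rightarrow> ('p \<Rightarrow> real ^ 'm \<Rightarrow> real ^ 'm \<Rightarrow> real) \<Rightarrow> bool" where
  "bundle_metric \<A> \<V> k l h \<longleftrightarrow>
     (\<forall>p. has_signature (h p) k l) \<and>
     (\<forall>U s t. open U \<and> smooth_section \<A> \<V> U s \<and> smooth_section \<A> \<V> U t
        \<longrightarrow> smooth_fun \<A> U (\<lambda>p. h p (s p) (t p)))"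

definition riemannian_metric ::
  "('p::topological_space, 'n::finite) chart set \<Rightarrow> ('p \<Rightarrow> real ^ 'n \<Rightarrow> real ^ 'n \<Rightarrow> real) \<Rightarrow> bool"
  where
  "riemannian_metric \<A> g \<longleftrightarrow> bundle_metric \<A> (tangent_bundle \<A>) CARD('n) 0 g"

definition lorentzian_metric ::
  "('p::topological_space, 'n::finite) chart set \<Rightarrow> ('p \<Rightarrow> real ^ 'n \<Rightarrow> real ^ 'n \<Rightarrow> real) \<Rightarrow> bool"
  where
  "lorentzian_metric \<A> g \<longleftrightarrow> bundle_metric \<A> (tangent_bundle \<A>) (CARD('n) - 1) 1 g"

definition orthonormal_frame ::
  "('p::topological_space, 'n::finite) chart set \<Rightarrow> ('p \<Rightarrow> real ^ 'n \<Rightarrow> real ^ 'n \<Rightarrow> real)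
     \<Rightarrow> 'p set \<Rightarrow> ('n \<Rightarrow> 'p \<Rightarrow> real ^ 'n) \<Rightarrow> bool" where
  "orthonormal_frame \<A> g U E \<longleftrightarrow>
     open U \<and> (\<forall>i. vector_field \<A> U (E i)) \<and>
     (\<forall>p\<in>U. \<forall>i j. g p (E i p) (E j p) = (if i = j then 1 else 0))"


section \<open>Linear connections\<close>

text \<open>A connection is a covariant derivative \<open>D p v s\<close>, the derivative at the point \<open>p\<close> of a section \<open>s\<close>
  along the tangent vector \<open>v\<close> at \<open>p\<close>. It acts on local sections: the axioms are required for sections
  and functions that are smooth on some open neighbourhood of \<open>p\<close> (elsewhere their values are
  arbitrary), so the Leibniz rule forces \<open>D p v s\<close> to depend only on the germ of \<open>s\<close> at \<open>p\<close>. The value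
  of \<open>D p v s\<close> at maps \<open>s\<close> that are not smooth near \<open>p\<close> has no meaning.\<close>

definition connection ::
  "('p::topological_space, 'n::finite) chart set \<Rightarrow> ('p, 'm::finite) triv set
     \<Rightarrow> ('p \<Rightarrow> real ^ 'n \<Rightarrow> ('p \<Rightarrow> real ^ 'm) \<Rightarrow> real ^ 'm) \<Rightarrow> bool" where
  "connection \<A> \<V> D \<longleftrightarrow>
     (\<forall>U p s. open U \<and> p \<in> U \<and> smooth_section \<A> \<V> U s \<longrightarrow> linear (\<lambda>v. D p v s)) \<and>
     (\<forall>U p v s t. open U \<and> p \<in> U \<and> smooth_section \<A> \<V> U s \<and> smooth_section \<A> \<V> U t
        \<longrightarrow> D p v (\<lambda>q. s q + t q) = D p v s + D p v t) \<and>
     (\<forall>U p v f s. open U \<and> p \<in> U \<and> smooth_fun \<A> U f \<and> smooth_section \<A> \<V> U s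
        \<longrightarrow> D p v (\<lambda>q. f q *\<^sub>R s q) = f p *\<^sub>R D p v s + dir_deriv \<A> f p v *\<^sub>R s p) \<and>
     (\<forall>U X s. open U \<and> vector_field \<A> U X \<and> smooth_section \<A> \<V> U s
        \<longrightarrow> smooth_section \<A> \<V> U (\<lambda>p. D p (X p) s))"

definition metric_connection ::
  "('p::topological_space, 'n::finite) chart set \<Rightarrow> ('p, 'm::finite) triv set
     \<Rightarrow> ('p \<Rightarrow> real ^ 'm \<Rightarrow> real ^ 'm \<Rightarrow> real)
     \<Rightarrow> ('p \<Rightarrow> real ^ 'n \<Rightarrow> ('p \<Rightarrow> real ^ 'm) \<Rightarrow> real ^ 'm) \<Rightarrow> bool" where
  "metric_connection \<A> \<V> h D \<longleftrightarrow> connection \<A> \<V> D \<and>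
     (\<forall>U p v s t. open U \<and> p \<in> U \<and> smooth_section \<A> \<V> U s \<and> smooth_section \<A> \<V> U t
        \<longrightarrow> dir_deriv \<A> (\<lambda>q. h q (s q) (t q)) p v = h p (D p v s) (t p) + h p (s p) (D p v t))"

definition levi_civita ::
  "('p::topological_space, 'n::finite) chart set \<Rightarrow> ('p \<Rightarrow> real ^ 'n \<Rightarrow> real ^ 'n \<Rightarrow> real)
     \<Rightarrow> ('p \<Rightarrow> real ^ 'n \<Rightarrow> ('p \<Rightarrow> real ^ 'n) \<Rightarrow> real ^ 'n) \<Rightarrow> bool" where
  "levi_civita \<A> g D \<longleftrightarrow> metric_connection \<A> (tangent_bundle \<A>) g D \<and>
     (\<forall>U p X Y. open U \<and> p \<in> U \<and> vector_field \<A> U X \<and> vector_field \<A> U Y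
        \<longrightarrow> D p (X p) Y - D p (Y p) X = lie_bracket \<A> X Y p)"

text \<open>The pull-back connection on \<open>\<Psi>\<^sup>*\<V>\<close> is the connection determined by
  \<open>(\<Psi>\<^sup>*D)\<^sub>v (Z \<circ> \<Psi>) = D\<^bsub>d\<Psi> v\<^esub> Z\<close> for sections \<open>Z\<close> of \<open>\<V>\<close>.\<close>

definition pullback_connection ::
  "('p::topological_space, 'n::finite) chart set \<Rightarrow> ('q::topological_space, 'k::finite) chart set
     \<Rightarrow> ('p \<Rightarrow> 'q) \<Rightarrow> ('q, 'm::finite) triv set
     \<Rightarrow> ('q \<Rightarrow> real ^ 'k \<Rightarrow> ('q \<Rightarrow> real ^ 'm) \<Rightarrow> real ^ 'm)
     \<Rightarrow> ('p \<Rightarrow> real ^ 'n \<Rightarrow> ('p \<Rightarrow> real ^ 'm) \<Rightarrow> real ^ 'm) \<Rightarrow> bool" where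
  "pullback_connection \<A> \<B> \<Psi> \<V> D D' \<longleftrightarrow>
     connection \<A> (pullback_bundle \<Psi> \<V>) D' \<and>
     (\<forall>V Z p v. open V \<and> \<Psi> p \<in> V \<and> smooth_section \<B> \<V> V Z
        \<longrightarrow> D' p v (Z \<circ> \<Psi>) = D (\<Psi> p) (differential \<A> \<B> \<Psi> p v) Z)"

definition curvature ::
  "('p, 'n::finite) chart set \<Rightarrow> ('p \<Rightarrow> real ^ 'n \<Rightarrow> ('p \<Rightarrow> real ^ 'm) \<Rightarrow> real ^ 'm::finite)
     \<Rightarrow> ('p \<Rightarrow> real ^ 'n) \<Rightarrow> ('p \<Rightarrow> real ^ 'n) \<Rightarrow> ('p \<Rightarrow> real ^ 'm) \<Rightarrow> 'p \<Rightarrow> real ^ 'm" where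
  "curvature \<A> D X Y s p =
     D p (X p) (\<lambda>q. D q (Y q) s) - D p (Y p) (\<lambda>q. D q (X q) s) - D p (lie_bracket \<A> X Y p) s"

text \<open>\<open>(\<nabla>\<^sub>v A) Y\<close> at \<open>p\<close>, for a field \<open>A\<close> of endomorphisms of the tangent spaces.\<close>

definition covariant_derivative_endo ::
  "('p \<Rightarrow> real ^ 'n \<Rightarrow> ('p \<Rightarrow> real ^ 'n) \<Rightarrow> real ^ 'n)
     \<Rightarrow> ('p \<Rightarrow> real ^ 'n \<Rightarrow> real ^ 'n::finite) \<Rightarrow> 'p \<Rightarrow> real ^ 'n \<Rightarrow> ('p \<Rightarrow> real ^ 'n) \<Rightarrow> real ^ 'n"
  where
  "covariant_derivative_endo D A p v Y = D p v (\<lambda>q. A q (Y q)) - A p (D p v Y)"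


section \<open>Immersions into a semi-Riemannian manifold\<close>

definition immersion ::
  "('p::topological_space, 'n::finite) chart set \<Rightarrow> ('q::topological_space, 'm::finite) chart set
     \<Rightarrow> ('p \<Rightarrow> 'q) \<Rightarrow> bool" where
  "immersion \<A> \<B> \<Psi> \<longleftrightarrow> smooth_map \<A> \<B> \<Psi> \<and> (\<forall>p. inj (differential \<A> \<B> \<Psi> p))"

definition induced_metric ::
  "('p, 'n::finite) chart set \<Rightarrow> ('q, 'm::finite) chart set \<Rightarrow> ('p \<Rightarrow> 'q)
     \<Rightarrow> ('q \<Rightarrow> real ^ 'm \<Rightarrow> real ^ 'm \<Rightarrow> real) \<Rightarrow> 'p \<Rightarrow> real ^ 'n \<Rightarrow> real ^ 'n \<Rightarrow> real" where
  "induced_metric \<A> \<B> \<Psi> G p u v =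
     G (\<Psi> p) (differential \<A> \<B> \<Psi> p u) (differential \<A> \<B> \<Psi> p v)"

definition spacelike_immersion ::
  "('p::topological_space, 'n::finite) chart set \<Rightarrow> ('q::topological_space, 'm::finite) chart set
     \<Rightarrow> ('q \<Rightarrow> real ^ 'm \<Rightarrow> real ^ 'm \<Rightarrow> real) \<Rightarrow> ('p \<Rightarrow> 'q) \<Rightarrow> bool" where
  "spacelike_immersion \<A> \<B> G \<Psi> \<longleftrightarrow>
     immersion \<A> \<B> \<Psi> \<and> riemannian_metric \<A> (induced_metric \<A> \<B> \<Psi> G)"

definition normal_field ::
  "('p, 'n::finite) chart set \<Rightarrow> ('q, 'm::finite) chart set
     \<Rightarrow> ('q \<Rightarrow> real ^ 'm \<Rightarrow> real ^ 'm \<Rightarrow> real) \<Rightarrow> ('p \<Rightarrow> 'q) \<Rightarrow> ('p \<Rightarrow> real ^ 'm) \<Rightarrow> bool" where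
  "normal_field \<A> \<B> G \<Psi> \<zeta> \<longleftrightarrow>
     smooth_section \<A> (pullback_bundle \<Psi> (tangent_bundle \<B>)) UNIV \<zeta> \<and>
     (\<forall>p v. G (\<Psi> p) (\<zeta> p) (differential \<A> \<B> \<Psi> p v) = 0)"

definition lightlike_normal_field ::
  "('p, 'n::finite) chart set \<Rightarrow> ('q, 'm::finite) chart set
     \<Rightarrow> ('q \<Rightarrow> real ^ 'm \<Rightarrow> real ^ 'm \<Rightarrow> real) \<Rightarrow> ('p \<Rightarrow> 'q) \<Rightarrow> ('p \<Rightarrow> real ^ 'm) \<Rightarrow> bool" where
  "lightlike_normal_field \<A> \<B> G \<Psi> \<zeta> \<longleftrightarrow>
     normal_field \<A> \<B> G \<Psi> \<zeta> \<and> (\<forall>p. \<zeta> p \<noteq> 0 \<and> G (\<Psi> p) (\<zeta> p) (\<zeta> p) = 0)"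

text \<open>The tangential part of a vector \<open>w\<close> tangent to the ambient manifold at \<open>\<Psi> p\<close> is returned as a
  tangent vector of the immersed manifold: \<open>w = d\<Psi> (tangential_part p w) + normal_part p w\<close>.
  For a spacelike immersion it exists and is unique.\<close>

definition tangential_part ::
  "('p, 'n::finite) chart set \<Rightarrow> ('q, 'm::finite) chart set
     \<Rightarrow> ('q \<Rightarrow> real ^ 'm \<Rightarrow> real ^ 'm \<Rightarrow> real) \<Rightarrow> ('p \<Rightarrow> 'q) \<Rightarrow> 'p \<Rightarrow> real ^ 'm \<Rightarrow> real ^ 'n" where
  "tangential_part \<A> \<B> G \<Psi> p w =
     (THE u. \<forall>v. G (\<Psi> p) (w - differential \<A> \<B> \<Psi> p u) (differential \<A> \<B> \<Psi> p v) = 0)"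

definition normal_part ::
  "('p, 'n::finite) chart set \<Rightarrow> ('q, 'm::finite) chart set
     \<Rightarrow> ('q \<Rightarrow> real ^ 'm \<Rightarrow> real ^ 'm \<Rightarrow> real) \<Rightarrow> ('p \<Rightarrow> 'q) \<Rightarrow> 'p \<Rightarrow> real ^ 'm \<Rightarrow> real ^ 'm" where
  "normal_part \<A> \<B> G \<Psi> p w = w - differential \<A> \<B> \<Psi> p (tangential_part \<A> \<B> G \<Psi> p w)"

text \<open>Weingarten formula: \<open>D\<^sub>v \<zeta> = - d\<Psi> (A\<^sub>\<zeta> v) + \<nabla>\<^sup>\<bottom>\<^sub>v \<zeta>\<close>, where \<open>D\<close> is the pull-back to \<open>\<Psi>\<^sup>*T\<close> of the
  Levi-Civita connection of \<open>G\<close>.\<close>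

definition shape_operator ::
  "('p, 'n::finite) chart set \<Rightarrow> ('q, 'm::finite) chart set
     \<Rightarrow> ('q \<Rightarrow> real ^ 'm \<Rightarrow> real ^ 'm \<Rightarrow> real) \<Rightarrow> ('p \<Rightarrow> 'q)
     \<Rightarrow> ('p \<Rightarrow> real ^ 'n \<Rightarrow> ('p \<Rightarrow> real ^ 'm) \<Rightarrow> real ^ 'm)
     \<Rightarrow> ('p \<Rightarrow> real ^ 'm) \<Rightarrow> 'p \<Rightarrow> real ^ 'n \<Rightarrow> real ^ 'n" where
  "shape_operator \<A> \<B> G \<Psi> D \<zeta> p v = - tangential_part \<A> \<B> G \<Psi> p (D p v \<zeta>)"

definition normal_connection ::
  "('p, 'n::finite) chart set \<Rightarrow> ('q, 'm::finite) chart set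
     \<Rightarrow> ('q \<Rightarrow> real ^ 'm \<Rightarrow> real ^ 'm \<Rightarrow> real) \<Rightarrow> ('p \<Rightarrow> 'q)
     \<Rightarrow> ('p \<Rightarrow> real ^ 'n \<Rightarrow> ('p \<Rightarrow> real ^ 'm) \<Rightarrow> real ^ 'm)
     \<Rightarrow> 'p \<Rightarrow> real ^ 'n \<Rightarrow> ('p \<Rightarrow> real ^ 'm) \<Rightarrow> real ^ 'm" where
  "normal_connection \<A> \<B> G \<Psi> D p v \<zeta> = normal_part \<A> \<B> G \<Psi> p (D p v \<zeta>)"

text \<open>\<open>Ric\<^sup>*(X, Y)\<close> at \<open>p\<close>, computed in the local orthonormal frame \<open>E\<close>. The value does not depend on the
  frame; statements about it quantify over all local orthonormal frames (these exist around every
  point).\<close>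

definition P_ricci ::
  "('p, 'n::finite) chart set \<Rightarrow> ('p \<Rightarrow> real ^ 'n \<Rightarrow> real ^ 'n \<Rightarrow> real)
     \<Rightarrow> ('p \<Rightarrow> real ^ 'n \<Rightarrow> ('p \<Rightarrow> real ^ 'n) \<Rightarrow> real ^ 'n)
     \<Rightarrow> ('p \<Rightarrow> real ^ 'n \<Rightarrow> real ^ 'n) \<Rightarrow> ('n \<Rightarrow> 'p \<Rightarrow> real ^ 'n)
     \<Rightarrow> ('p \<Rightarrow> real ^ 'n) \<Rightarrow> ('p \<Rightarrow> real ^ 'n) \<Rightarrow> 'p \<Rightarrow> real" where
  "P_ricci \<A> g D P E X Y p = (\<Sum>i\<in>UNIV. g p (curvature \<A> D (E i) X Y p) (P p (E i p)))"


section \<open>Tractor bundles and tractor connections\<close>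

definition line_subbundle ::
  "('p::topological_space, 'n::finite) chart set \<Rightarrow> ('p, 'm::finite) triv set
     \<Rightarrow> ('p \<Rightarrow> (real ^ 'm) set) \<Rightarrow> bool" where
  "line_subbundle \<A> \<V> L \<longleftrightarrow>
     (\<forall>p. \<exists>U \<sigma>. open U \<and> p \<in> U \<and> smooth_section \<A> \<V> U \<sigma> \<and>
        (\<forall>q\<in>U. \<sigma> q \<noteq> 0 \<and> L q = span {\<sigma> q}))"

definition subbundle_section ::
  "('p, 'n::finite) chart set \<Rightarrow> ('p, 'm::finite) triv set \<Rightarrow> ('p \<Rightarrow> (real ^ 'm) set)
     \<Rightarrow> 'p set \<Rightarrow> ('p \<Rightarrow> real ^ 'm) \<Rightarrow> bool" where
  "subbundle_section \<A> \<V> L U \<sigma> \<longleftrightarrow> smooth_section \<A> \<V> U \<sigma> \<and> (\<forall>p\<in>U. \<sigma> p \<in> L p)"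

definition tractor_bundle ::
  "('p::topological_space, 'n::finite) chart set \<Rightarrow> ('p, 'm::finite) triv set
     \<Rightarrow> ('p \<Rightarrow> real ^ 'm \<Rightarrow> real ^ 'm \<Rightarrow> real) \<Rightarrow> ('p \<Rightarrow> (real ^ 'm) set) \<Rightarrow> bool" where
  "tractor_bundle \<A> \<V> h L \<longleftrightarrow>
     CARD('m) = CARD('n) + 2 \<and> vector_bundle \<A> \<V> \<and> bundle_metric \<A> \<V> (CARD('n) + 1) 1 h \<and>
     line_subbundle \<A> \<V> L \<and> (\<forall>p. \<forall>w\<in>L p. h p w w = 0)"

text \<open>The fibre at \<open>p\<close> of \<open>L\<^sup>\<bottom> / L\<close>, as a set of cosets, and the map \<open>\<beta>\<^sub>\<sigma>\<close> into it.\<close>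

definition coset :: "('p \<Rightarrow> (real ^ 'm) set) \<Rightarrow> 'p \<Rightarrow> real ^ 'm \<Rightarrow> (real ^ 'm) set" where
  "coset L p w = {w + t | t. t \<in> L p}"

definition perp_quotient ::
  "('p \<Rightarrow> real ^ 'm \<Rightarrow> real ^ 'm \<Rightarrow> real) \<Rightarrow> ('p \<Rightarrow> (real ^ 'm) set) \<Rightarrow> 'p \<Rightarrow> (real ^ 'm) set set"
  where
  "perp_quotient h L p = coset L p ` {w. \<forall>t\<in>L p. h p w t = 0}"

definition tractor_beta ::
  "('p \<Rightarrow> (real ^ 'm) set) \<Rightarrow> ('p \<Rightarrow> real ^ 'n \<Rightarrow> ('p \<Rightarrow> real ^ 'm) \<Rightarrow> real ^ 'm)
     \<Rightarrow> ('p \<Rightarrow> real ^ 'm) \<Rightarrow> 'p \<Rightarrow> real ^ 'n \<Rightarrow> (real ^ 'm) set" where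
  "tractor_beta L D \<sigma> p v = coset L p (D p v \<sigma>)"

text \<open>\<open>\<beta>\<^sub>\<sigma>\<close> is fibrewise linear and smooth because \<open>D\<close> is a connection, so it is a vector bundle
  isomorphism exactly when it is fibrewise bijective.\<close>

definition tractor_connection ::
  "('p::topological_space, 'n::finite) chart set \<Rightarrow> ('p, 'm::finite) triv set
     \<Rightarrow> ('p \<Rightarrow> real ^ 'm \<Rightarrow> real ^ 'm \<Rightarrow> real) \<Rightarrow> ('p \<Rightarrow> (real ^ 'm) set)
     \<Rightarrow> ('p \<Rightarrow> real ^ 'n \<Rightarrow> ('p \<Rightarrow> real ^ 'm) \<Rightarrow> real ^ 'm) \<Rightarrow> bool" where
  "tractor_connection \<A> \<V> h L D \<longleftrightarrow>
     tractor_bundle \<A> \<V> h L \<and> metric_connection \<A> \<V> h D \<and>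
     (\<forall>U \<sigma>. open U \<and> subbundle_section \<A> \<V> L U \<sigma> \<and> (\<forall>p\<in>U. \<sigma> p \<noteq> 0)
        \<longrightarrow> (\<forall>p\<in>U. bij_betw (tractor_beta L D \<sigma> p) UNIV (perp_quotient h L p)))"

text \<open>The metric \<open>h\<^sup>\<sigma>(u, v) = h(\<beta>\<^sub>\<sigma> u, \<beta>\<^sub>\<sigma> v)\<close>, evaluated on the representatives \<open>D\<^sub>u \<sigma>\<close>, \<open>D\<^sub>v \<sigma>\<close> of
  the cosets; the choice is irrelevant because \<open>L\<close> is orthogonal to \<open>L\<^sup>\<bottom>\<close>.\<close>

definition tractor_metric ::
  "('p \<Rightarrow> real ^ 'm \<Rightarrow> real ^ 'm \<Rightarrow> real)
     \<Rightarrow> ('p \<Rightarrow> real ^ 'n \<Rightarrow> ('p \<Rightarrow> real ^ 'm) \<Rightarrow> real ^ 'm)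
     \<Rightarrow> ('p \<Rightarrow> real ^ 'm) \<Rightarrow> 'p \<Rightarrow> real ^ 'n \<Rightarrow> real ^ 'n \<Rightarrow> real" where
  "tractor_metric h D \<sigma> p u v = h p (D p u \<sigma>) (D p v \<sigma>)"

text \<open>In the trace condition, \<open>R(E\<^sub>i, X)\<close> acts on the representative \<open>D\<^sub>Y \<sigma>\<close> of \<open>\<beta>\<^sub>\<sigma> Y\<close>. By the first
  condition the summands do not depend on the representatives.\<close>

definition normal_tractor_connection ::
  "('p::topological_space, 'n::finite) chart set \<Rightarrow> ('p, 'm::finite) triv set
     \<Rightarrow> ('p \<Rightarrow> real ^ 'm \<Rightarrow> real ^ 'm \<Rightarrow> real) \<Rightarrow> ('p \<Rightarrow> (real ^ 'm) set)
     \<Rightarrow> ('p \<Rightarrow> real ^ 'n \<Rightarrow> ('p \<Rightarrow> real ^ 'm) \<Rightarrow> real ^ 'm) \<Rightarrow> bool" where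
  "normal_tractor_connection \<A> \<V> h L D \<longleftrightarrow>
     tractor_connection \<A> \<V> h L D \<and>
     (\<forall>X Y \<sigma>. vector_field \<A> UNIV X \<and> vector_field \<A> UNIV Y \<and> subbundle_section \<A> \<V> L UNIV \<sigma>
        \<longrightarrow> (\<forall>p. curvature \<A> D X Y \<sigma> p \<in> L p)) \<and>
     (\<forall>X Y U \<sigma> E. vector_field \<A> UNIV X \<and> vector_field \<A> UNIV Y \<and>
        open U \<and> subbundle_section \<A> \<V> L U \<sigma> \<and> (\<forall>p\<in>U. \<sigma> p \<noteq> 0) \<and>
        orthonormal_frame \<A> (tractor_metric h D \<sigma>) U E
        \<longrightarrow> (\<forall>p\<in>U. (\<Sum>i\<in>UNIV. h p (curvature \<A> D (E i) X (\<lambda>q. D q (Y q) \<sigma>) p)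
                                  (D p (E i p) \<sigma>)) = 0))"

end

theory Submission
  imports Defs
begin

text \<open>Write \<open>D\<close> for the pull-back connection, which is metric and torsion-free along \<open>\<Psi>\<close>, so that the Gauss,
  Weingarten and Codazzi equations hold. By the Codazzi equation the tangential part of \<open>R(X, Y) \<xi>\<close>
  is, up to sign, the defect in the first condition; as \<open>R(X, Y) \<xi>\<close> is orthogonal to \<open>\<xi>\<close>, it lies in
  \<open>span {\<xi>}\<close> if and only if the defect vanishes.

  For a section \<open>\<sigma> = f \<xi>\<close> of the line bundle, \<open>D\<^sub>Y \<sigma> = - f d\<Psi> (A\<^sub>\<xi> Y)\<close> modulo \<open>\<xi>\<close>, hence
  \<open>h\<^sup>\<sigma> = (f \<lambda>)\<^sup>2 g\<close> and the trace in the normality condition is that of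
  \<open>(E, F) \<mapsto> G (R(E, X) d\<Psi> (A\<^sub>\<xi> Y), d\<Psi> (A\<^sub>\<xi> F))\<close> up to a nonvanishing factor. The Gauss equation together with
  \<open>A\<^sub>\<xi>\<^sup>2 = \<lambda>\<^sup>2\<close> identifies this trace with \<open>\<lambda>\<close> times the defect of the second condition at
  \<open>(X, A\<^sub>\<xi> Y)\<close>, and \<open>Y \<mapsto> A\<^sub>\<xi> Y\<close> is a bijection of the vector fields.\<close>


section \<open>Calculus of smooth maps between Euclidean spaces\<close>

text \<open>Two features of the setting shape the proof. The connection on the pulled-back bundle is
  known only through its values on fields \<open>Z \<circ> \<Psi>\<close>; that it is metric and
  torsion-free has to be derived in frames pulled back from the ambient manifold. Further,
  \<open>X\<close> and \<open>Y\<close> range over global vector fields, while orthonormal frames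
  are only local and their members enter the curvature themselves. Bump functions and the
  tensoriality of the curvature carry the first condition over to frame fields. That condition has
  to be available before the trace is evaluated: the \<xi>-component of the derivative of \<sigma>
  can be discarded only because the curvature maps \<xi> into its own span. The passage from
  \<sigma> to the metric \<open>g\<close> is a rescaling of the frame by \<open>f * lam\<close>,
  whose square absorbs the unknown coefficient \<open>f\<close>. Finally, the bijection of the
  vector fields is explicit: dividing \<open>A\<xi> Y\<close> by the square of \<open>lam\<close>
  gives the preimage of \<open>Y\<close>.\<close>

lemma ck_on_subset: "ck_on k S f \<Longrightarrow> T \<subseteq> S \<Longrightarrow> ck_on k T f"
  by (induction k arbitrary: f) (auto intro: continuous_on_subset)

lemma frechet_derivative_cong_open:
  assumes "open S" "x \<in> S" "\<And>y. y \<in> S \<Longrightarrow> f y = g y"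
  shows "frechet_derivative f (at x) = frechet_derivative g (at x)"
proof -
  have "(f has_derivative D) (at x) \<longleftrightarrow> (g has_derivative D) (at x)" for D
    using assms has_derivative_transform_within_open by metis
  then show ?thesis unfolding frechet_derivative_def by simp
qed

lemma differentiable_cong_open:
  assumes "open S" "x \<in> S" "\<And>y. y \<in> S \<Longrightarrow> f y = g y"
  shows "f differentiable (at x) \<longleftrightarrow> g differentiable (at x)"
  unfolding differentiable_def using assms has_derivative_transform_within_open by metis

lemma ck_on_cong:
  assumes "open S" "\<And>x. x \<in> S \<Longrightarrow> f x = g x"
  shows "ck_on k S f \<longleftrightarrow> ck_on k S g"
  using assms(2)
proof (induction k arbitrary: f g)
  case 0
  then show ?case by (simp cong: continuous_on_cong)
next
  case (Suc k)
  have "ck_on k S (\<lambda>x. frechet_derivative f (at x) v)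
      = ck_on k S (\<lambda>x. frechet_derivative g (at x) v)" for v
    by (rule Suc.IH) (metis Suc.prems assms(1) frechet_derivative_cong_open)
  moreover have "(\<forall>x\<in>S. f differentiable (at x)) = (\<forall>x\<in>S. g differentiable (at x))"
    by (metis Suc.prems assms(1) differentiable_cong_open)
  ultimately show ?case by simp
qed

lemma ck_on_SucD: "ck_on (Suc k) S f \<Longrightarrow> ck_on k S f"
proof (induction k arbitrary: f)
  case 0
  then show ?case
    by (metis ck_on.simps continuous_at_imp_continuous_on differentiable_imp_continuous_within)
next
  case (Suc k)
  then show ?case by (metis ck_on.simps(2))
qed

text \<open>The set \<open>S\<close> need not be open: derivatives are taken in the full space, and
  only order zero refers to \<open>S\<close>, where \<open>at x within S\<close> does not change
  when \<open>S\<close> is cut down to a neighbourhood of \<open>x\<close>.\<close>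

lemma ck_on_local:
  assumes "\<And>x. x \<in> S \<Longrightarrow> \<exists>T. open T \<and> x \<in> T \<and> ck_on k (S \<inter> T) f"
  shows "ck_on k S f"
  using assms
proof (induction k arbitrary: f)
  case 0
  then obtain T where T: "\<And>x. x \<in> S \<Longrightarrow> open (T x) \<and> x \<in> T x \<and> continuous_on (S \<inter> T x) f"
    by (metis ck_on.simps(1))
  have "continuous (at x within S) f" if "x \<in> S" for x
  proof -
    have "at x within S = at x within (S \<inter> T x)"
      by (rule at_within_nhd[of _ "T x"]) (use T[OF that] in auto)
    then show ?thesis
      using T[OF that] that by (simp add: continuous_on_eq_continuous_within)
  qed
  then show ?case by (simp add: continuous_on_eq_continuous_within)
next
  case (Suc k)
  then show ?case
    by (metis IntI ck_on.simps(2))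
qed

lemma ck_on_const: "ck_on k S (\<lambda>x. c)"
  by (induction k arbitrary: c) auto

lemma ck_on_has_derivative:
  "ck_on (Suc k) S f \<Longrightarrow> x \<in> S \<Longrightarrow> (f has_derivative frechet_derivative f (at x)) (at x)"
  by (simp add: frechet_derivative_works)

text \<open>Any explicit derivative may stand in for \<open>frechet_derivative\<close>. The closure
  properties below are proved by induction on the order through this rule.\<close>

lemma ck_on_SucI:
  assumes "open S" "\<And>x. x \<in> S \<Longrightarrow> (f has_derivative f' x) (at x)" "\<And>v. ck_on k S (\<lambda>x. f' x v)"
  shows "ck_on (Suc k) S f"
proof -
  have "ck_on k S (\<lambda>x. frechet_derivative f (at x) v)" for v
  proof (subst ck_on_cong[OF assms(1)])
    show "frechet_derivative f (at x) v = f' x v" if "x \<in> S" for x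
      using frechet_derivative_at[OF assms(2)[OF that]] by simp
  qed (rule assms(3))
  moreover have "f differentiable (at x)" if "x \<in> S" for x
    using assms(2)[OF that] by (rule differentiableI)
  ultimately show ?thesis by simp
qed

lemma ck_on_bounded_linear:
  assumes "bounded_linear L" "open S" "ck_on k S f"
  shows "ck_on k S (\<lambda>x. L (f x))"
  using assms(3)
proof (induction k arbitrary: f)
  case 0
  then show ?case
    using assms(1) by (auto intro: bounded_linear.continuous_on)
next
  case (Suc k)
  show ?case
  proof (rule ck_on_SucI[OF assms(2)])
    show "((\<lambda>x. L (f x)) has_derivative (\<lambda>v. L (frechet_derivative f (at x) v))) (at x)" if "x \<in> S" for x
      by (rule bounded_linear.has_derivative[OF assms(1) ck_on_has_derivative[OF Suc.prems that]])
    show "ck_on k S (\<lambda>x. L (frechet_derivative f (at x) v))" for v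
      using Suc by simp
  qed
qed

lemma ck_on_add:
  assumes "open S" "ck_on k S f" "ck_on k S g"
  shows "ck_on k S (\<lambda>x. f x + g x)"
  using assms(2,3)
proof (induction k arbitrary: f g)
  case 0
  then show ?case by (auto intro: continuous_intros)
next
  case (Suc k)
  show ?case
  proof (rule ck_on_SucI[OF assms(1)])
    show "((\<lambda>x. f x + g x) has_derivative
        (\<lambda>v. frechet_derivative f (at x) v + frechet_derivative g (at x) v)) (at x)" if "x \<in> S" for x
      by (rule has_derivative_add[OF ck_on_has_derivative[OF Suc.prems(1) that]
            ck_on_has_derivative[OF Suc.prems(2) that]])
    show "ck_on k S (\<lambda>x. frechet_derivative f (at x) v + frechet_derivative g (at x) v)" for v
      using Suc by simp
  qed
qed

text \<open>The product rule pairs each factor with a derivative of the other, so the induction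
  hypothesis also needs the factors themselves at the lower order.\<close>

lemma ck_on_bilinear:
  assumes B: "bounded_bilinear B" and "open S" "ck_on k S f" "ck_on k S g"
  shows "ck_on k S (\<lambda>x. B (f x) (g x))"
  using assms(3,4)
proof (induction k arbitrary: f g)
  case 0
  then show ?case using bounded_bilinear.continuous_on[OF B] by auto
next
  case (Suc k)
  show ?case
  proof (rule ck_on_SucI[OF assms(2)])
    show "((\<lambda>x. B (f x) (g x)) has_derivative
        (\<lambda>v. B (f x) (frechet_derivative g (at x) v) + B (frechet_derivative f (at x) v) (g x))) (at x)"
      if "x \<in> S" for x
      by (rule bounded_bilinear.FDERIV[OF B ck_on_has_derivative[OF Suc.prems(1) that]
            ck_on_has_derivative[OF Suc.prems(2) that]])
    show "ck_on k S (\<lambda>x. B (f x) (frechet_derivative g (at x) v) + B (frechet_derivative f (at x) v) (g x))" for v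
      using Suc.prems ck_on_SucD[OF Suc.prems(1)] ck_on_SucD[OF Suc.prems(2)]
      by (intro ck_on_add assms(2) Suc.IH) auto
  qed
qed

lemma ck_on_sum:
  assumes "open S" "\<And>i. i \<in> I \<Longrightarrow> ck_on k S (f i)"
  shows "ck_on k S (\<lambda>x. \<Sum>i\<in>I. f i x)"
  using assms(2) by (induction I rule: infinite_finite_induct)
    (auto intro!: ck_on_add assms(1) ck_on_const)

lemma linear_euclidean_expansion:
  assumes "linear L"
  shows "L v = (\<Sum>b\<in>Basis. (v \<bullet> b) *\<^sub>R L b)"
  by (subst euclidean_representation[of v, symmetric], subst linear_sum[OF assms])
    (simp add: linear_cmul[OF assms])

text \<open>The chain rule evaluates the derivative of \<open>f\<close> in a direction that varies
  with the point, whereas \<open>ck_on\<close> controls only fixed directions. Expanding the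
  direction in \<open>Basis\<close> reduces to fixed directions with coefficients of class
  \<open>k\<close>.\<close>

lemma ck_on_compose:
  fixes h :: "'a::euclidean_space \<Rightarrow> 'b::euclidean_space"
  assumes "open S" "open T" "ck_on k T f" "ck_on k S h" "h ` S \<subseteq> T"
  shows "ck_on k S (\<lambda>x. f (h x))"
  using assms(3,4)
proof (induction k arbitrary: f)
  case 0
  then show ?case using assms(5) by (auto intro: continuous_on_compose2)
next
  case (Suc k)
  show ?case
  proof (rule ck_on_SucI[OF assms(1)])
    fix x assume "x \<in> S"
    then have df: "(f has_derivative frechet_derivative f (at (h x))) (at (h x))"
      using ck_on_has_derivative[OF Suc.prems(1)] assms(5) by blast
    show "((\<lambda>x. f (h x)) has_derivative
        (\<lambda>v. \<Sum>b\<in>Basis. (frechet_derivative h (at x) v \<bullet> b) *\<^sub>R frechet_derivative f (at (h x)) b)) (at x)"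
      using has_derivative_compose[OF ck_on_has_derivative[OF Suc.prems(2) \<open>x \<in> S\<close>] df]
      by (subst linear_euclidean_expansion[OF has_derivative_linear[OF df], symmetric])
  next
    show "ck_on k S (\<lambda>x. \<Sum>b\<in>Basis. (frechet_derivative h (at x) v \<bullet> b) *\<^sub>R frechet_derivative f (at (h x)) b)" for v
      using Suc.prems ck_on_SucD[OF Suc.prems(2)]
      by (intro ck_on_sum assms(1) ck_on_bilinear[OF bounded_bilinear_scaleR] Suc.IH
         ck_on_bounded_linear[OF bounded_linear_inner_left]) auto
  qed
qed

text \<open>The derivative is a polynomial in \<open>inverse\<close>, so the induction on the order
  closes.\<close>

lemma ck_on_inverse: "ck_on k (- {0::real}) inverse"
proof (induction k)
  case 0
  then show ?case by (auto intro!: continuous_intros)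
next
  case (Suc k)
  have o: "open (- {0::real})" by auto
  show ?case
  proof (rule ck_on_SucI[OF o])
    show "(inverse has_derivative (\<lambda>v. - (inverse x * v * inverse x))) (at x)" if "x \<in> - {0::real}" for x
      using has_derivative_inverse'[of x UNIV] that by auto
    have "ck_on k (- {0}) (\<lambda>x. (- v) * (inverse x * inverse x))" for v :: real
      by (intro ck_on_bilinear[OF bounded_bilinear_mult] o ck_on_const Suc)
    then show "ck_on k (- {0}) (\<lambda>x. - (inverse x * v * inverse x))" for v :: real
      by (simp add: mult_ac)
  qed
qed

lemma smooth_on_subset: "smooth_on S f \<Longrightarrow> T \<subseteq> S \<Longrightarrow> smooth_on T f"
  unfolding smooth_on_def using ck_on_subset by blast

lemma smooth_on_cong:
  "open S \<Longrightarrow> (\<And>x. x \<in> S \<Longrightarrow> f x = g x) \<Longrightarrow> smooth_on S f \<longleftrightarrow> smooth_on S g"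
  unfolding smooth_on_def using ck_on_cong by blast

lemma smooth_on_local:
  assumes "\<And>x. x \<in> S \<Longrightarrow> \<exists>T. open T \<and> x \<in> T \<and> smooth_on (S \<inter> T) f"
  shows "smooth_on S f"
  using assms unfolding smooth_on_def by (metis ck_on_local)

lemma smooth_on_const: "smooth_on S (\<lambda>x. c)"
  unfolding smooth_on_def by (simp add: ck_on_const)

lemma smooth_on_bounded_linear:
  "bounded_linear L \<Longrightarrow> open S \<Longrightarrow> smooth_on S f \<Longrightarrow> smooth_on S (\<lambda>x. L (f x))"
  unfolding smooth_on_def by (simp add: ck_on_bounded_linear)

lemma smooth_on_add:
  "open S \<Longrightarrow> smooth_on S f \<Longrightarrow> smooth_on S g \<Longrightarrow> smooth_on S (\<lambda>x. f x + g x)"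
  unfolding smooth_on_def by (simp add: ck_on_add)

lemma smooth_on_bilinear:
  "bounded_bilinear B \<Longrightarrow> open S \<Longrightarrow> smooth_on S f \<Longrightarrow> smooth_on S g \<Longrightarrow> smooth_on S (\<lambda>x. B (f x) (g x))"
  unfolding smooth_on_def by (simp add: ck_on_bilinear)

lemma smooth_on_sum:
  "open S \<Longrightarrow> (\<And>i. i \<in> I \<Longrightarrow> smooth_on S (f i)) \<Longrightarrow> smooth_on S (\<lambda>x. \<Sum>i\<in>I. f i x)"
  unfolding smooth_on_def by (simp add: ck_on_sum)

lemma smooth_on_compose:
  fixes h :: "'a::euclidean_space \<Rightarrow> 'b::euclidean_space"
  shows "open S \<Longrightarrow> open T \<Longrightarrow> smooth_on T f \<Longrightarrow> smooth_on S h \<Longrightarrow> h ` S \<subseteq> T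
    \<Longrightarrow> smooth_on S (\<lambda>x. f (h x))"
  unfolding smooth_on_def using ck_on_compose by blast

lemma smooth_on_inverse:
  fixes f :: "'a::euclidean_space \<Rightarrow> real"
  assumes "open S" "smooth_on S f" "\<And>x. x \<in> S \<Longrightarrow> f x \<noteq> 0"
  shows "smooth_on S (\<lambda>x. inverse (f x))"
  by (rule smooth_on_compose[where T = "- {0}"])
    (use assms ck_on_inverse in \<open>auto simp: smooth_on_def\<close>)

lemma smooth_on_imp_has_derivative:
  assumes "smooth_on S f" "x \<in> S"
  shows "(f has_derivative frechet_derivative f (at x)) (at x)"
  using assms ck_on_has_derivative unfolding smooth_on_def by blast

lemma smooth_on_frechet_derivative:
  assumes "smooth_on S f"
  shows "smooth_on S (\<lambda>x. frechet_derivative f (at x) v)"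
  using assms unfolding smooth_on_def by (metis ck_on.simps(2))

lemma smooth_on_imp_continuous_on: "smooth_on S f \<Longrightarrow> continuous_on S f"
  unfolding smooth_on_def by (metis ck_on.simps(1))

lemma smooth_on_frechet_derivative_apply:
  assumes "open S" "smooth_on S f" "smooth_on S w"
  shows "smooth_on S (\<lambda>x. frechet_derivative f (at x) (w x))"
proof (subst smooth_on_cong[OF assms(1)])
  show "frechet_derivative f (at x) (w x)
      = (\<Sum>b\<in>Basis. (w x \<bullet> b) *\<^sub>R frechet_derivative f (at x) b)" if "x \<in> S" for x
    by (rule linear_euclidean_expansion)
      (use smooth_on_imp_has_derivative[OF assms(2) that] has_derivative_linear in blast)
  show "smooth_on S (\<lambda>x. \<Sum>b\<in>Basis. (w x \<bullet> b) *\<^sub>R frechet_derivative f (at x) b)"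
    by (intro smooth_on_sum smooth_on_bilinear[OF bounded_bilinear_scaleR] assms
        smooth_on_bounded_linear[OF bounded_linear_inner_left] smooth_on_frechet_derivative)
qed

text \<open>The left-hand side of the equation is symmetric in \<open>u\<close> and \<open>v\<close>; letting \<open>h\<close> tend to zero, so are the
  mixed second derivatives.\<close>

lemma second_difference_mean_value:
  fixes F :: "'a::euclidean_space \<Rightarrow> real"
  assumes "smooth_on (ball x r) F" "0 < h" "h * (norm u + norm v) < r"
  shows "\<exists>y. dist x y \<le> h * (norm u + norm v) \<and>
    F (x + h *\<^sub>R u + h *\<^sub>R v) - F (x + h *\<^sub>R u) - F (x + h *\<^sub>R v) + F x
      = h * (h * frechet_derivative (\<lambda>z. frechet_derivative F (at z) u) (at y) v)"
proof -
  have nb: "x + s *\<^sub>R u + t *\<^sub>R v \<in> ball x r \<and> dist x (x + s *\<^sub>R u + t *\<^sub>R v) \<le> h * (norm u + norm v)"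
    if "0 \<le> s" "s \<le> h" "0 \<le> t" "t \<le> h" for s t
  proof -
    have "dist x (x + s *\<^sub>R u + t *\<^sub>R v) = norm (s *\<^sub>R u + t *\<^sub>R v)"
      unfolding dist_norm by (subst norm_minus_commute) (simp add: add.assoc)
    also have "\<dots> \<le> s * norm u + t * norm v"
      using norm_triangle_ineq[of "s *\<^sub>R u" "t *\<^sub>R v"] that by simp
    also have "\<dots> \<le> h * norm u + h * norm v"
      using that by (intro add_mono mult_right_mono) auto
    finally have "dist x (x + s *\<^sub>R u + t *\<^sub>R v) \<le> h * (norm u + norm v)"
      by (simp add: distrib_left)
    then show ?thesis using assms(3) by simp
  qed
  \<comment> \<open>The second difference is \<open>k h - k 0\<close>. The mean value theorem is
    applied to \<open>k\<close> in direction \<open>u\<close> and then to \<open>Fu\<close> in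
    direction \<open>v\<close>.\<close>
  define k where "k s = F (x + s *\<^sub>R u + h *\<^sub>R v) - F (x + s *\<^sub>R u)" for s
  define Fu where "Fu = (\<lambda>z. frechet_derivative F (at z) u)"
  have line: "((\<lambda>t. H (a + t *\<^sub>R w)) has_real_derivative frechet_derivative H (at (a + t *\<^sub>R w)) w) (at t)"
    if "smooth_on (ball x r) H" "a + t *\<^sub>R w \<in> ball x r" for H :: "'a \<Rightarrow> real" and a w t
  proof -
    have "((\<lambda>t. a + t *\<^sub>R w) has_derivative (\<lambda>t. t *\<^sub>R w)) (at t)"
      by (auto intro!: derivative_eq_intros)
    from has_derivative_compose[OF this smooth_on_imp_has_derivative[OF that]]
    have "((\<lambda>t. H (a + t *\<^sub>R w)) has_derivative (\<lambda>s. frechet_derivative H (at (a + t *\<^sub>R w)) (s *\<^sub>R w))) (at t)" .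
    moreover have "linear (frechet_derivative H (at (a + t *\<^sub>R w)))"
      using smooth_on_imp_has_derivative[OF that] has_derivative_linear by blast
    ultimately show ?thesis
      unfolding has_field_derivative_def by (simp add: linear_cmul mult_commute_abs)
  qed
  have dk: "(k has_real_derivative Fu (x + s *\<^sub>R u + h *\<^sub>R v) - Fu (x + s *\<^sub>R u)) (at s)"
    if "0 \<le> s" "s \<le> h" for s
  proof -
    have "((\<lambda>s. F (x + h *\<^sub>R v + s *\<^sub>R u)) has_real_derivative Fu (x + h *\<^sub>R v + s *\<^sub>R u)) (at s)"
      unfolding Fu_def using that nb[of s h] assms(2)
      by (intro line assms(1)) (auto simp: add_ac)
    moreover have "((\<lambda>s. F (x + s *\<^sub>R u)) has_real_derivative Fu (x + s *\<^sub>R u)) (at s)"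
      unfolding Fu_def using that nb[of s 0] assms(2)
      by (intro line assms(1)) auto
    ultimately show ?thesis
      unfolding k_def by (auto intro!: DERIV_diff simp: add_ac)
  qed
  obtain s where s: "0 < s" "s < h" "k h - k 0 = (h - 0) * (Fu (x + s *\<^sub>R u + h *\<^sub>R v) - Fu (x + s *\<^sub>R u))"
    using MVT2[OF assms(2) dk] by blast
  have "smooth_on (ball x r) Fu"
    unfolding Fu_def by (rule smooth_on_frechet_derivative[OF assms(1)])
  then have "((\<lambda>t. Fu (x + s *\<^sub>R u + t *\<^sub>R v)) has_real_derivative
      frechet_derivative Fu (at (x + s *\<^sub>R u + t *\<^sub>R v)) v) (at t)" if "0 \<le> t" "t \<le> h" for t
    using that nb[of s t] s by (intro line) auto
  from MVT2[OF assms(2) this] obtain t where t: "0 < t" "t < h"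
    "Fu (x + s *\<^sub>R u + h *\<^sub>R v) - Fu (x + s *\<^sub>R u + 0 *\<^sub>R v) = (h - 0) * frechet_derivative Fu (at (x + s *\<^sub>R u + t *\<^sub>R v)) v"
    by blast
  have "k h - k 0 = F (x + h *\<^sub>R u + h *\<^sub>R v) - F (x + h *\<^sub>R u) - F (x + h *\<^sub>R v) + F x"
    unfolding k_def by simp
  then show ?thesis
    using nb[of s t] s t unfolding Fu_def by (intro exI[of _ "x + s *\<^sub>R u + t *\<^sub>R v"]) auto
qed

lemma symmetric_second_derivative:
  fixes F :: "'a::euclidean_space \<Rightarrow> real"
  assumes "open S" "smooth_on S F" "x \<in> S"
  shows "frechet_derivative (\<lambda>z. frechet_derivative F (at z) u) (at x) v
       = frechet_derivative (\<lambda>z. frechet_derivative F (at z) v) (at x) u"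
    (is "?A x = ?B x")
proof -
  obtain r where r: "r > 0" "ball x r \<subseteq> S" using assms openE by blast
  have sF: "smooth_on (ball x r) F" using smooth_on_subset assms r by blast
  have cont: "continuous (at x) (\<lambda>z. frechet_derivative (\<lambda>z. frechet_derivative F (at z) u) (at z) v)" for u v
    using smooth_on_imp_continuous_on[OF smooth_on_frechet_derivative[OF smooth_on_frechet_derivative[OF assms(2)]]]
      assms continuous_on_eq_continuous_at by blast
  show ?thesis
  proof (rule ccontr)
    assume ne: "?A x \<noteq> ?B x"
    define e where "e = \<bar>?A x - ?B x\<bar> / 2"
    have e: "e > 0" using ne unfolding e_def by simp
    obtain d1 where d1: "d1 > 0" "\<And>y. dist x y < d1 \<Longrightarrow> \<bar>?A y - ?A x\<bar> < e"
      using cont[of u v] e unfolding continuous_at_eps_delta dist_real_def by (metis dist_commute)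
    obtain d2 where d2: "d2 > 0" "\<And>y. dist x y < d2 \<Longrightarrow> \<bar>?B y - ?B x\<bar> < e"
      using cont[of v u] e unfolding continuous_at_eps_delta dist_real_def by (metis dist_commute)
    define m where "m = min r (min d1 d2)"
    \<comment> \<open>The summand 1 keeps \<open>N\<close> positive when \<open>u\<close> and
      \<open>v\<close> vanish. The step \<open>h\<close> chosen from it puts both intermediate
      points at distance less than \<open>m\<close> from \<open>x\<close>.\<close>
    define N where "N = norm u + norm v + 1"
    have mN: "m > 0" "N > 0" using r d1 d2 unfolding m_def N_def by (auto intro: add_nonneg_pos)
    define h where "h = m / (2 * N)"
    have h: "h > 0" using mN unfolding h_def by simp
    have "h * (norm u + norm v) \<le> h * N" using h unfolding N_def by simp
    also have "\<dots> < m" using mN unfolding h_def by simp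
    finally have hm: "h * (norm u + norm v) < m" .
    then have hr: "h * (norm u + norm v) < r" "h * (norm v + norm u) < r"
      unfolding m_def by (auto simp: add.commute)
    obtain y where y: "dist x y \<le> h * (norm u + norm v)"
      "F (x + h *\<^sub>R u + h *\<^sub>R v) - F (x + h *\<^sub>R u) - F (x + h *\<^sub>R v) + F x = h * (h * ?A y)"
      using second_difference_mean_value[OF sF h hr(1)] by blast
    obtain z where z: "dist x z \<le> h * (norm v + norm u)"
      "F (x + h *\<^sub>R v + h *\<^sub>R u) - F (x + h *\<^sub>R v) - F (x + h *\<^sub>R u) + F x = h * (h * ?B z)"
      using second_difference_mean_value[OF sF h hr(2)] by blast
    \<comment> \<open>Exchanging \<open>u\<close> and \<open>v\<close> leaves the second difference
      unchanged, so the two mixed derivatives agree, though possibly at different points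
      \<open>y\<close> and \<open>z\<close>; continuity at \<open>x\<close> absorbs this.\<close>
    have "F (x + h *\<^sub>R v + h *\<^sub>R u) = F (x + h *\<^sub>R u + h *\<^sub>R v)" by (simp add: add_ac)
    then have "h * (h * ?A y) = h * (h * ?B z)" using y(2) z(2) by linarith
    then have "?A y = ?B z" using h by simp
    moreover have "\<bar>?A y - ?A x\<bar> < e" using y(1) hm unfolding m_def by (intro d1) auto
    moreover have "\<bar>?B z - ?B x\<bar> < e" using z(1) hm unfolding m_def by (intro d2) (auto simp: add.commute)
    ultimately show False unfolding e_def by (smt (verit) field_sum_of_halves)
  qed
qed

section \<open>Smooth functions and directional derivatives on manifolds\<close>

locale smooth_manifold =
  fixes \<A> :: "('p::{t2_space,second_countable_topology}, 'n::finite) chart set"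
  assumes atlas: "smooth_atlas \<A>"
begin

lemma chart_homeomorphism:
  "c \<in> \<A> \<Longrightarrow> homeomorphism (fst c) (snd c ` fst c) (snd c) (chart_inv c)"
  and open_chart_domain: "c \<in> \<A> \<Longrightarrow> open (fst c)"
  and open_chart_image: "c \<in> \<A> \<Longrightarrow> open (snd c ` fst c)"
  and smooth_transition: "c \<in> \<A> \<Longrightarrow> d \<in> \<A> \<Longrightarrow> smooth_on (snd c ` (fst c \<inter> fst d)) (snd d \<circ> chart_inv c)"
  using atlas unfolding smooth_atlas_def is_chart_def by auto

lemma chart_inv_chart: "c \<in> \<A> \<Longrightarrow> p \<in> fst c \<Longrightarrow> chart_inv c (snd c p) = p"
  using chart_homeomorphism unfolding homeomorphism_def by blast

lemma inj_on_chart: "c \<in> \<A> \<Longrightarrow> inj_on (snd c) (fst c)"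
  by (metis chart_inv_chart inj_on_inverseI)

lemma chart_at_in: "chart_at \<A> p \<in> \<A>" and in_chart_at: "p \<in> fst (chart_at \<A> p)"
proof -
  have "\<exists>c. c \<in> \<A> \<and> p \<in> fst c" using atlas unfolding smooth_atlas_def by blast
  then have "chart_at \<A> p \<in> \<A> \<and> p \<in> fst (chart_at \<A> p)" unfolding chart_at_def by (rule someI_ex)
  then show "chart_at \<A> p \<in> \<A>" "p \<in> fst (chart_at \<A> p)" by auto
qed

lemma open_chart_Int:
  assumes "c \<in> \<A>" "open W"
  shows "open (snd c ` (fst c \<inter> W))"
proof -
  have "openin (top_of_set (snd c ` fst c)) (snd c ` (fst c \<inter> W))"
    by (rule homeomorphism_imp_open_map[OF chart_homeomorphism[OF assms(1)]])
      (simp add: assms(2) openin_open_Int)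
  then show ?thesis using open_chart_image[OF assms(1)] openin_open_eq by blast
qed

lemma chart_Int_image: "c \<in> \<A> \<Longrightarrow> x \<in> snd c ` (fst c \<inter> W) \<Longrightarrow>
   chart_inv c x \<in> fst c \<and> chart_inv c x \<in> W \<and> snd c (chart_inv c x) = x"
  by (auto simp: chart_inv_chart)

lemma smooth_funD: "smooth_fun \<A> U f \<Longrightarrow> c \<in> \<A> \<Longrightarrow> smooth_on (snd c ` (fst c \<inter> U)) (f \<circ> chart_inv c)"
  unfolding smooth_fun_def by auto

lemma smooth_fun_subset: "smooth_fun \<A> U f \<Longrightarrow> W \<subseteq> U \<Longrightarrow> smooth_fun \<A> W f"
  unfolding smooth_fun_def by (meson Int_mono image_mono smooth_on_subset subset_refl)

lemma smooth_fun_cong: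
  assumes "open U" "\<And>p. p \<in> U \<Longrightarrow> f p = g p"
  shows "smooth_fun \<A> U f \<longleftrightarrow> smooth_fun \<A> U g"
  unfolding smooth_fun_def
proof (intro ball_cong refl)
  fix c assume "c \<in> \<A>"
  then show "smooth_on (snd c ` (fst c \<inter> U)) (f \<circ> chart_inv c) = smooth_on (snd c ` (fst c \<inter> U)) (g \<circ> chart_inv c)"
    by (intro smooth_on_cong open_chart_Int assms) (auto simp: chart_inv_chart assms(2))
qed

lemma smooth_fun_local:
  assumes "\<And>p. p \<in> U \<Longrightarrow> \<exists>W. open W \<and> p \<in> W \<and> smooth_fun \<A> (U \<inter> W) f"
  shows "smooth_fun \<A> U f"
  unfolding smooth_fun_def
proof (intro ballI smooth_on_local)
  fix c x assume c: "c \<in> \<A>" and x: "x \<in> snd c ` (fst c \<inter> U)"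
  then obtain p where p: "p \<in> fst c" "p \<in> U" "x = snd c p" by auto
  then obtain W where W: "open W" "p \<in> W" "smooth_fun \<A> (U \<inter> W) f" using assms by blast
  have "snd c ` (fst c \<inter> U) \<inter> snd c ` (fst c \<inter> W) = snd c ` (fst c \<inter> (U \<inter> W))"
    using inj_on_image_Int[OF inj_on_chart[OF c], of "fst c \<inter> U" "fst c \<inter> W"] by (simp add: Int_ac)
  then show "\<exists>T. open T \<and> x \<in> T \<and> smooth_on (snd c ` (fst c \<inter> U) \<inter> T) (f \<circ> chart_inv c)"
    using open_chart_Int[OF c W(1)] p W smooth_funD[OF W(3) c] by (intro exI[of _ "snd c ` (fst c \<inter> W)"]) auto
qed

lemma smooth_fun_const: "smooth_fun \<A> U (\<lambda>p. k)"
  unfolding smooth_fun_def o_def by (simp add: smooth_on_const)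

lemma smooth_fun_bounded_linear:
  "bounded_linear L \<Longrightarrow> open U \<Longrightarrow> smooth_fun \<A> U f \<Longrightarrow> smooth_fun \<A> U (\<lambda>p. L (f p))"
  unfolding smooth_fun_def o_def using smooth_on_bounded_linear[of L, OF _ open_chart_Int] by simp

lemma smooth_fun_add:
  "open U \<Longrightarrow> smooth_fun \<A> U f \<Longrightarrow> smooth_fun \<A> U g \<Longrightarrow> smooth_fun \<A> U (\<lambda>p. f p + g p)"
  unfolding smooth_fun_def o_def by (simp add: smooth_on_add open_chart_Int)

lemma smooth_fun_bilinear:
  "bounded_bilinear B \<Longrightarrow> open U \<Longrightarrow> smooth_fun \<A> U f \<Longrightarrow> smooth_fun \<A> U g \<Longrightarrow> smooth_fun \<A> U (\<lambda>p. B (f p) (g p))"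
  unfolding smooth_fun_def o_def using smooth_on_bilinear[of B, OF _ open_chart_Int] by simp

lemmas smooth_fun_scaleR = smooth_fun_bilinear[OF bounded_bilinear_scaleR]
lemmas smooth_fun_mult = smooth_fun_bilinear[OF bounded_bilinear_mult]

lemma smooth_fun_minus: "open U \<Longrightarrow> smooth_fun \<A> U f \<Longrightarrow> smooth_fun \<A> U (\<lambda>p. - f p)"
  by (rule smooth_fun_bounded_linear[OF bounded_linear_minus[OF bounded_linear_ident]])

lemma smooth_fun_sum:
  "open U \<Longrightarrow> (\<And>i. i \<in> I \<Longrightarrow> smooth_fun \<A> U (f i)) \<Longrightarrow> smooth_fun \<A> U (\<lambda>p. \<Sum>i\<in>I. f i p)"
  unfolding smooth_fun_def o_def by (simp add: smooth_on_sum open_chart_Int)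

lemma smooth_fun_prod:
  fixes f :: "'i \<Rightarrow> 'p \<Rightarrow> real"
  assumes "open U" "\<And>i. i \<in> I \<Longrightarrow> smooth_fun \<A> U (f i)"
  shows "smooth_fun \<A> U (\<lambda>p. \<Prod>i\<in>I. f i p)"
  using assms(2) by (induction I rule: infinite_finite_induct)
    (auto intro!: smooth_fun_mult smooth_fun_const assms(1))

lemma smooth_fun_inverse:
  fixes f :: "'p \<Rightarrow> real"
  assumes "open U" "smooth_fun \<A> U f" "\<And>p. p \<in> U \<Longrightarrow> f p \<noteq> 0"
  shows "smooth_fun \<A> U (\<lambda>p. inverse (f p))"
  unfolding smooth_fun_def o_def
proof
  fix c assume c: "c \<in> \<A>"
  show "smooth_on (snd c ` (fst c \<inter> U)) (\<lambda>x. inverse (f (chart_inv c x)))"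
    by (rule smooth_on_inverse[OF open_chart_Int[OF c assms(1)]])
      (use smooth_funD[OF assms(2) c] assms(3) in \<open>auto simp: chart_inv_chart c o_def\<close>)
qed

lemma smooth_fun_compose:
  fixes f :: "'p \<Rightarrow> 'b::euclidean_space"
  assumes "open U" "open T" "smooth_on T F" "smooth_fun \<A> U f" "f ` U \<subseteq> T"
  shows "smooth_fun \<A> U (\<lambda>p. F (f p))"
  unfolding smooth_fun_def o_def
proof
  fix c assume c: "c \<in> \<A>"
  show "smooth_on (snd c ` (fst c \<inter> U)) (\<lambda>x. F (f (chart_inv c x)))"
    by (rule smooth_on_compose[where T = T])
      (use assms c open_chart_Int smooth_funD[OF assms(4) c] in \<open>auto simp: chart_inv_chart o_def\<close>)
qed

lemma smooth_fun_chart: "c \<in> \<A> \<Longrightarrow> smooth_fun \<A> (fst c) (snd c)"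
  unfolding smooth_fun_def using smooth_transition by blast

section \<open>Directional derivatives in charts and the Lie bracket\<close>

lemma smooth_fun_has_derivative:
  assumes "open U" "p \<in> U" "smooth_fun \<A> U f" "c \<in> \<A>" "p \<in> fst c"
  shows "((f \<circ> chart_inv c) has_derivative frechet_derivative (f \<circ> chart_inv c) (at (snd c p))) (at (snd c p))"
  by (rule smooth_on_imp_has_derivative[OF smooth_funD[OF assms(3,4)]]) (use assms in auto)

lemma dir_deriv_has_derivative:
  assumes "open U" "p \<in> U" "smooth_fun \<A> U f"
  shows "((f \<circ> chart_inv (chart_at \<A> p)) has_derivative dir_deriv \<A> f p) (at (snd (chart_at \<A> p) p))"
  using smooth_fun_has_derivative[OF assms chart_at_in in_chart_at]
  unfolding dir_deriv_def .

lemma dir_deriv_eqI: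
  assumes "((f \<circ> chart_inv (chart_at \<A> p)) has_derivative L) (at (snd (chart_at \<A> p) p))"
  shows "dir_deriv \<A> f p v = L v"
  using frechet_derivative_at[OF assms] unfolding dir_deriv_def by simp

text \<open>\<open>dir_deriv\<close> is computed in the chart selected at \<open>p\<close>. The
  chain rule for the transition map moves the computation to any chart \<open>c\<close>, which can
  then be kept fixed while \<open>p\<close> varies.\<close>

lemma dir_deriv_chart:
  assumes "open U" "p \<in> U" "smooth_fun \<A> U f" "c \<in> \<A>" "p \<in> fst c"
  shows "dir_deriv \<A> f p v
    = frechet_derivative (f \<circ> chart_inv c) (at (snd c p)) (dir_deriv \<A> (snd c) p v)"
proof (rule dir_deriv_eqI)
  let ?c = "chart_at \<A> p"
  let ?S = "snd ?c ` (fst ?c \<inter> fst c)"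
  have in_S: "snd ?c p \<in> ?S" using assms in_chart_at by auto
  have *: "((snd c \<circ> chart_inv ?c) has_derivative dir_deriv \<A> (snd c) p) (at (snd ?c p))"
    by (rule dir_deriv_has_derivative[OF open_chart_domain[OF assms(4)] assms(5) smooth_fun_chart[OF assms(4)]])
  have pt: "(snd c \<circ> chart_inv ?c) (snd ?c p) = snd c p"
    by (simp add: chart_inv_chart chart_at_in in_chart_at)
  have "((\<lambda>x. (f \<circ> chart_inv c) ((snd c \<circ> chart_inv ?c) x)) has_derivative
      (\<lambda>v. frechet_derivative (f \<circ> chart_inv c) (at (snd c p)) (dir_deriv \<A> (snd c) p v))) (at (snd ?c p))"
    by (rule has_derivative_compose[OF *])
      (use smooth_fun_has_derivative[OF assms] in \<open>simp only: pt\<close>)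
  then show "((f \<circ> chart_inv ?c) has_derivative
      (\<lambda>v. frechet_derivative (f \<circ> chart_inv c) (at (snd c p)) (dir_deriv \<A> (snd c) p v))) (at (snd ?c p))"
    by (rule has_derivative_transform_within_open[OF _ open_chart_Int[OF chart_at_in open_chart_domain[OF assms(4)]] in_S])
      (use assms(4) in \<open>auto simp: chart_inv_chart chart_at_in\<close>)
qed

lemma dir_deriv_linear:
  assumes "open U" "p \<in> U" "smooth_fun \<A> U f"
  shows "linear (dir_deriv \<A> f p)"
  using dir_deriv_has_derivative[OF assms] by (rule has_derivative_linear)

lemma dir_deriv_cong:
  assumes "open U" "p \<in> U" "\<And>q. q \<in> U \<Longrightarrow> f q = g q"
  shows "dir_deriv \<A> f p v = dir_deriv \<A> g p v"
proof -
  have "frechet_derivative (f \<circ> chart_inv (chart_at \<A> p)) (at (snd (chart_at \<A> p) p))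
     = frechet_derivative (g \<circ> chart_inv (chart_at \<A> p)) (at (snd (chart_at \<A> p) p))"
    by (rule frechet_derivative_cong_open[OF open_chart_Int[OF chart_at_in assms(1)]])
      (use assms in \<open>auto simp: in_chart_at chart_inv_chart chart_at_in\<close>)
  then show ?thesis unfolding dir_deriv_def by simp
qed

lemma dir_deriv_const: "dir_deriv \<A> (\<lambda>q. k) p v = 0"
  unfolding dir_deriv_def by (simp add: o_def)

lemma dir_deriv_bounded_linear:
  assumes "bounded_linear L" "open U" "p \<in> U" "smooth_fun \<A> U f"
  shows "dir_deriv \<A> (\<lambda>q. L (f q)) p v = L (dir_deriv \<A> f p v)"
  using bounded_linear.has_derivative[OF assms(1) dir_deriv_has_derivative[OF assms(2-4)]]
  by (intro dir_deriv_eqI) (simp add: o_def)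

lemma dir_deriv_add:
  assumes "open U" "p \<in> U" "smooth_fun \<A> U f" "smooth_fun \<A> U g"
  shows "dir_deriv \<A> (\<lambda>q. f q + g q) p v = dir_deriv \<A> f p v + dir_deriv \<A> g p v"
  using has_derivative_add[OF dir_deriv_has_derivative[OF assms(1-3)] dir_deriv_has_derivative[OF assms(1,2,4)]]
  by (intro dir_deriv_eqI) (simp add: o_def)

lemma dir_deriv_bilinear:
  assumes "bounded_bilinear B" "open U" "p \<in> U" "smooth_fun \<A> U f" "smooth_fun \<A> U g"
  shows "dir_deriv \<A> (\<lambda>q. B (f q) (g q)) p v = B (f p) (dir_deriv \<A> g p v) + B (dir_deriv \<A> f p v) (g p)"
  using bounded_bilinear.FDERIV[OF assms(1) dir_deriv_has_derivative[OF assms(2-4)] dir_deriv_has_derivative[OF assms(2,3,5)]]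
  by (intro dir_deriv_eqI) (simp add: o_def chart_inv_chart chart_at_in in_chart_at)

lemmas dir_deriv_mult = dir_deriv_bilinear[OF bounded_bilinear_mult]

lemma dir_deriv_sum:
  assumes "open U" "p \<in> U" "\<And>i. i \<in> I \<Longrightarrow> smooth_fun \<A> U (f i)"
  shows "dir_deriv \<A> (\<lambda>q. \<Sum>i\<in>I. f i q) p v = (\<Sum>i\<in>I. dir_deriv \<A> (f i) p v)"
  using assms(3) by (induction I rule: infinite_finite_induct)
    (auto simp: dir_deriv_const dir_deriv_add[OF assms(1,2)] smooth_fun_sum[OF assms(1)])

lemma dir_deriv_chart_at: "dir_deriv \<A> (snd (chart_at \<A> p)) p v = v"
proof (rule dir_deriv_eqI)
  let ?c = "chart_at \<A> p"
  show "((snd ?c \<circ> chart_inv ?c) has_derivative (\<lambda>v. v)) (at (snd ?c p))"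
    by (rule has_derivative_transform_within_open[OF has_derivative_ident open_chart_image[OF chart_at_in]])
      (auto simp: chart_inv_chart chart_at_in in_chart_at)
qed

text \<open>Passing back to the selected chart is a left inverse; bijectivity then follows because
  both dimensions agree.\<close>

lemma dir_deriv_chart_bij:
  assumes "c \<in> \<A>" "p \<in> fst c"
  shows "linear (dir_deriv \<A> (snd c) p)" "bij (dir_deriv \<A> (snd c) p)"
proof -
  show lin: "linear (dir_deriv \<A> (snd c) p)"
    by (rule dir_deriv_linear[OF open_chart_domain[OF assms(1)] assms(2) smooth_fun_chart[OF assms(1)]])
  let ?c = "chart_at \<A> p"
  have "v = frechet_derivative (snd ?c \<circ> chart_inv c) (at (snd c p)) (dir_deriv \<A> (snd c) p v)" for v
    using dir_deriv_chart[OF open_chart_domain[OF chart_at_in] in_chart_at smooth_fun_chart[OF chart_at_in] assms]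
    by (simp add: dir_deriv_chart_at)
  then have "inj (dir_deriv \<A> (snd c) p)" by (metis injI)
  then show "bij (dir_deriv \<A> (snd c) p)"
    using linear_injective_imp_surjective[OF lin] by (simp add: bij_def)
qed

lemma smooth_section_funD:
  "vector_field \<A> U X \<Longrightarrow> c \<in> \<A> \<Longrightarrow> smooth_fun \<A> (fst c \<inter> U) (\<lambda>p. dir_deriv \<A> (snd c) p (X p))"
  unfolding smooth_section_def tangent_bundle_def by auto

text \<open>As a map into \<open>real ^ 'n\<close>, \<open>X\<close> may be discontinuous, because
  the selected charts jump. Only its components in a fixed chart are smooth, so the derivative is
  rewritten in such a chart before any smoothness is claimed.\<close>

lemma dir_deriv_smooth:
  assumes "open U" "smooth_fun \<A> U f" "vector_field \<A> U X"
  shows "smooth_fun \<A> U (\<lambda>q. dir_deriv \<A> f q (X q))"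
  unfolding smooth_fun_def
proof
  fix c assume c: "c \<in> \<A>"
  let ?S = "snd c ` (fst c \<inter> U)"
  let ?X = "\<lambda>x. dir_deriv \<A> (snd c) (chart_inv c x) (X (chart_inv c x))"
  have o: "open ?S" using open_chart_Int[OF c assms(1)] .
  have "smooth_on ?S ?X"
    using smooth_funD[OF smooth_section_funD[OF assms(3) c] c] by (simp add: o_def)
  from smooth_on_frechet_derivative_apply[OF o smooth_funD[OF assms(2) c] this]
  show "smooth_on ?S ((\<lambda>q. dir_deriv \<A> f q (X q)) \<circ> chart_inv c)"
  proof (rule iffD1[OF smooth_on_cong[OF o], rotated])
    fix x assume x: "x \<in> ?S"
    then obtain q where q: "q \<in> fst c" "q \<in> U" "x = snd c q" by auto
    show "frechet_derivative (f \<circ> chart_inv c) (at x) (?X x) = ((\<lambda>q. dir_deriv \<A> f q (X q)) \<circ> chart_inv c) x"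
      using dir_deriv_chart[OF assms(1) q(2) assms(2) c q(1)] q c by (simp add: chart_inv_chart)
  qed
qed

text \<open>In coordinates each iterated derivative is a first-order term, containing the derivative
  of the components of the inner field, plus a Hessian term. The first-order terms make up the
  bracket, and the Hessian terms cancel by symmetry.\<close>

lemma dir_deriv_lie_bracket:
  fixes f :: "'p \<Rightarrow> real"
  assumes U: "open U" "p \<in> U" and f: "smooth_fun \<A> U f"
    and X: "vector_field \<A> U X" and Y: "vector_field \<A> U Y"
  shows "dir_deriv \<A> f p (lie_bracket \<A> X Y p)
    = dir_deriv \<A> (\<lambda>q. dir_deriv \<A> f q (Y q)) p (X p) - dir_deriv \<A> (\<lambda>q. dir_deriv \<A> f q (X q)) p (Y p)"
proof -
  define c where "c = chart_at \<A> p"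
  have c: "c \<in> \<A>" "p \<in> fst c" unfolding c_def using chart_at_in in_chart_at by auto
  define S where "S = snd c ` (fst c \<inter> U)"
  define F where "F = f \<circ> chart_inv c"
  define x where "x = snd c p"
  have S: "open S" "x \<in> S" unfolding S_def x_def using open_chart_Int[OF c(1) U(1)] c U by auto
  have F: "smooth_on S F" unfolding S_def F_def using smooth_funD[OF f c(1)] .
  define comp where "comp = (\<lambda>Z::'p \<Rightarrow> real ^ 'n. (\<lambda>q. dir_deriv \<A> (snd c) q (Z q)) \<circ> chart_inv c)"
  have comp_smooth: "smooth_on S (comp Z)" if "vector_field \<A> U Z" for Z
    using smooth_funD[OF smooth_section_funD[OF that c(1)] c(1)] unfolding comp_def S_def by simp
  have comp_x: "comp Z x = Z p" for Z
    unfolding comp_def x_def using c by (simp add: chart_inv_chart) (simp add: c_def dir_deriv_chart_at)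
  have chart_dir: "dir_deriv \<A> h p v = frechet_derivative (h \<circ> chart_inv c) (at x) v" for h :: "'p \<Rightarrow> 'b::real_normed_vector" and v
    unfolding dir_deriv_def x_def c_def ..
  have linF: "linear (frechet_derivative F (at z))" if "z \<in> S" for z
    using smooth_on_imp_has_derivative[OF F that] by (rule has_derivative_linear)
  \<comment> \<open>The second summand differentiates \<open>F\<close> with the field
    \<open>Z\<close> frozen at \<open>p\<close>; this is the Hessian of \<open>F\<close>.\<close>
  have second: "dir_deriv \<A> (\<lambda>q. dir_deriv \<A> f q (Z q)) p u
      = frechet_derivative F (at x) (frechet_derivative (comp Z) (at x) u)
        + frechet_derivative (\<lambda>z. frechet_derivative F (at z) (Z p)) (at x) u"
    if Z: "vector_field \<A> U Z" for Z u
  proof -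
    have eq: "((\<lambda>q. dir_deriv \<A> f q (Z q)) \<circ> chart_inv c) z
        = (\<Sum>b\<in>Basis. (comp Z z \<bullet> b) *\<^sub>R frechet_derivative F (at z) b)" if z: "z \<in> S" for z
    proof -
      obtain q where q: "q \<in> fst c" "q \<in> U" "z = snd c q" using z unfolding S_def by auto
      have "((\<lambda>q. dir_deriv \<A> f q (Z q)) \<circ> chart_inv c) z = frechet_derivative F (at z) (comp Z z)"
        using dir_deriv_chart[OF U(1) q(2) f c(1) q(1)] q c unfolding F_def comp_def by (simp add: chart_inv_chart)
      also have "\<dots> = (\<Sum>b\<in>Basis. (comp Z z \<bullet> b) *\<^sub>R frechet_derivative F (at z) b)"
        by (rule linear_euclidean_expansion[OF linF[OF z]])
      finally show ?thesis .
    qed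
    have "((\<lambda>z. \<Sum>b\<in>Basis. (comp Z z \<bullet> b) *\<^sub>R frechet_derivative F (at z) b) has_derivative
       (\<lambda>u. \<Sum>b\<in>Basis. (comp Z x \<bullet> b) *\<^sub>R frechet_derivative (\<lambda>z. frechet_derivative F (at z) b) (at x) u
         + (frechet_derivative (comp Z) (at x) u \<bullet> b) *\<^sub>R frechet_derivative F (at x) b)) (at x)"
      by (intro has_derivative_sum has_derivative_scaleR has_derivative_inner_left
          smooth_on_imp_has_derivative[OF comp_smooth[OF Z] S(2)]
          smooth_on_imp_has_derivative[OF smooth_on_frechet_derivative[OF F] S(2)])
    note D = fun_cong[OF frechet_derivative_at[OF this], of u, symmetric]
    have "frechet_derivative ((\<lambda>q. dir_deriv \<A> f q (Z q)) \<circ> chart_inv c) (at x)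
      = frechet_derivative (\<lambda>z. \<Sum>b\<in>Basis. (comp Z z \<bullet> b) *\<^sub>R frechet_derivative F (at z) b) (at x)"
      by (rule frechet_derivative_cong_open[OF S eq])
    then have "dir_deriv \<A> (\<lambda>q. dir_deriv \<A> f q (Z q)) p u
      = (\<Sum>b\<in>Basis. (comp Z x \<bullet> b) *\<^sub>R frechet_derivative (\<lambda>z. frechet_derivative F (at z) b) (at x) u
         + (frechet_derivative (comp Z) (at x) u \<bullet> b) *\<^sub>R frechet_derivative F (at x) b)"
      unfolding chart_dir using D by simp
    also have "\<dots> = (\<Sum>b\<in>Basis. (Z p \<bullet> b) *\<^sub>R frechet_derivative (\<lambda>z. frechet_derivative F (at z) b) (at x) u)
        + frechet_derivative F (at x) (frechet_derivative (comp Z) (at x) u)"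
      by (subst linear_euclidean_expansion[OF linF[OF S(2)], of "frechet_derivative (comp Z) (at x) u"])
        (simp add: sum.distrib comp_x)
    also have "(\<Sum>b\<in>Basis. (Z p \<bullet> b) *\<^sub>R frechet_derivative (\<lambda>z. frechet_derivative F (at z) b) (at x) u)
        = frechet_derivative (\<lambda>z. frechet_derivative F (at z) (Z p)) (at x) u"
    proof -
      have "frechet_derivative (\<lambda>z. frechet_derivative F (at z) w) (at x) u
          = frechet_derivative (\<lambda>z. frechet_derivative F (at z) u) (at x) w" for w
        by (rule symmetric_second_derivative[OF S(1) F S(2)])
      moreover have "linear (frechet_derivative (\<lambda>z. frechet_derivative F (at z) u) (at x))"
        using smooth_on_imp_has_derivative[OF smooth_on_frechet_derivative[OF F] S(2)] by (rule has_derivative_linear)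
      ultimately show ?thesis
        using linear_euclidean_expansion[of "frechet_derivative (\<lambda>z. frechet_derivative F (at z) u) (at x)" "Z p"]
        by (simp only:)
    qed
    finally show ?thesis by simp
  qed
  have "lie_bracket \<A> X Y p = frechet_derivative (comp Y) (at x) (X p) - frechet_derivative (comp X) (at x) (Y p)"
    unfolding lie_bracket_def Let_def chart_dir[folded c_def] c_def[symmetric] comp_def ..
  moreover have "frechet_derivative (\<lambda>z. frechet_derivative F (at z) (Y p)) (at x) (X p)
      = frechet_derivative (\<lambda>z. frechet_derivative F (at z) (X p)) (at x) (Y p)"
    by (rule symmetric_second_derivative[OF S(1) F S(2)])
  ultimately show ?thesis
    unfolding second[OF X] second[OF Y] chart_dir[of f] F_def[symmetric]
    by (simp add: linear_diff[OF linF[OF S(2)]])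
qed

text \<open>The transition functions are the Jacobians of the chart transitions, hence
  smooth.\<close>

lemma vector_bundle_tangent: "vector_bundle \<A> (tangent_bundle \<A>)"
proof -
  have "smooth_fun \<A> (fst c \<inter> fst d) (\<lambda>p. dir_deriv \<A> (snd d) p (inv (dir_deriv \<A> (snd c) p) w))"
    if c: "c \<in> \<A>" and d: "d \<in> \<A>" for c d w
  proof (subst smooth_fun_cong)
    let ?S = "snd c ` (fst c \<inter> fst d)"
    have o: "open ?S" using open_chart_Int[OF c open_chart_domain[OF d]] .
    show o': "open (fst c \<inter> fst d)" using open_chart_domain[OF c] open_chart_domain[OF d] by auto
    show "dir_deriv \<A> (snd d) p (inv (dir_deriv \<A> (snd c) p) w)
        = frechet_derivative (snd d \<circ> chart_inv c) (at (snd c p)) w" if p: "p \<in> fst c \<inter> fst d" for p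
    proof -
      have "dir_deriv \<A> (snd c) p (inv (dir_deriv \<A> (snd c) p) w) = w"
        using dir_deriv_chart_bij(2)[OF c, of p] p by (simp add: bij_is_surj surj_f_inv_f)
      then show ?thesis
        using dir_deriv_chart[OF open_chart_domain[OF d] _ smooth_fun_chart[OF d] c, of p] p by simp
    qed
    show "smooth_fun \<A> (fst c \<inter> fst d) (\<lambda>p. frechet_derivative (snd d \<circ> chart_inv c) (at (snd c p)) w)"
      by (rule smooth_fun_compose[OF o' o smooth_on_frechet_derivative[OF smooth_transition[OF c d]]])
        (auto intro: smooth_fun_subset[OF smooth_fun_chart[OF c]])
  qed
  moreover have "(\<Union>t\<in>tangent_bundle \<A>. fst t) = UNIV"
    using chart_at_in in_chart_at unfolding tangent_bundle_def by fastforce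
  ultimately show ?thesis
    unfolding vector_bundle_def
    by (auto simp: tangent_bundle_def open_chart_domain dir_deriv_chart_bij)
qed

end

section \<open>Sections and connections\<close>

locale smooth_bundle = smooth_manifold \<A>
  for \<A> :: "('p::{t2_space,second_countable_topology}, 'n::finite) chart set" +
  fixes \<V> :: "('p, 'm::finite) triv set"
  assumes is_bundle: "vector_bundle \<A> \<V>"
begin

abbreviation sec :: "'p set \<Rightarrow> ('p \<Rightarrow> real ^ 'm) \<Rightarrow> bool" where
  "sec \<equiv> smooth_section \<A> \<V>"

lemma open_triv: "t \<in> \<V> \<Longrightarrow> open (fst t)"
  and linear_triv: "t \<in> \<V> \<Longrightarrow> p \<in> fst t \<Longrightarrow> linear (snd t p)"
  and bij_triv: "t \<in> \<V> \<Longrightarrow> p \<in> fst t \<Longrightarrow> bij (snd t p)"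
  and triv_transition: "t \<in> \<V> \<Longrightarrow> t' \<in> \<V> \<Longrightarrow> smooth_fun \<A> (fst t \<inter> fst t') (\<lambda>p. snd t' p (inv (snd t p) w))"
  using is_bundle unfolding vector_bundle_def by (auto simp: split_beta)

lemma ex_triv: obtains t where "t \<in> \<V>" "p \<in> fst t"
proof -
  have "p \<in> (\<Union>t\<in>\<V>. fst t)" using is_bundle unfolding vector_bundle_def by blast
  then show thesis using that by blast
qed

lemma secI: "(\<And>t. t \<in> \<V> \<Longrightarrow> smooth_fun \<A> (fst t \<inter> U) (\<lambda>p. snd t p (s p))) \<Longrightarrow> sec U s"
  and secD: "sec U s \<Longrightarrow> t \<in> \<V> \<Longrightarrow> smooth_fun \<A> (fst t \<inter> U) (\<lambda>p. snd t p (s p))"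
  unfolding smooth_section_def by auto

lemma sec_subset:
  assumes "sec U s" "W \<subseteq> U"
  shows "sec W s"
proof (intro secI)
  fix t assume "t \<in> \<V>"
  from secD[OF assms(1) this] show "smooth_fun \<A> (fst t \<inter> W) (\<lambda>p. snd t p (s p))"
    by (rule smooth_fun_subset) (use assms(2) in auto)
qed

lemma sec_cong:
  assumes "open U" "sec U s" "\<And>p. p \<in> U \<Longrightarrow> s p = s' p"
  shows "sec U s'"
proof (intro secI)
  fix t assume t: "t \<in> \<V>"
  show "smooth_fun \<A> (fst t \<inter> U) (\<lambda>p. snd t p (s' p))"
    by (rule iffD1[OF smooth_fun_cong secD[OF assms(2) t]]) (use open_triv[OF t] assms in auto)
qed

lemma sec_add:
  assumes "open U" "sec U s" "sec U s'"
  shows "sec U (\<lambda>p. s p + s' p)"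
proof (intro secI)
  fix t assume t: "t \<in> \<V>"
  have o: "open (fst t \<inter> U)" using open_triv[OF t] assms(1) by auto
  show "smooth_fun \<A> (fst t \<inter> U) (\<lambda>p. snd t p (s p + s' p))"
    by (rule iffD1[OF smooth_fun_cong smooth_fun_add[OF o secD[OF assms(2) t] secD[OF assms(3) t]]])
      (use o t in \<open>auto simp: linear_add linear_triv\<close>)
qed

lemma sec_scaleR:
  assumes "open U" "smooth_fun \<A> U f" "sec U s"
  shows "sec U (\<lambda>p. f p *\<^sub>R s p)"
proof (intro secI)
  fix t assume t: "t \<in> \<V>"
  have o: "open (fst t \<inter> U)" using open_triv[OF t] assms(1) by auto
  have f: "smooth_fun \<A> (fst t \<inter> U) f" using assms(2) by (rule smooth_fun_subset) auto
  show "smooth_fun \<A> (fst t \<inter> U) (\<lambda>p. snd t p (f p *\<^sub>R s p))"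
    by (rule iffD1[OF smooth_fun_cong smooth_fun_scaleR[OF o f secD[OF assms(3) t]]])
      (use o t in \<open>auto simp: linear_cmul linear_triv\<close>)
qed

lemma sec_zero: "sec U (\<lambda>p. 0)"
proof (intro secI)
  fix t assume t: "t \<in> \<V>"
  have "smooth_fun \<A> (fst t) (\<lambda>p. snd t p 0)"
    by (rule iffD1[OF smooth_fun_cong smooth_fun_const[of _ 0]])
      (use t open_triv in \<open>auto simp: linear_0 linear_triv\<close>)
  then show "smooth_fun \<A> (fst t \<inter> U) (\<lambda>p. snd t p 0)" by (rule smooth_fun_subset) auto
qed

lemma sec_cmul: "open U \<Longrightarrow> sec U s \<Longrightarrow> sec U (\<lambda>p. k *\<^sub>R s p)"
  using sec_scaleR[OF _ smooth_fun_const] .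

lemma sec_minus: "open U \<Longrightarrow> sec U s \<Longrightarrow> sec U (\<lambda>p. - s p)"
  using sec_cmul[of U s "-1"] by simp

lemma sec_diff: "open U \<Longrightarrow> sec U s \<Longrightarrow> sec U s' \<Longrightarrow> sec U (\<lambda>p. s p - s' p)"
  using sec_add[of U s "\<lambda>p. - s' p"] sec_minus by simp

lemma sec_sum:
  assumes "open U" "\<And>i. i \<in> I \<Longrightarrow> sec U (s i)"
  shows "sec U (\<lambda>p. \<Sum>i\<in>I. s i p)"
  using assms(2) by (induction I rule: infinite_finite_induct) (auto intro!: sec_add sec_zero assms(1))

lemma sec_local:
  assumes "\<And>p. p \<in> U \<Longrightarrow> \<exists>W. open W \<and> p \<in> W \<and> sec (U \<inter> W) s"
  shows "sec U s"
proof (intro secI smooth_fun_local)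
  fix t p assume t: "t \<in> \<V>" and p: "p \<in> fst t \<inter> U"
  then obtain W where W: "open W" "p \<in> W" "sec (U \<inter> W) s" using assms by blast
  then show "\<exists>W. open W \<and> p \<in> W \<and> smooth_fun \<A> (fst t \<inter> U \<inter> W) (\<lambda>p. snd t p (s p))"
    using secD[OF W(3) t] by (auto simp: Int_ac)
qed

section \<open>Local frames and extension of vectors\<close>

definition triv_frame :: "('p, 'm) triv \<Rightarrow> 'm \<Rightarrow> 'p \<Rightarrow> real ^ 'm" where
  "triv_frame t i q = inv (snd t q) (axis i 1)"

lemma sec_triv_frame: "t \<in> \<V> \<Longrightarrow> sec (fst t) (triv_frame t i)"
  unfolding triv_frame_def by (intro secI) (subst Int_commute, rule triv_transition)

lemma triv_frame_expand:
  assumes "t \<in> \<V>" "q \<in> fst t"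
  shows "w = (\<Sum>i\<in>UNIV. (snd t q w $ i) *\<^sub>R triv_frame t i q)"
proof -
  have b: "bij (snd t q)" and l: "linear (snd t q)" using assms bij_triv linear_triv by auto
  have "snd t q (\<Sum>i\<in>UNIV. (snd t q w $ i) *\<^sub>R triv_frame t i q)
      = (\<Sum>i\<in>UNIV. (snd t q w $ i) *\<^sub>R axis i 1)"
    unfolding triv_frame_def
    by (simp add: linear_sum[OF l] linear_cmul[OF l] bij_is_surj[OF b] surj_f_inv_f)
  also have "\<dots> = snd t q w"
    using basis_expansion[of "snd t q w"] by (simp add: scalar_mult_eq_scaleR)
  finally show ?thesis using bij_is_inj[OF b] unfolding inj_def by metis
qed

lemma smooth_triv_coeff:
  assumes "t \<in> \<V>" "open U" "sec U s"
  shows "smooth_fun \<A> (fst t \<inter> U) (\<lambda>q. snd t q (s q) $ i)"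
  by (rule smooth_fun_bounded_linear[OF bounded_linear_vec_nth _ secD[OF assms(3,1)]])
    (use open_triv[OF assms(1)] assms in auto)

text \<open>Constant coefficients in a local frame give the extension. Identities between tensors at
  a point are proved by extending the vectors in this way.\<close>

lemma sec_extend:
  obtains U s where "open U" "p \<in> U" "sec U s" "s p = w"
proof -
  obtain t where t: "t \<in> \<V>" "p \<in> fst t" by (rule ex_triv)
  show thesis
  proof (rule that)
    show "open (fst t)" using open_triv t by auto
    show "sec (fst t) (\<lambda>q. \<Sum>i\<in>UNIV. (snd t p w $ i) *\<^sub>R triv_frame t i q)"
      using open_triv t by (intro sec_sum sec_cmul sec_triv_frame) auto
    show "(\<Sum>i\<in>UNIV. (snd t p w $ i) *\<^sub>R triv_frame t i p) = w"
      by (rule triv_frame_expand[OF t, symmetric])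
  qed (rule t)
qed

end

locale bundle_connection = smooth_bundle \<A> \<V>
  for \<A> :: "('p::{t2_space,second_countable_topology}, 'n::finite) chart set"
    and \<V> :: "('p, 'm::finite) triv set" +
  fixes D :: "'p \<Rightarrow> real ^ 'n \<Rightarrow> ('p \<Rightarrow> real ^ 'm) \<Rightarrow> real ^ 'm"
  assumes conn: "connection \<A> \<V> D"
begin

lemmas conn_axioms = conn[unfolded connection_def]

lemma D_linear: "open U \<Longrightarrow> p \<in> U \<Longrightarrow> sec U s \<Longrightarrow> linear (\<lambda>v. D p v s)"
  using conjunct1[OF conn_axioms] by blast

lemma D_add: "open U \<Longrightarrow> p \<in> U \<Longrightarrow> sec U s \<Longrightarrow> sec U s' \<Longrightarrow>
    D p v (\<lambda>q. s q + s' q) = D p v s + D p v s'"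
  using conjunct1[OF conjunct2[OF conn_axioms]] by blast

lemma D_scaleR: "open U \<Longrightarrow> p \<in> U \<Longrightarrow> smooth_fun \<A> U f \<Longrightarrow> sec U s \<Longrightarrow>
    D p v (\<lambda>q. f q *\<^sub>R s q) = f p *\<^sub>R D p v s + dir_deriv \<A> f p v *\<^sub>R s p"
  using conjunct1[OF conjunct2[OF conjunct2[OF conn_axioms]]] by blast

lemma D_smooth: "open U \<Longrightarrow> vector_field \<A> U X \<Longrightarrow> sec U s \<Longrightarrow> sec U (\<lambda>p. D p (X p) s)"
  using conjunct2[OF conjunct2[OF conjunct2[OF conn_axioms]]] by blast

text \<open>Both sections become equal everywhere after multiplication with the indicator function of \<open>U\<close>,
  which is smooth on \<open>U\<close>.\<close>

lemma D_cong:
  assumes "open U" "p \<in> U" "sec U s" "\<And>q. q \<in> U \<Longrightarrow> s q = s' q"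
  shows "D p v s = D p v s'"
proof -
  define f where "f q = (if q \<in> U then 1 else 0 :: real)" for q
  have f: "smooth_fun \<A> U f"
    by (rule iffD1[OF smooth_fun_cong[OF assms(1)] smooth_fun_const[of _ 1]]) (simp add: f_def)
  have df: "dir_deriv \<A> f p v = 0"
    using dir_deriv_cong[OF assms(1,2), of f "\<lambda>_. 1"] by (simp add: f_def dir_deriv_const)
  have s': "sec U s'" using sec_cong[OF assms(1,3,4)] .
  have "(\<lambda>q. f q *\<^sub>R s q) = (\<lambda>q. f q *\<^sub>R s' q)" using assms(4) by (auto simp: f_def)
  then show ?thesis
    using D_scaleR[OF assms(1,2) f assms(3), of v] D_scaleR[OF assms(1,2) f s', of v] assms(2)
    by (simp add: df f_def)
qed

lemma D_cmul: "open U \<Longrightarrow> p \<in> U \<Longrightarrow> sec U s \<Longrightarrow> D p v (\<lambda>q. k *\<^sub>R s q) = k *\<^sub>R D p v s"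
  using D_scaleR[OF _ _ smooth_fun_const] by (simp add: dir_deriv_const)

lemma D_minus: "open U \<Longrightarrow> p \<in> U \<Longrightarrow> sec U s \<Longrightarrow> D p v (\<lambda>q. - s q) = - D p v s"
  using D_cmul[of U p s v "-1"] by simp

lemma D_diff: "open U \<Longrightarrow> p \<in> U \<Longrightarrow> sec U s \<Longrightarrow> sec U s' \<Longrightarrow>
    D p v (\<lambda>q. s q - s' q) = D p v s - D p v s'"
  using D_add[of U p s "\<lambda>p. - s' p"] sec_minus D_minus by simp

lemma D_zero: "D p v (\<lambda>q. 0) = 0"
  using D_cmul[of UNIV p "\<lambda>q. 0" v 0] sec_zero by simp

lemma D_sum:
  assumes "open U" "p \<in> U" "\<And>i. i \<in> I \<Longrightarrow> sec U (s i)"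
  shows "D p v (\<lambda>q. \<Sum>i\<in>I. s i q) = (\<Sum>i\<in>I. D p v (s i))"
  using assms(3) by (induction I rule: infinite_finite_induct)
    (auto simp: D_zero D_add[OF assms(1,2)] sec_sum[OF assms(1)])

lemma D_lin_simps:
  assumes "open U" "p \<in> U" "sec U s"
  shows "D p (u + v) s = D p u s + D p v s" "D p (u - v) s = D p u s - D p v s"
    "D p (k *\<^sub>R u) s = k *\<^sub>R D p u s" "D p (- u) s = - D p u s"
  using linear_add[OF D_linear[OF assms]] linear_diff[OF D_linear[OF assms]]
    linear_cmul[OF D_linear[OF assms]] linear_neg[OF D_linear[OF assms]] by blast+

section \<open>Tensoriality of the curvature\<close>

lemma curvature_cong:
  assumes "open U" "p \<in> U" "vector_field \<A> U X" "vector_field \<A> U Y" "sec U s" "\<And>q. q \<in> U \<Longrightarrow> s q = s' q"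
  shows "curvature \<A> D X Y s p = curvature \<A> D X Y s' p"
proof -
  have "D p (X p) (\<lambda>q. D q (Y q) s) = D p (X p) (\<lambda>q. D q (Y q) s')"
    by (intro D_cong[OF assms(1,2)] D_smooth assms(1,4,5) D_cong[OF assms(1) _ assms(5,6)])
  moreover have "D p (Y p) (\<lambda>q. D q (X q) s) = D p (Y p) (\<lambda>q. D q (X q) s')"
    by (intro D_cong[OF assms(1,2)] D_smooth assms(1,3,5) D_cong[OF assms(1) _ assms(5,6)])
  ultimately show ?thesis
    unfolding curvature_def using D_cong[OF assms(1,2,5,6)] by simp
qed

lemma curvature_add:
  assumes "open U" "p \<in> U" "vector_field \<A> U X" "vector_field \<A> U Y" "sec U s" "sec U s'"
  shows "curvature \<A> D X Y (\<lambda>q. s q + s' q) p = curvature \<A> D X Y s p + curvature \<A> D X Y s' p"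
proof -
  have *: "D p v (\<lambda>q. D q (Z q) (\<lambda>q. s q + s' q)) = D p v (\<lambda>q. D q (Z q) s) + D p v (\<lambda>q. D q (Z q) s')"
    if "vector_field \<A> U Z" for Z v
  proof -
    have "D p v (\<lambda>q. D q (Z q) (\<lambda>q. s q + s' q)) = D p v (\<lambda>q. D q (Z q) s + D q (Z q) s')"
      by (intro D_cong[OF assms(1,2)] D_smooth assms that sec_add D_add[OF assms(1)])
    then show ?thesis using D_add[OF assms(1,2)] D_smooth assms that by simp
  qed
  show ?thesis unfolding curvature_def using *[OF assms(3)] *[OF assms(4)] D_add[OF assms(1,2,5,6)] by simp
qed

lemma D_D_scaleR:
  assumes "open U" "p \<in> U" "vector_field \<A> U Z" "smooth_fun \<A> U f" "sec U s"
  shows "D p v (\<lambda>q. D q (Z q) (\<lambda>q. f q *\<^sub>R s q))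
    = f p *\<^sub>R D p v (\<lambda>q. D q (Z q) s) + dir_deriv \<A> f p v *\<^sub>R D p (Z p) s
      + (dir_deriv \<A> f p (Z p) *\<^sub>R D p v s + dir_deriv \<A> (\<lambda>q. dir_deriv \<A> f q (Z q)) p v *\<^sub>R s p)"
proof -
  have dZ: "smooth_fun \<A> U (\<lambda>q. dir_deriv \<A> f q (Z q))" using dir_deriv_smooth assms by blast
  have "D p v (\<lambda>q. D q (Z q) (\<lambda>q. f q *\<^sub>R s q))
    = D p v (\<lambda>q. f q *\<^sub>R D q (Z q) s + dir_deriv \<A> f q (Z q) *\<^sub>R s q)"
    by (intro D_cong[OF assms(1,2)] D_smooth assms sec_scaleR D_scaleR[OF assms(1)])
  also have "\<dots> = D p v (\<lambda>q. f q *\<^sub>R D q (Z q) s) + D p v (\<lambda>q. dir_deriv \<A> f q (Z q) *\<^sub>R s q)"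
    by (intro D_add[OF assms(1,2)] sec_scaleR D_smooth assms dZ)
  finally show ?thesis
    using D_scaleR[OF assms(1,2) dZ assms(5)] D_scaleR[OF assms(1,2,4) D_smooth[OF assms(1,3,5)]] by simp
qed

text \<open>The first derivatives of \<open>f\<close> cancel by antisymmetry in \<open>X\<close> and
  \<open>Y\<close>, the second ones against the derivative of \<open>f\<close> along the
  bracket.\<close>

lemma curvature_scaleR:
  assumes "open U" "p \<in> U" "vector_field \<A> U X" "vector_field \<A> U Y" "smooth_fun \<A> U f" "sec U s"
  shows "curvature \<A> D X Y (\<lambda>q. f q *\<^sub>R s q) p = f p *\<^sub>R curvature \<A> D X Y s p"
  unfolding curvature_def D_D_scaleR[OF assms(1,2,3,5,6)] D_D_scaleR[OF assms(1,2,4,5,6)]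
    D_scaleR[OF assms(1,2,5,6)] dir_deriv_lie_bracket[OF assms(1,2,5,3,4)]
  by (simp add: algebra_simps)

text \<open>The Leibniz rule of the bracket is taken as the hypothesis \<open>br\<close>. It is
  supplied later from a torsion-free connection, which avoids a computation in charts.\<close>

lemma curvature_lie_bracket_scaleR:
  assumes "open U" "p \<in> U" "vector_field \<A> U X" "vector_field \<A> U Y" "smooth_fun \<A> U f" "sec U s"
    and br: "lie_bracket \<A> (\<lambda>q. f q *\<^sub>R X q) Y p = f p *\<^sub>R lie_bracket \<A> X Y p - dir_deriv \<A> f p (Y p) *\<^sub>R X p"
  shows "curvature \<A> D (\<lambda>q. f q *\<^sub>R X q) Y s p = f p *\<^sub>R curvature \<A> D X Y s p"
proof -
  have DX: "sec U (\<lambda>q. D q (X q) s)" and DY: "sec U (\<lambda>q. D q (Y q) s)" using D_smooth assms by blast+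
  have "D p (Y p) (\<lambda>q. D q (f q *\<^sub>R X q) s) = D p (Y p) (\<lambda>q. f q *\<^sub>R D q (X q) s)"
    by (rule D_cong[symmetric, OF assms(1,2) sec_scaleR[OF assms(1,5) DX]])
      (simp add: D_lin_simps[OF assms(1) _ assms(6)])
  then show ?thesis
    unfolding curvature_def br D_scaleR[OF assms(1,2,5) DX]
      D_lin_simps[OF assms(1,2,6)] D_lin_simps[OF assms(1,2) DY]
    by (simp add: algebra_simps)
qed

end

text \<open>No signature is fixed, so that the Riemannian metric \<open>g\<close>, the ambient
  metric and its pull-back are all instances.\<close>

locale metric_bundle_connection = bundle_connection \<A> \<V> D
  for \<A> :: "('p::{t2_space,second_countable_topology}, 'n::finite) chart set"
    and \<V> :: "('p, 'm::finite) triv set"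
    and D :: "'p \<Rightarrow> real ^ 'n \<Rightarrow> ('p \<Rightarrow> real ^ 'm) \<Rightarrow> real ^ 'm" +
  fixes h :: "'p \<Rightarrow> real ^ 'm \<Rightarrow> real ^ 'm \<Rightarrow> real"
  assumes h_bilinear: "bilinear (h p)" and h_sym: "h p w w' = h p w' w"
    and h_smooth: "open U \<Longrightarrow> smooth_section \<A> \<V> U s \<Longrightarrow> smooth_section \<A> \<V> U s' \<Longrightarrow>
      smooth_fun \<A> U (\<lambda>q. h q (s q) (s' q))"
    and D_metric: "open U \<Longrightarrow> p \<in> U \<Longrightarrow> smooth_section \<A> \<V> U s \<Longrightarrow> smooth_section \<A> \<V> U s' \<Longrightarrow>
      dir_deriv \<A> (\<lambda>q. h q (s q) (s' q)) p v = h p (D p v s) (s' p) + h p (s p) (D p v s')"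
begin

lemmas h_simps = bilinear_ladd[OF h_bilinear] bilinear_radd[OF h_bilinear]
  bilinear_lsub[OF h_bilinear] bilinear_rsub[OF h_bilinear]
  bilinear_lmul[OF h_bilinear] bilinear_rmul[OF h_bilinear]
  bilinear_lneg[OF h_bilinear] bilinear_rneg[OF h_bilinear]
  bilinear_lzero[OF h_bilinear] bilinear_rzero[OF h_bilinear]

text \<open>The commutator identity for directional derivatives is applied to the function
  \<open>h q (s q) (s' q)\<close>. After expanding with the metric property, the products of two
  first derivatives cancel in the difference.\<close>

lemma curvature_skew:
  assumes "open U" "p \<in> U" "vector_field \<A> U X" "vector_field \<A> U Y" "sec U s" "sec U s'"
  shows "h p (curvature \<A> D X Y s p) (s' p) = - h p (s p) (curvature \<A> D X Y s' p)"
proof -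
  have *: "dir_deriv \<A> (\<lambda>q. dir_deriv \<A> (\<lambda>q. h q (s q) (s' q)) q (Z q)) p v
     = h p (D p v (\<lambda>q. D q (Z q) s)) (s' p) + h p (D p (Z p) s) (D p v s')
     + (h p (D p v s) (D p (Z p) s') + h p (s p) (D p v (\<lambda>q. D q (Z q) s')))"
    if Z: "vector_field \<A> U Z" for Z v
  proof -
    have "dir_deriv \<A> (\<lambda>q. dir_deriv \<A> (\<lambda>q. h q (s q) (s' q)) q (Z q)) p v
      = dir_deriv \<A> (\<lambda>q. h q (D q (Z q) s) (s' q) + h q (s q) (D q (Z q) s')) p v"
      by (rule dir_deriv_cong[OF assms(1,2)]) (rule D_metric[OF assms(1) _ assms(5,6)])
    also have "\<dots> = dir_deriv \<A> (\<lambda>q. h q (D q (Z q) s) (s' q)) p v + dir_deriv \<A> (\<lambda>q. h q (s q) (D q (Z q) s')) p v"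
      by (intro dir_deriv_add[OF assms(1,2)] h_smooth assms D_smooth Z)
    finally show ?thesis
      using D_metric[OF assms(1,2) D_smooth[OF assms(1) Z assms(5)] assms(6)]
        D_metric[OF assms(1,2,5) D_smooth[OF assms(1) Z assms(6)]] by simp
  qed
  show ?thesis
    using dir_deriv_lie_bracket[OF assms(1,2) h_smooth[OF assms(1,5,6)] assms(3,4)]
    unfolding *[OF assms(3)] *[OF assms(4)] D_metric[OF assms(1,2,5,6)] curvature_def
    by (simp add: h_simps algebra_simps)
qed

end

lemma metric_bundle_connectionI:
  assumes "smooth_atlas \<A>" "vector_bundle \<A> \<V>" "bundle_metric \<A> \<V> k l h" "metric_connection \<A> \<V> h D"
  shows "metric_bundle_connection \<A> \<V> D h"
proof
  show "smooth_atlas \<A>" "vector_bundle \<A> \<V>" by fact+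
  show "connection \<A> \<V> D" using assms(4) unfolding metric_connection_def by (rule conjunct1)
  have sig: "has_signature (h p) k l" for p
    using assms(3) unfolding bundle_metric_def by blast
  show "bilinear (h p)" for p using sig[of p] unfolding has_signature_def by (rule conjunct1)
  show "h p w w' = h p w' w" for p w w' using sig[of p] unfolding has_signature_def by blast
  show "smooth_fun \<A> U (\<lambda>q. h q (s q) (s' q))"
    if "open U" "smooth_section \<A> \<V> U s" "smooth_section \<A> \<V> U s'" for U s s'
    using conjunct2[OF assms(3)[unfolded bundle_metric_def]] that by blast
  show "dir_deriv \<A> (\<lambda>q. h q (s q) (s' q)) p v = h p (D p v s) (s' p) + h p (s p) (D p v s')"
    if "open U" "p \<in> U" "smooth_section \<A> \<V> U s" "smooth_section \<A> \<V> U s'" for U p v s s'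
    using conjunct2[OF assms(4)[unfolded metric_connection_def]] that by blast
qed

section \<open>The pull-back of the tangent bundle along a smooth map\<close>

context smooth_manifold
begin

lemma dir_deriv_compose:
  assumes "open U" "p \<in> U" "smooth_fun \<A> U H" "(F has_derivative F') (at (H p))"
  shows "dir_deriv \<A> (\<lambda>q. F (H q)) p v = F' (dir_deriv \<A> H p v)"
proof (rule dir_deriv_eqI)
  let ?c = "chart_at \<A> p"
  have "(F has_derivative F') (at ((H \<circ> chart_inv ?c) (snd ?c p)))"
    using assms(4) by (simp add: chart_inv_chart chart_at_in in_chart_at)
  from has_derivative_compose[OF dir_deriv_has_derivative[OF assms(1-3)] this]
  show "((\<lambda>q. F (H q)) \<circ> chart_inv ?c has_derivative (\<lambda>v. F' (dir_deriv \<A> H p v))) (at (snd ?c p))"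
    by (simp add: o_def)
qed

lemma smooth_bundle_tangent: "smooth_bundle \<A> (tangent_bundle \<A>)"
  by unfold_locales (rule vector_bundle_tangent)

lemma tangent_triv: "c \<in> \<A> \<Longrightarrow> (fst c, \<lambda>p v. dir_deriv \<A> (snd c) p v) \<in> tangent_bundle \<A>"
  unfolding tangent_bundle_def by auto

end

locale smooth_mapping = M: smooth_manifold \<A> + N: smooth_manifold \<B>
  for \<A> :: "('p::{t2_space,second_countable_topology}, 'n::finite) chart set"
    and \<B> :: "('q::{t2_space,second_countable_topology}, 'm::finite) chart set" +
  fixes \<Psi> :: "'p \<Rightarrow> 'q"
  assumes smooth_map: "smooth_map \<A> \<B> \<Psi>"
begin

abbreviation d\<Psi> :: "'p \<Rightarrow> real ^ 'n \<Rightarrow> real ^ 'm" where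
  "d\<Psi> \<equiv> differential \<A> \<B> \<Psi>"

lemma open_vimage_map: "open V \<Longrightarrow> open (\<Psi> -` V)"
  using smooth_map unfolding smooth_map_def by (simp add: open_vimage)

lemma smooth_chart_map: "d \<in> \<B> \<Longrightarrow> smooth_fun \<A> (\<Psi> -` fst d) (snd d \<circ> \<Psi>)"
  using smooth_map unfolding smooth_map_def smooth_fun_def by blast

lemma smooth_fun_pull:
  assumes "open V" "smooth_fun \<B> V f"
  shows "smooth_fun \<A> (\<Psi> -` V) (f \<circ> \<Psi>)"
proof (rule M.smooth_fun_local)
  fix p assume p: "p \<in> \<Psi> -` V"
  define d where "d = chart_at \<B> (\<Psi> p)"
  have d: "d \<in> \<B>" "\<Psi> p \<in> fst d" unfolding d_def using N.chart_at_in N.in_chart_at by auto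
  let ?W = "\<Psi> -` V \<inter> \<Psi> -` fst d"
  have oW: "open ?W" using assms(1) d open_vimage_map N.open_chart_domain[OF d(1)] by auto
  have "smooth_fun \<A> ?W (\<lambda>q. (f \<circ> chart_inv d) ((snd d \<circ> \<Psi>) q))"
    by (rule M.smooth_fun_compose[OF oW N.open_chart_Int[OF d(1) assms(1)] N.smooth_funD[OF assms(2) d(1)]])
      (rule M.smooth_fun_subset[OF smooth_chart_map[OF d(1)]], auto)
  then have "smooth_fun \<A> ?W (f \<circ> \<Psi>)"
    by (rule iffD1[OF M.smooth_fun_cong[OF oW], rotated]) (simp add: N.chart_inv_chart[OF d(1)])
  then show "\<exists>W. open W \<and> p \<in> W \<and> smooth_fun \<A> (\<Psi> -` V \<inter> W) (f \<circ> \<Psi>)"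
    using open_vimage_map[OF N.open_chart_domain[OF d(1)]] d(2) by blast
qed

text \<open>\<open>differential\<close> and \<open>dir_deriv \<B>\<close> use the same selected
  chart at \<open>\<Psi> p\<close>, so this is the chain rule for the factorization through that
  chart.\<close>

lemma dir_deriv_pull:
  assumes "open V" "\<Psi> p \<in> V" "smooth_fun \<B> V f"
  shows "dir_deriv \<A> (f \<circ> \<Psi>) p v = dir_deriv \<B> f (\<Psi> p) (d\<Psi> p v)"
proof -
  define d where "d = chart_at \<B> (\<Psi> p)"
  have d: "d \<in> \<B>" "\<Psi> p \<in> fst d" unfolding d_def using N.chart_at_in N.in_chart_at by auto
  have o: "open (\<Psi> -` fst d)" using open_vimage_map N.open_chart_domain d by blast
  have "dir_deriv \<A> (f \<circ> \<Psi>) p v = dir_deriv \<A> (\<lambda>q. (f \<circ> chart_inv d) ((snd d \<circ> \<Psi>) q)) p v"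
    by (rule M.dir_deriv_cong[OF o]) (use d in \<open>auto simp: N.chart_inv_chart\<close>)
  also have "\<dots> = frechet_derivative (f \<circ> chart_inv d) (at (snd d (\<Psi> p))) (dir_deriv \<A> (snd d \<circ> \<Psi>) p v)"
    by (rule M.dir_deriv_compose[OF o _ smooth_chart_map[OF d(1)]])
      (use d N.smooth_fun_has_derivative[OF assms d] in \<open>simp_all add: o_def\<close>)
  finally show ?thesis unfolding differential_def dir_deriv_def[of \<B>] d_def .
qed

lemma linear_differential: "linear (d\<Psi> p)"
proof -
  have "linear (dir_deriv \<A> (snd (chart_at \<B> (\<Psi> p)) \<circ> \<Psi>) p)"
    by (rule M.dir_deriv_linear[OF _ _ smooth_chart_map[OF N.chart_at_in]])
      (auto simp: N.in_chart_at open_vimage_map N.open_chart_domain[OF N.chart_at_in])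
  then show ?thesis unfolding differential_def by (simp add: eta_contract_eq)
qed

lemma vector_bundle_pullback:
  assumes "vector_bundle \<B> \<V>"
  shows "vector_bundle \<A> (pullback_bundle \<Psi> \<V>)"
proof -
  interpret V: smooth_bundle \<B> \<V> using assms by unfold_locales
  have *: "pullback_bundle \<Psi> \<V> = (\<lambda>t. (\<Psi> -` fst t, snd t \<circ> \<Psi>)) ` \<V>"
    unfolding pullback_bundle_def by (simp add: split_beta)
  have "\<exists>t\<in>\<V>. \<Psi> p \<in> fst t" for p using V.ex_triv by metis
  moreover have "smooth_fun \<A> (\<Psi> -` fst t \<inter> \<Psi> -` fst t') (\<lambda>p. snd t' (\<Psi> p) (inv (snd t (\<Psi> p)) w))"
    if "t \<in> \<V>" "t' \<in> \<V>" for t t' w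
  proof -
    have "open (fst t \<inter> fst t')" using V.open_triv[OF that(1)] V.open_triv[OF that(2)] by auto
    from smooth_fun_pull[OF this V.triv_transition[OF that, of w]] show ?thesis by (simp add: o_def)
  qed
  ultimately show ?thesis
    unfolding vector_bundle_def *
    by (auto simp: split_beta open_vimage_map V.open_triv V.linear_triv V.bij_triv)
qed

sublocale TM: smooth_bundle \<A> "tangent_bundle \<A>"
  by (rule M.smooth_bundle_tangent)

sublocale TN: smooth_bundle \<B> "tangent_bundle \<B>"
  by (rule N.smooth_bundle_tangent)

sublocale PB: smooth_bundle \<A> "pullback_bundle \<Psi> (tangent_bundle \<B>)"
  by unfold_locales (rule vector_bundle_pullback[OF N.vector_bundle_tangent])

lemma pullback_triv: "t \<in> tangent_bundle \<B> \<Longrightarrow> (\<Psi> -` fst t, snd t \<circ> \<Psi>) \<in> pullback_bundle \<Psi> (tangent_bundle \<B>)"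
  unfolding pullback_bundle_def by force

lemma pullback_tangent_triv_cases:
  assumes "t \<in> pullback_bundle \<Psi> (tangent_bundle \<B>)"
  obtains d where "d \<in> \<B>" "t = (\<Psi> -` fst d, \<lambda>p v. dir_deriv \<B> (snd d) (\<Psi> p) v)"
  using assms unfolding pullback_bundle_def tangent_bundle_def by (auto simp: o_def)

lemma sec_pull:
  assumes "open V" "TN.sec V Z"
  shows "PB.sec (\<Psi> -` V) (Z \<circ> \<Psi>)"
proof (rule PB.secI)
  fix t assume "t \<in> pullback_bundle \<Psi> (tangent_bundle \<B>)"
  then obtain d where d: "d \<in> \<B>" "t = (\<Psi> -` fst d, \<lambda>p v. dir_deriv \<B> (snd d) (\<Psi> p) v)"
    by (rule pullback_tangent_triv_cases)
  have "open (fst d \<inter> V)" using N.open_chart_domain[OF d(1)] assms(1) by auto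
  from smooth_fun_pull[OF this] TN.secD[OF assms(2) N.tangent_triv[OF d(1)]]
  show "smooth_fun \<A> (fst t \<inter> \<Psi> -` V) (\<lambda>p. snd t p ((Z \<circ> \<Psi>) p))"
    by (simp add: d(2) o_def)
qed

text \<open>The components of \<open>d\<Psi> p (X p)\<close> in a chart \<open>d\<close> are the
  derivatives of \<open>snd d \<circ> \<Psi>\<close> along \<open>X\<close>.\<close>

lemma sec_differential:
  assumes "open U" "TM.sec U X"
  shows "PB.sec U (\<lambda>p. d\<Psi> p (X p))"
proof (rule PB.secI)
  fix t assume "t \<in> pullback_bundle \<Psi> (tangent_bundle \<B>)"
  then obtain d where d: "d \<in> \<B>" "t = (\<Psi> -` fst d, \<lambda>p v. dir_deriv \<B> (snd d) (\<Psi> p) v)"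
    by (rule pullback_tangent_triv_cases)
  have o: "open (\<Psi> -` fst d \<inter> U)" using open_vimage_map[OF N.open_chart_domain[OF d(1)]] assms(1) by auto
  have "smooth_fun \<A> (\<Psi> -` fst d \<inter> U) (\<lambda>p. dir_deriv \<A> (snd d \<circ> \<Psi>) p (X p))"
    by (rule M.dir_deriv_smooth[OF o M.smooth_fun_subset[OF smooth_chart_map[OF d(1)]] TM.sec_subset[OF assms(2)]]) auto
  then have "smooth_fun \<A> (\<Psi> -` fst d \<inter> U) (\<lambda>p. dir_deriv \<B> (snd d) (\<Psi> p) (d\<Psi> p (X p)))"
    by (rule iffD1[OF M.smooth_fun_cong[OF o], rotated])
      (simp add: dir_deriv_pull[OF N.open_chart_domain[OF d(1)] _ N.smooth_fun_chart[OF d(1)]])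
  then show "smooth_fun \<A> (fst t \<inter> U) (\<lambda>p. snd t p (d\<Psi> p (X p)))"
    by (simp add: d(2))
qed

lemma pullback_frame:
  assumes "t \<in> tangent_bundle \<B>" "open U" "PB.sec U s"
  shows "smooth_fun \<A> (\<Psi> -` fst t \<inter> U) (\<lambda>q. snd t (\<Psi> q) (s q) $ i)"
    and "q \<in> \<Psi> -` fst t \<Longrightarrow> s q = (\<Sum>i\<in>UNIV. (snd t (\<Psi> q) (s q) $ i) *\<^sub>R TN.triv_frame t i (\<Psi> q))"
  using PB.smooth_triv_coeff[OF pullback_triv[OF assms(1)] assms(2,3)]
    TN.triv_frame_expand[OF assms(1)] by auto

end

section \<open>Metric property and torsion of the pull-back connection\<close>

locale pullback_levi_civita = smooth_mapping \<A> \<B> \<Psi>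
  for \<A> :: "('p::{t2_space,second_countable_topology}, 'n::finite) chart set"
    and \<B> :: "('q::{t2_space,second_countable_topology}, 'm::finite) chart set"
    and \<Psi> :: "'p \<Rightarrow> 'q" +
  fixes G :: "'q \<Rightarrow> real ^ 'm \<Rightarrow> real ^ 'm \<Rightarrow> real"
    and DN :: "'q \<Rightarrow> real ^ 'm \<Rightarrow> ('q \<Rightarrow> real ^ 'm) \<Rightarrow> real ^ 'm"
    and D :: "'p \<Rightarrow> real ^ 'n \<Rightarrow> ('p \<Rightarrow> real ^ 'm) \<Rightarrow> real ^ 'm"
    and k l :: nat
  assumes G: "bundle_metric \<B> (tangent_bundle \<B>) k l G"
    and DN: "levi_civita \<B> G DN"
    and D: "pullback_connection \<A> \<B> \<Psi> (tangent_bundle \<B>) DN D"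
begin

sublocale NC: metric_bundle_connection \<B> "tangent_bundle \<B>" DN G
  using DN unfolding levi_civita_def
  by (intro metric_bundle_connectionI[OF N.atlas TN.is_bundle G]) blast

sublocale PC: bundle_connection \<A> "pullback_bundle \<Psi> (tangent_bundle \<B>)" D
  using D unfolding pullback_connection_def by unfold_locales blast

lemma D_pull: "open V \<Longrightarrow> \<Psi> p \<in> V \<Longrightarrow> TN.sec V Z \<Longrightarrow> D p v (Z \<circ> \<Psi>) = DN (\<Psi> p) (d\<Psi> p v) Z"
  using conjunct2[OF D[unfolded pullback_connection_def]] by blast

lemma DN_torsion: "open U \<Longrightarrow> p \<in> U \<Longrightarrow> TN.sec U X \<Longrightarrow> TN.sec U Y \<Longrightarrow>
    DN p (X p) Y - DN p (Y p) X = lie_bracket \<B> X Y p"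
  using conjunct2[OF DN[unfolded levi_civita_def]] by blast

text \<open>A section along \<Psi> need not come from a field on the ambient manifold, but the frame
  does. The Leibniz rule then reduces \<open>D\<close> to the frame, where its defining property
  applies.\<close>

lemma D_expand:
  assumes "t \<in> tangent_bundle \<B>" "open U" "PB.sec U s" "p \<in> U" "\<Psi> p \<in> fst t"
  shows "D p v s = (\<Sum>i\<in>UNIV. (snd t (\<Psi> p) (s p) $ i) *\<^sub>R DN (\<Psi> p) (d\<Psi> p v) (TN.triv_frame t i)
    + dir_deriv \<A> (\<lambda>q. snd t (\<Psi> q) (s q) $ i) p v *\<^sub>R TN.triv_frame t i (\<Psi> p))"
proof -
  let ?W = "\<Psi> -` fst t \<inter> U"
  let ?a = "\<lambda>i q. snd t (\<Psi> q) (s q) $ i"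
  let ?e = "\<lambda>i. TN.triv_frame t i \<circ> \<Psi>"
  have oV: "open (fst t)" using TN.open_triv assms by auto
  have oW: "open ?W" using open_vimage_map[OF oV] assms by auto
  have e: "PB.sec ?W (?e i)" for i
    using sec_pull[OF oV TN.sec_triv_frame[OF assms(1)]] by (rule PB.sec_subset) auto
  have a: "smooth_fun \<A> ?W (?a i)" for i
    using pullback_frame(1)[OF assms(1-3)] .
  have "D p v s = D p v (\<lambda>q. \<Sum>i\<in>UNIV. ?a i q *\<^sub>R ?e i q)"
    by (rule PC.D_cong[OF oW _ PB.sec_subset[OF assms(3)]])
      (use assms(4,5) pullback_frame(2)[OF assms(1-3)] in auto)
  also have "\<dots> = (\<Sum>i\<in>UNIV. D p v (\<lambda>q. ?a i q *\<^sub>R ?e i q))"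
    using assms(4,5) by (intro PC.D_sum[OF oW] PB.sec_scaleR oW a e) auto
  also have "\<dots> = (\<Sum>i\<in>UNIV. ?a i p *\<^sub>R D p v (?e i) + dir_deriv \<A> (?a i) p v *\<^sub>R ?e i p)"
    using assms(4,5) by (intro sum.cong refl PC.D_scaleR[OF oW _ a e]) auto
  finally show ?thesis
    using D_pull[OF oV assms(5) TN.sec_triv_frame[OF assms(1)]] by simp
qed

lemma pullback_metric_expand:
  assumes "t \<in> tangent_bundle \<B>" "open U" "PB.sec U s" "PB.sec U s'" "q \<in> \<Psi> -` fst t"
  shows "G (\<Psi> q) (s q) (s' q) = (\<Sum>i\<in>UNIV. \<Sum>j\<in>UNIV. (snd t (\<Psi> q) (s q) $ i * snd t (\<Psi> q) (s' q) $ j)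
      * ((\<lambda>z. G z (TN.triv_frame t i z) (TN.triv_frame t j z)) \<circ> \<Psi>) q)"
proof -
  have "G (\<Psi> q) (s q) (s' q)
      = G (\<Psi> q) (\<Sum>i\<in>UNIV. (snd t (\<Psi> q) (s q) $ i) *\<^sub>R TN.triv_frame t i (\<Psi> q))
          (\<Sum>i\<in>UNIV. (snd t (\<Psi> q) (s' q) $ i) *\<^sub>R TN.triv_frame t i (\<Psi> q))"
    using pullback_frame(2)[OF assms(1-3,5)] pullback_frame(2)[OF assms(1,2,4,5)] by simp
  also have "\<dots> = (\<Sum>(i,j)\<in>UNIV \<times> UNIV. G (\<Psi> q) ((snd t (\<Psi> q) (s q) $ i) *\<^sub>R TN.triv_frame t i (\<Psi> q))
      ((snd t (\<Psi> q) (s' q) $ j) *\<^sub>R TN.triv_frame t j (\<Psi> q)))"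
    by (rule bilinear_sum[OF NC.h_bilinear])
  finally show ?thesis
    by (simp add: NC.h_simps sum.cartesian_product mult.commute mult.left_commute)
qed

lemma pullback_metric_smooth:
  assumes "open U" "PB.sec U s" "PB.sec U s'"
  shows "smooth_fun \<A> U (\<lambda>q. G (\<Psi> q) (s q) (s' q))"
proof (rule M.smooth_fun_local)
  fix p assume "p \<in> U"
  obtain t where t: "t \<in> tangent_bundle \<B>" "\<Psi> p \<in> fst t" using TN.ex_triv by blast
  have oV: "open (fst t)" using TN.open_triv t by auto
  have oW: "open (\<Psi> -` fst t \<inter> U)" using open_vimage_map[OF oV] assms by auto
  have g: "smooth_fun \<A> (\<Psi> -` fst t \<inter> U) ((\<lambda>z. G z (TN.triv_frame t i z) (TN.triv_frame t j z)) \<circ> \<Psi>)" for i j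
    by (rule M.smooth_fun_subset[OF smooth_fun_pull[OF oV NC.h_smooth[OF oV]]])
      (auto intro: TN.sec_triv_frame t)
  have "smooth_fun \<A> (\<Psi> -` fst t \<inter> U) (\<lambda>q. G (\<Psi> q) (s q) (s' q))"
    by (subst M.smooth_fun_cong[OF oW pullback_metric_expand[OF t(1) assms]], blast)
      (intro M.smooth_fun_sum M.smooth_fun_mult oW g pullback_frame(1)[OF t(1)] assms)
  then show "\<exists>W. open W \<and> p \<in> W \<and> smooth_fun \<A> (U \<inter> W) (\<lambda>q. G (\<Psi> q) (s q) (s' q))"
    using open_vimage_map[OF oV] t(2) by (intro exI[of _ "\<Psi> -` fst t"]) (simp add: Int_commute)
qed

text \<open>Both sides are expanded in a pulled-back frame. The derivative of the Gram coefficients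
  \<open>g i j\<close> is given by the metric property of \<open>DN\<close>, and the derivatives of
  the section coefficients match by the product rule.\<close>

lemma pullback_metric_compatible:
  assumes "open U" "p \<in> U" "PB.sec U s" "PB.sec U s'"
  shows "dir_deriv \<A> (\<lambda>q. G (\<Psi> q) (s q) (s' q)) p v = G (\<Psi> p) (D p v s) (s' p) + G (\<Psi> p) (s p) (D p v s')"
proof -
  obtain t where t: "t \<in> tangent_bundle \<B>" "\<Psi> p \<in> fst t" using TN.ex_triv by blast
  have oV: "open (fst t)" using TN.open_triv t by auto
  let ?W = "\<Psi> -` fst t \<inter> U"
  have oW: "open ?W" using open_vimage_map[OF oV] assms by auto
  have pW: "p \<in> ?W" using assms t by auto
  define e where "e = TN.triv_frame t"
  define a where "a i q = snd t (\<Psi> q) (s q) $ i" for i q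
  define b where "b i q = snd t (\<Psi> q) (s' q) $ i" for i q
  define g where "g i j = (\<lambda>z. G z (e i z) (e j z)) \<circ> \<Psi>" for i j
  have e: "TN.sec (fst t) (e i)" for i unfolding e_def by (rule TN.sec_triv_frame[OF t(1)])
  have a: "smooth_fun \<A> ?W (a i)" for i unfolding a_def by (rule pullback_frame(1)[OF t(1) assms(1,3)])
  have b: "smooth_fun \<A> ?W (b i)" for i unfolding b_def by (rule pullback_frame(1)[OF t(1) assms(1,4)])
  have g: "smooth_fun \<A> ?W (g i j)" for i j
    unfolding g_def by (rule M.smooth_fun_subset[OF smooth_fun_pull[OF oV NC.h_smooth[OF oV e e]]]) auto
  have dg: "dir_deriv \<A> (g i j) p v
      = G (\<Psi> p) (DN (\<Psi> p) (d\<Psi> p v) (e i)) (e j (\<Psi> p)) + G (\<Psi> p) (e i (\<Psi> p)) (DN (\<Psi> p) (d\<Psi> p v) (e j))" for i j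
    unfolding g_def dir_deriv_pull[OF oV t(2) NC.h_smooth[OF oV e e]] by (rule NC.D_metric[OF oV t(2) e e])
  have "dir_deriv \<A> (\<lambda>q. G (\<Psi> q) (s q) (s' q)) p v
     = dir_deriv \<A> (\<lambda>q. \<Sum>i\<in>UNIV. \<Sum>j\<in>UNIV. (a i q * b j q) * g i j q) p v"
    by (rule M.dir_deriv_cong[OF oW pW])
      (use pullback_metric_expand[OF t(1) assms(1,3,4)] in \<open>simp add: a_def b_def g_def e_def\<close>)
  also have "\<dots> = (\<Sum>i\<in>UNIV. dir_deriv \<A> (\<lambda>q. \<Sum>j\<in>UNIV. (a i q * b j q) * g i j q) p v)"
    by (intro M.dir_deriv_sum[OF oW pW] M.smooth_fun_sum M.smooth_fun_mult oW a b g)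
  also have "\<dots> = (\<Sum>i\<in>UNIV. \<Sum>j\<in>UNIV. dir_deriv \<A> (\<lambda>q. (a i q * b j q) * g i j q) p v)"
    by (intro sum.cong refl M.dir_deriv_sum[OF oW pW] M.smooth_fun_mult oW a b g)
  also have "\<dots> = (\<Sum>i\<in>UNIV. \<Sum>j\<in>UNIV. (a i p * b j p) * dir_deriv \<A> (g i j) p v
      + (a i p * dir_deriv \<A> (b j) p v + dir_deriv \<A> (a i) p v * b j p) * g i j p)"
    by (simp add: M.dir_deriv_mult[OF oW pW M.smooth_fun_mult[OF oW a b] g] M.dir_deriv_mult[OF oW pW a b])
  also have "\<dots> = (\<Sum>i\<in>UNIV. \<Sum>j\<in>UNIV.
       G (\<Psi> p) (a i p *\<^sub>R DN (\<Psi> p) (d\<Psi> p v) (e i) + dir_deriv \<A> (a i) p v *\<^sub>R e i (\<Psi> p)) (b j p *\<^sub>R e j (\<Psi> p)))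
     + (\<Sum>i\<in>UNIV. \<Sum>j\<in>UNIV.
       G (\<Psi> p) (a i p *\<^sub>R e i (\<Psi> p)) (b j p *\<^sub>R DN (\<Psi> p) (d\<Psi> p v) (e j) + dir_deriv \<A> (b j) p v *\<^sub>R e j (\<Psi> p)))"
    unfolding sum.distrib[symmetric] dg
    by (intro sum.cong refl) (simp add: NC.h_simps g_def algebra_simps)
  also have "\<dots> = G (\<Psi> p) (\<Sum>i\<in>UNIV. a i p *\<^sub>R DN (\<Psi> p) (d\<Psi> p v) (e i) + dir_deriv \<A> (a i) p v *\<^sub>R e i (\<Psi> p))
        (\<Sum>j\<in>UNIV. b j p *\<^sub>R e j (\<Psi> p))
     + G (\<Psi> p) (\<Sum>i\<in>UNIV. a i p *\<^sub>R e i (\<Psi> p))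
        (\<Sum>j\<in>UNIV. b j p *\<^sub>R DN (\<Psi> p) (d\<Psi> p v) (e j) + dir_deriv \<A> (b j) p v *\<^sub>R e j (\<Psi> p))"
    by (simp only: bilinear_sum[OF NC.h_bilinear] sum.cartesian_product)
  also have "(\<Sum>i\<in>UNIV. a i p *\<^sub>R DN (\<Psi> p) (d\<Psi> p v) (e i) + dir_deriv \<A> (a i) p v *\<^sub>R e i (\<Psi> p)) = D p v s"
    unfolding a_def e_def by (rule D_expand[OF t(1) assms(1,3,2) t(2), symmetric])
  also have "(\<Sum>i\<in>UNIV. b i p *\<^sub>R DN (\<Psi> p) (d\<Psi> p v) (e i) + dir_deriv \<A> (b i) p v *\<^sub>R e i (\<Psi> p)) = D p v s'"
    unfolding b_def e_def by (rule D_expand[OF t(1) assms(1,4,2) t(2), symmetric])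
  also have "(\<Sum>i\<in>UNIV. a i p *\<^sub>R e i (\<Psi> p)) = s p"
    unfolding a_def e_def using pullback_frame(2)[OF t(1) assms(1,3)] t(2) by simp
  also have "(\<Sum>i\<in>UNIV. b i p *\<^sub>R e i (\<Psi> p)) = s' p"
    unfolding b_def e_def using pullback_frame(2)[OF t(1) assms(1,4)] t(2) by simp
  finally show ?thesis .
qed

sublocale PM: metric_bundle_connection \<A> "pullback_bundle \<Psi> (tangent_bundle \<B>)" D "\<lambda>p. G (\<Psi> p)"
  by unfold_locales
    (simp_all add: NC.h_bilinear NC.h_sym pullback_metric_smooth pullback_metric_compatible)

text \<open>Coordinate fields have constant components in their own chart, so their brackets vanish
  and the torsion-free property says that the Christoffel symbols are symmetric.\<close>

lemma coordinate_frame_commute: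
  assumes "d \<in> \<B>" "z \<in> fst d"
  defines "t \<equiv> (fst d, \<lambda>p v. dir_deriv \<B> (snd d) p v)"
  shows "DN z (TN.triv_frame t i z) (TN.triv_frame t j) = DN z (TN.triv_frame t j z) (TN.triv_frame t i)"
proof -
  have t: "t \<in> tangent_bundle \<B>" unfolding t_def by (rule N.tangent_triv[OF assms(1)])
  have o: "open (fst d)" using N.open_chart_domain[OF assms(1)] .
  have e: "TN.sec (fst d) (TN.triv_frame t i)" for i
    using TN.sec_triv_frame[OF t] by (simp add: t_def)
  have sm: "smooth_fun \<B> (fst d) (\<lambda>z. snd d z $ m)" for m
    by (rule N.smooth_fun_bounded_linear[OF bounded_linear_vec_nth o N.smooth_fun_chart[OF assms(1)]])
  have dm: "dir_deriv \<B> (\<lambda>z. snd d z $ m) q v = dir_deriv \<B> (snd d) q v $ m" if "q \<in> fst d" for q v m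
    by (rule N.dir_deriv_bounded_linear[OF bounded_linear_vec_nth o that N.smooth_fun_chart[OF assms(1)]])
  have const: "dir_deriv \<B> (\<lambda>z. snd d z $ m) q (TN.triv_frame t j q) = axis j 1 $ m" if "q \<in> fst d" for q j m
    unfolding dm[OF that] TN.triv_frame_def t_def
    using N.dir_deriv_chart_bij(2)[OF assms(1) that] by (simp add: bij_is_surj surj_f_inv_f)
  have "dir_deriv \<B> (\<lambda>q. dir_deriv \<B> (\<lambda>z. snd d z $ m) q (TN.triv_frame t j q)) z v = 0" for m j v
    using N.dir_deriv_cong[OF o assms(2) const[where m = m and j = j], where v = v] by (simp add: N.dir_deriv_const)
  then have "dir_deriv \<B> (\<lambda>z. snd d z $ m) z (lie_bracket \<B> (TN.triv_frame t i) (TN.triv_frame t j) z) = 0" for m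
    using N.dir_deriv_lie_bracket[OF o assms(2) sm e e] by simp
  then have "dir_deriv \<B> (snd d) z (lie_bracket \<B> (TN.triv_frame t i) (TN.triv_frame t j) z) = 0"
    by (simp add: vec_eq_iff dm[OF assms(2)])
  then have "lie_bracket \<B> (TN.triv_frame t i) (TN.triv_frame t j) z = 0"
    using N.dir_deriv_chart_bij[OF assms(1,2)] by (metis bij_is_inj linear_injective_0)
  then show ?thesis using DN_torsion[OF o assms(2) e e, of i j] by simp
qed

text \<open>The fields \<open>d\<Psi> q (X q)\<close> live only along \<Psi>, so the torsion-free
  property of \<open>DN\<close> does not apply to them directly. In coordinates the Christoffel
  terms cancel by symmetry, and what remains are commutators of derivatives of the components
  \<open>f i\<close> of \<Psi>, that is, the components of the image of the bracket.\<close>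

lemma D_differential_torsion:
  assumes "open U" "p \<in> U" "TM.sec U X" "TM.sec U Y"
  shows "D p (X p) (\<lambda>q. d\<Psi> q (Y q)) - D p (Y p) (\<lambda>q. d\<Psi> q (X q)) = d\<Psi> p (lie_bracket \<A> X Y p)"
proof -
  define d where "d = chart_at \<B> (\<Psi> p)"
  have d: "d \<in> \<B>" "\<Psi> p \<in> fst d" unfolding d_def using N.chart_at_in N.in_chart_at by auto
  define t where "t = (fst d, \<lambda>p v. dir_deriv \<B> (snd d) p v)"
  have t: "t \<in> tangent_bundle \<B>" "\<Psi> p \<in> fst t" unfolding t_def using N.tangent_triv[OF d(1)] d by auto
  have od: "open (fst d)" using N.open_chart_domain[OF d(1)] .
  let ?W = "\<Psi> -` fst d \<inter> U"
  have oW: "open ?W" using open_vimage_map[OF od] assms by auto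
  have pW: "p \<in> ?W" using assms d by auto
  define f where "f i = (\<lambda>q. (snd d \<circ> \<Psi>) q $ i)" for i
  define e where "e = TN.triv_frame t"
  have o1: "open (\<Psi> -` fst d)" using open_vimage_map[OF od] .
  have sf: "smooth_fun \<A> ?W (f i)" for i
    unfolding f_def
    by (rule M.smooth_fun_subset[OF M.smooth_fun_bounded_linear[OF bounded_linear_vec_nth o1 smooth_chart_map[OF d(1)]]]) auto
  have coeff: "snd t (\<Psi> q) (d\<Psi> q v) $ i = dir_deriv \<A> (f i) q v" if "q \<in> ?W" for q v i
    unfolding t_def snd_conv f_def
    using M.dir_deriv_bounded_linear[OF bounded_linear_vec_nth o1 _ smooth_chart_map[OF d(1)], of q]
      dir_deriv_pull[OF od _ N.smooth_fun_chart[OF d(1)], of q] that by simp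
  have Dexp: "D p v (\<lambda>q. d\<Psi> q (Z q)) = (\<Sum>i\<in>UNIV. dir_deriv \<A> (f i) p (Z p) *\<^sub>R DN (\<Psi> p) (d\<Psi> p v) (e i)
      + dir_deriv \<A> (\<lambda>q. dir_deriv \<A> (f i) q (Z q)) p v *\<^sub>R e i (\<Psi> p))" if Z: "TM.sec U Z" for Z v
  proof -
    have "dir_deriv \<A> (\<lambda>q. snd t (\<Psi> q) (d\<Psi> q (Z q)) $ i) p v
      = dir_deriv \<A> (\<lambda>q. dir_deriv \<A> (f i) q (Z q)) p v" for i
      by (rule M.dir_deriv_cong[OF oW pW coeff])
    then show ?thesis
      using D_expand[OF t(1) assms(1) sec_differential[OF assms(1) Z] assms(2) t(2), of v] coeff[OF pW]
      by (simp add: e_def)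
  qed
  have dexp: "d\<Psi> p v = (\<Sum>i\<in>UNIV. dir_deriv \<A> (f i) p v *\<^sub>R e i (\<Psi> p))" for v
    using TN.triv_frame_expand[OF t, of "d\<Psi> p v"] coeff[OF pW] by (simp add: e_def)
  have e: "TN.sec (fst t) (e i)" for i unfolding e_def by (rule TN.sec_triv_frame[OF t(1)])
  have DNlin: "DN (\<Psi> p) (d\<Psi> p v) (e i) = (\<Sum>j\<in>UNIV. dir_deriv \<A> (f j) p v *\<^sub>R DN (\<Psi> p) (e j (\<Psi> p)) (e i))" for v i
  proof -
    have l: "linear (\<lambda>w. DN (\<Psi> p) w (e i))" by (rule NC.D_linear[OF TN.open_triv[OF t(1)] t(2) e])
    show ?thesis unfolding dexp by (simp add: linear_sum[OF l] linear_cmul[OF l])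
  qed
  have comm: "DN (\<Psi> p) (e j (\<Psi> p)) (e i) = DN (\<Psi> p) (e i (\<Psi> p)) (e j)" for i j
    unfolding e_def t_def by (rule coordinate_frame_commute[OF d])
  \<comment> \<open>These are the Christoffel terms of the two derivatives; swapping the summation
    indices identifies them.\<close>
  have "(\<Sum>i\<in>UNIV. dir_deriv \<A> (f i) p (Y p) *\<^sub>R DN (\<Psi> p) (d\<Psi> p (X p)) (e i))
      = (\<Sum>i\<in>UNIV. \<Sum>j\<in>UNIV. (dir_deriv \<A> (f i) p (Y p) * dir_deriv \<A> (f j) p (X p)) *\<^sub>R DN (\<Psi> p) (e j (\<Psi> p)) (e i))"
    unfolding DNlin by (simp add: scaleR_sum_right)
  also have "\<dots> = (\<Sum>j\<in>UNIV. \<Sum>i\<in>UNIV. (dir_deriv \<A> (f i) p (Y p) * dir_deriv \<A> (f j) p (X p)) *\<^sub>R DN (\<Psi> p) (e j (\<Psi> p)) (e i))"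
    by (rule sum.swap)
  also have "\<dots> = (\<Sum>j\<in>UNIV. \<Sum>i\<in>UNIV. (dir_deriv \<A> (f j) p (X p) * dir_deriv \<A> (f i) p (Y p)) *\<^sub>R DN (\<Psi> p) (e i (\<Psi> p)) (e j))"
    by (subst comm) (simp add: mult.commute)
  also have "\<dots> = (\<Sum>i\<in>UNIV. dir_deriv \<A> (f i) p (X p) *\<^sub>R DN (\<Psi> p) (d\<Psi> p (Y p)) (e i))"
    unfolding DNlin by (simp add: scaleR_sum_right)
  finally have sym: "(\<Sum>i\<in>UNIV. dir_deriv \<A> (f i) p (Y p) *\<^sub>R DN (\<Psi> p) (d\<Psi> p (X p)) (e i))
    = (\<Sum>i\<in>UNIV. dir_deriv \<A> (f i) p (X p) *\<^sub>R DN (\<Psi> p) (d\<Psi> p (Y p)) (e i))" .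
  have "D p (X p) (\<lambda>q. d\<Psi> q (Y q)) - D p (Y p) (\<lambda>q. d\<Psi> q (X q))
    = (\<Sum>i\<in>UNIV. (dir_deriv \<A> (\<lambda>q. dir_deriv \<A> (f i) q (Y q)) p (X p)
        - dir_deriv \<A> (\<lambda>q. dir_deriv \<A> (f i) q (X q)) p (Y p)) *\<^sub>R e i (\<Psi> p))"
    unfolding Dexp[OF assms(3)] Dexp[OF assms(4)] sum.distrib sym
    by (simp add: sum_subtractf scaleR_diff_left)
  also have "\<dots> = d\<Psi> p (lie_bracket \<A> X Y p)"
    unfolding dexp
    by (simp add: M.dir_deriv_lie_bracket[OF oW pW sf] TM.sec_subset[OF assms(3)] TM.sec_subset[OF assms(4)])
  finally show ?thesis .
qed

end

section \<open>Bump functions\<close>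

text \<open>The negative power of \<open>x\<close> makes the family closed under differentiation:
  the derivative of a member is a combination of the next two. Smoothness thus becomes an induction
  on the order with \<open>k\<close> arbitrary.\<close>

definition flat :: "nat \<Rightarrow> real \<Rightarrow> real" where
  "flat k x = (if x > 0 then inverse x ^ k * exp (- inverse x) else 0)"

lemma flat_tendsto_0: "(flat k \<longlongrightarrow> 0) (at 0)"
proof (rule filterlim_split_at)
  have "((\<lambda>x. inverse x ^ k / exp (inverse x)) \<longlongrightarrow> 0) (at_right (0::real))"
    by (rule filterlim_compose[OF tendsto_power_div_exp_0 filterlim_inverse_at_top_right])
  moreover have "eventually (\<lambda>x. inverse x ^ k / exp (inverse x) = flat k x) (at_right (0::real))"
    using eventually_at_right_less by eventually_elim (simp add: flat_def exp_minus field_simps)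
  ultimately show "(flat k \<longlongrightarrow> 0) (at_right 0)"
    by (rule Lim_transform_eventually)
  have "eventually (\<lambda>x. 0 = flat k x) (at_left (0::real))"
    unfolding eventually_at_left_field by (intro exI[of _ "-1"]) (auto simp: flat_def)
  then show "(flat k \<longlongrightarrow> 0) (at_left 0)"
    by (rule Lim_transform_eventually[OF tendsto_const])
qed

lemma flat_has_derivative:
  "(flat k has_real_derivative (flat (k + 2) x - real k * flat (k + 1) x)) (at x)"
proof (cases x "0::real" rule: linorder_cases)
  case less
  have "(flat k has_real_derivative 0) (at x)"
    by (rule has_field_derivative_transform_within_open[of "\<lambda>_. 0" _ _ "{..<0}"])
      (use less in \<open>auto simp: flat_def\<close>)
  then show ?thesis using less by (simp add: flat_def)
next
  case equal
  \<comment> \<open>At the origin the difference quotient of one member is the next member, which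
    tends to zero.\<close>
  have "((\<lambda>y. (flat k y - flat k 0) / (y - 0)) \<longlongrightarrow> 0) (at 0)"
  proof (rule Lim_transform_eventually[OF flat_tendsto_0[of "k + 1"]])
    show "\<forall>\<^sub>F y in at 0. flat (k + 1) y = (flat k y - flat k 0) / (y - 0)"
      by (rule eventually_at_filter[THEN iffD2]) (auto simp: flat_def field_simps)
  qed
  then show ?thesis using equal by (simp add: has_field_derivative_iff flat_def)
next
  case greater
  have "((\<lambda>x. inverse x ^ k * exp (- inverse x)) has_real_derivative
      (flat (k + 2) x - real k * flat (k + 1) x)) (at x)"
    using greater
    by (auto intro!: derivative_eq_intros simp: flat_def power2_eq_square)
      (cases k; simp add: field_simps power2_eq_square)
  then show ?thesis
    by (rule has_field_derivative_transform_within_open[of _ _ _ "{0<..}"])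
      (use greater in \<open>auto simp: flat_def\<close>)
qed

lemma ck_on_flat: "ck_on j UNIV (flat k)"
proof (induction j arbitrary: k)
  case 0
  have "isCont (flat k) x" for x using flat_has_derivative by (rule DERIV_isCont)
  then show ?case by (simp add: continuous_at_imp_continuous_on)
next
  case (Suc j)
  show ?case
  proof (rule ck_on_SucI)
    show "(flat k has_derivative (\<lambda>v. (flat (k + 2) x + (- real k) * flat (k + 1) x) * v)) (at x)" for x
      using flat_has_derivative[of k x] by (simp add: has_field_derivative_def)
    show "ck_on j UNIV (\<lambda>x. (flat (k + 2) x + (- real k) * flat (k + 1) x) * v)" for v
      by (intro ck_on_bilinear[OF bounded_bilinear_mult] ck_on_add ck_on_const open_UNIV Suc.IH)
  qed simp
qed

context smooth_manifold
begin

text \<open>A function of the chart coordinates, supported in a small closed ball, is extended by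
  zero. The closed set \<open>K\<close> is exported because it makes extensions by zero of local
  sections smooth as well.\<close>

lemma ex_bump_function:
  assumes "open U" "p \<in> U"
  obtains \<phi> :: "'p \<Rightarrow> real" and K where "smooth_fun \<A> UNIV \<phi>" "closed K" "K \<subseteq> U" "\<phi> p \<noteq> 0" "\<And>q. q \<notin> K \<Longrightarrow> \<phi> q = 0"
proof -
  define c where "c = chart_at \<A> p"
  have c: "c \<in> \<A>" "p \<in> fst c" unfolding c_def using chart_at_in in_chart_at by auto
  obtain r where r: "r > 0" "cball (snd c p) r \<subseteq> snd c ` (fst c \<inter> U)"
    using open_chart_Int[OF c(1) assms(1)] c assms(2) open_contains_cball by blast
  \<comment> \<open>The argument of \<open>flat 0\<close> is positive exactly on the open ball of
    radius \<open>r\<close> around \<open>snd c p\<close>.\<close>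
  define b where "b = (\<lambda>x. flat 0 (r\<^sup>2 + - ((x + - snd c p) \<bullet> (x + - snd c p))))"
  have b_smooth: "smooth_on UNIV b"
    unfolding b_def smooth_on_def
  proof
    fix k
    have id: "ck_on k UNIV (\<lambda>x::real ^ 'n. x)"
      by (cases k) (auto intro: ck_on_const)
    have "ck_on k UNIV (\<lambda>x. r\<^sup>2 + - ((x + - snd c p) \<bullet> (x + - snd c p)))"
      by (intro ck_on_add ck_on_const ck_on_bounded_linear[OF bounded_linear_minus[OF bounded_linear_ident]]
          ck_on_bilinear[OF bounded_bilinear_inner] id open_UNIV)
    then show "ck_on k UNIV (\<lambda>x. flat 0 (r\<^sup>2 + - ((x + - snd c p) \<bullet> (x + - snd c p))))"
      by (intro ck_on_compose[OF open_UNIV open_UNIV ck_on_flat]) auto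
  qed
  have b_0: "b x = 0" if "x \<notin> cball (snd c p) r" for x
  proof -
    have "r \<le> norm (x - snd c p)" using that by (simp add: dist_norm norm_minus_commute)
    then have "r\<^sup>2 \<le> (x - snd c p) \<bullet> (x - snd c p)"
      using r(1) by (simp add: power2_norm_eq_inner[symmetric] power_mono)
    then show ?thesis by (simp add: b_def flat_def)
  qed
  define K where "K = chart_inv c ` cball (snd c p) r"
  define \<phi> where "\<phi> q = (if q \<in> fst c then b (snd c q) else 0)" for q
  have "continuous_on (snd c ` fst c) (chart_inv c)"
    using chart_homeomorphism[OF c(1)] unfolding homeomorphism_def by blast
  then have "compact K"
    unfolding K_def using r(2)
    by (intro compact_continuous_image compact_cball) (auto intro: continuous_on_subset)
  \<comment> \<open>The Hausdorff property enters here. The complement of \<open>K\<close> is open,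
    and together with the chart domain it covers the manifold.\<close>
  then have K: "closed K" by (rule compact_imp_closed)
  have K_sub: "K \<subseteq> fst c \<inter> U" unfolding K_def using r(2) chart_Int_image[OF c(1)] by blast
  have \<phi>_0: "\<phi> q = 0" if "q \<notin> K" for q
    using that b_0[of "snd c q"] chart_inv_chart[OF c(1), of q] unfolding \<phi>_def K_def by (metis imageI)
  have "smooth_fun \<A> UNIV \<phi>"
  proof (rule smooth_fun_local)
    fix q
    show "\<exists>W. open W \<and> q \<in> W \<and> smooth_fun \<A> (UNIV \<inter> W) \<phi>"
    proof (cases "q \<in> fst c")
      case True
      have "smooth_fun \<A> (fst c) (\<lambda>q. b (snd c q))"
        by (rule smooth_fun_compose[OF open_chart_domain[OF c(1)] open_UNIV b_smooth smooth_fun_chart[OF c(1)]]) simp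
      then have "smooth_fun \<A> (fst c) \<phi>"
        by (rule iffD1[OF smooth_fun_cong[OF open_chart_domain[OF c(1)]], rotated]) (simp add: \<phi>_def)
      then show ?thesis using True open_chart_domain[OF c(1)] by auto
    next
      case False
      have "open (- K)" using K by auto
      moreover have "smooth_fun \<A> (- K) \<phi>"
        by (rule iffD1[OF smooth_fun_cong[OF \<open>open (- K)\<close>] smooth_fun_const[of _ 0]]) (simp add: \<phi>_0)
      ultimately show ?thesis using False K_sub by auto
    qed
  qed
  moreover have "\<phi> p \<noteq> 0" using c r by (simp add: \<phi>_def b_def flat_def)
  ultimately show thesis using that K K_sub \<phi>_0 by blast
qed

end

context smooth_bundle
begin

text \<open>This links local frames to statements about global fields. The multiple does not agree
  with \<open>s\<close> near \<open>p\<close>, but for a tensorial expression the nonzero factor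
  \<open>\<phi> p\<close> can be divided out afterwards.\<close>

lemma ex_global_multiple:
  assumes "open U" "p \<in> U" "sec U s"
  obtains \<phi> where "smooth_fun \<A> UNIV \<phi>" "\<phi> p \<noteq> 0" "sec UNIV (\<lambda>q. \<phi> q *\<^sub>R s q)"
proof -
  obtain \<phi> :: "'p \<Rightarrow> real" and K where \<phi>: "smooth_fun \<A> UNIV \<phi>" "closed K" "K \<subseteq> U" "\<phi> p \<noteq> 0" "\<And>q. q \<notin> K \<Longrightarrow> \<phi> q = 0"
    using ex_bump_function[OF assms(1,2)] by blast
  have "sec UNIV (\<lambda>q. \<phi> q *\<^sub>R s q)"
  proof (rule sec_local)
    fix q
    show "\<exists>W. open W \<and> q \<in> W \<and> sec (UNIV \<inter> W) (\<lambda>q. \<phi> q *\<^sub>R s q)"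
    proof (cases "q \<in> U")
      case True
      then show ?thesis
        using sec_scaleR[OF assms(1) smooth_fun_subset[OF \<phi>(1)] assms(3)] assms(1) by auto
    next
      case False
      have o: "open (- K)" using \<phi>(2) by auto
      have "sec (- K) (\<lambda>q. \<phi> q *\<^sub>R s q)"
        by (rule sec_cong[OF o sec_zero]) (simp add: \<phi>(5))
      then show ?thesis using o False \<phi>(3) by auto
    qed
  qed
  then show thesis using that \<phi> by blast
qed

end

section \<open>Linear algebra of inner products\<close>

lemma has_signature_positive_definite:
  fixes b :: "real ^ 'n::finite \<Rightarrow> real ^ 'n \<Rightarrow> real"
  assumes "has_signature b k 0" "u \<noteq> 0"
  shows "b u u > 0"
proof -
  obtain P N where PN: "independent (P \<union> N)" "span (P \<union> N) = UNIV" "card N = 0"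
    "\<forall>u\<in>P \<union> N. \<forall>v\<in>P \<union> N. u \<noteq> v \<longrightarrow> b u v = 0" "\<forall>u\<in>P. b u u > 0"
    and bil: "bilinear b"
    using assms(1) unfolding has_signature_def by auto
  have fin: "finite (P \<union> N)" using PN(1) independent_imp_finite by blast
  \<comment> \<open>Vanishing \<open>card N\<close> alone would also allow an infinite
    \<open>N\<close>; independence excludes it.\<close>
  then have N: "N = {}" using PN(3) by auto
  have P: "finite P" "span P = UNIV" using fin PN(2) N by auto
  obtain c where c: "u = (\<Sum>v\<in>P. c v *\<^sub>R v)"
    using P span_finite[OF P(1)] by auto
  have "b u u = (\<Sum>(v,w)\<in>P \<times> P. b (c v *\<^sub>R v) (c w *\<^sub>R w))"
    unfolding c by (rule bilinear_sum[OF bil])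
  also have "\<dots> = (\<Sum>v\<in>P. \<Sum>w\<in>P. b (c v *\<^sub>R v) (c w *\<^sub>R w))"
    by (simp add: sum.cartesian_product)
  also have "\<dots> = (\<Sum>v\<in>P. (c v)\<^sup>2 * b v v)"
  proof (rule sum.cong[OF refl])
    fix v assume v: "v \<in> P"
    have "(\<Sum>w\<in>P. b (c v *\<^sub>R v) (c w *\<^sub>R w)) = (\<Sum>w\<in>P. if w = v then (c v)\<^sup>2 * b v v else 0)"
      using v PN(4) by (intro sum.cong refl)
        (auto simp: bilinear_lmul[OF bil] bilinear_rmul[OF bil] power2_eq_square)
    then show "(\<Sum>w\<in>P. b (c v *\<^sub>R v) (c w *\<^sub>R w)) = (c v)\<^sup>2 * b v v" using P(1) v by simp
  qed
  finally have b: "b u u = (\<Sum>v\<in>P. (c v)\<^sup>2 * b v v)" .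
  have "\<not> (\<forall>v\<in>P. c v = 0)"
  proof
    assume "\<forall>v\<in>P. c v = 0"
    then have "u = 0" unfolding c by simp
    then show False using assms(2) by simp
  qed
  then obtain v where v: "v \<in> P" "c v \<noteq> 0" by blast
  show ?thesis
    unfolding b by (rule sum_pos2[OF P(1) v(1)]) (use v PN(5) in \<open>auto intro: less_imp_le\<close>)
qed

locale orthonormal_basis_for =
  fixes b :: "real ^ 'n::finite \<Rightarrow> real ^ 'n \<Rightarrow> real" and e :: "'n \<Rightarrow> real ^ 'n"
  assumes bil: "bilinear b" and sym: "b u v = b v u"
    and orthonormal: "b (e i) (e j) = (if i = j then 1 else 0)"
begin

lemma b_linear: "linear (b u)" "linear (\<lambda>u. b u v)"
  using bil unfolding bilinear_def by auto

text \<open>The coefficients are recovered by pairing with the \<open>e j\<close>, so the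
  combination map is injective, and by dimension it is surjective.\<close>

lemma expand: "u = (\<Sum>i\<in>UNIV. b u (e i) *\<^sub>R e i)"
proof -
  define T where "T x = (\<Sum>i\<in>UNIV. x $ i *\<^sub>R e i)" for x :: "real ^ 'n"
  have lin: "linear T"
    unfolding T_def by (rule linearI) (simp_all add: algebra_simps sum.distrib scaleR_sum_right)
  have co: "b (T x) (e j) = x $ j" for x j
    unfolding T_def linear_sum[OF b_linear(2)]
    by (simp add: bilinear_lmul[OF bil] orthonormal if_distrib cong: if_cong)
  have "inj T" by (metis co injI vec_eq_iff)
  then have "surj T" by (rule linear_injective_imp_surjective[OF lin]) simp
  then obtain x where "u = T x" by (metis surjD)
  then show ?thesis using co by (simp add: T_def)
qed

lemma parseval: "b u v = (\<Sum>i\<in>UNIV. b u (e i) * b (e i) v)"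
proof -
  have "b u v = b (\<Sum>i\<in>UNIV. b u (e i) *\<^sub>R e i) v" using expand by metis
  then show ?thesis by (simp add: linear_sum[OF b_linear(2)] bilinear_lmul[OF bil])
qed

text \<open>\<open>trace (matrix L)\<close> refers to the standard basis, which need not be
  orthonormal for \<open>b\<close>. Expanding the image of each standard vector in \<open>e\<close>,
  and each \<open>e i\<close> in standard vectors, gives the same double sum.\<close>

lemma trace_eq:
  assumes "linear L"
  shows "trace (matrix L) = (\<Sum>i\<in>UNIV. b (L (e i)) (e i))"
proof -
  have "trace (matrix L) = (\<Sum>j\<in>UNIV. L (axis j 1) $ j)"
    unfolding trace_def matrix_def by simp
  also have "\<dots> = (\<Sum>j\<in>UNIV. \<Sum>i\<in>UNIV. b (L (axis j 1)) (e i) * e i $ j)"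
  proof (rule sum.cong[OF refl])
    fix j
    have "L (axis j 1) $ j = (\<Sum>i\<in>UNIV. b (L (axis j 1)) (e i) *\<^sub>R e i) $ j"
      using expand[of "L (axis j 1)"] by simp
    then show "L (axis j 1) $ j = (\<Sum>i\<in>UNIV. b (L (axis j 1)) (e i) * e i $ j)" by simp
  qed
  also have "\<dots> = (\<Sum>i\<in>UNIV. \<Sum>j\<in>UNIV. b (L (axis j 1)) (e i) * e i $ j)" by (rule sum.swap)
  also have "\<dots> = (\<Sum>i\<in>UNIV. b (L (e i)) (e i))"
  proof (rule sum.cong[OF refl])
    fix i
    have "L (e i) = L (\<Sum>j\<in>UNIV. e i $ j *\<^sub>R axis j 1)"
      using basis_expansion[of "e i"] by (simp add: scalar_mult_eq_scaleR)
    also have "\<dots> = (\<Sum>j\<in>UNIV. e i $ j *\<^sub>R L (axis j 1))"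
      by (simp add: linear_sum[OF assms] linear_cmul[OF assms])
    finally have "b (L (e i)) (e i) = b (\<Sum>j\<in>UNIV. e i $ j *\<^sub>R L (axis j 1)) (e i)" by simp
    also have "\<dots> = (\<Sum>j\<in>UNIV. e i $ j * b (L (axis j 1)) (e i))"
      by (simp add: linear_sum[OF b_linear(2)] bilinear_lmul[OF bil])
    finally show "(\<Sum>j\<in>UNIV. b (L (axis j 1)) (e i) * e i $ j) = b (L (e i)) (e i)"
      by (simp add: mult.commute)
  qed
  finally show ?thesis .
qed

end

section \<open>Smoothness of dual vector fields\<close>

text \<open>A kernel vector of the Gram matrix yields a combination \<open>u\<close> orthogonal to
  all \<open>e i\<close>, hence to itself. The nonzero determinant is the denominator in Cramer's
  rule below.\<close>

lemma positive_definite_gram_det: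
  fixes b :: "real ^ 'n::finite \<Rightarrow> real ^ 'n \<Rightarrow> real" and e :: "'n \<Rightarrow> real ^ 'n"
  assumes bil: "bilinear b" and pos: "\<And>u. u \<noteq> 0 \<Longrightarrow> b u u > 0"
    and gen: "\<And>x. (\<Sum>i\<in>UNIV. x $ i *\<^sub>R e i) = 0 \<Longrightarrow> x = (0 :: real ^ 'n)"
  shows "det (\<chi> i j. b (e j) (e i)) \<noteq> 0"
proof -
  let ?M = "(\<chi> i j. b (e j) (e i)) :: real ^ 'n ^ 'n"
  have lb: "linear (b u)" "linear (\<lambda>u. b u v)" for u v using bil unfolding bilinear_def by auto
  have "x = 0" if "?M *v x = 0" for x
  proof -
    define u where "u = (\<Sum>i\<in>UNIV. x $ i *\<^sub>R e i)"
    have "b u (e i) = 0" for i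
      using that unfolding u_def linear_sum[OF lb(2)]
      by (simp add: vec_eq_iff matrix_vector_mult_def bilinear_lmul[OF bil] mult.commute)
    then have "b u (\<Sum>i\<in>UNIV. x $ i *\<^sub>R e i) = 0"
      by (simp add: linear_sum[OF lb(1)] bilinear_rmul[OF bil])
    then have "b u u = 0" unfolding u_def .
    then have "u = 0" using pos by fastforce
    then show "x = 0" using gen unfolding u_def by blast
  qed
  then have "invertible ?M"
    using matrix_left_invertible_ker[of ?M] invertible_left_inverse[of ?M] by blast
  then show ?thesis by (simp add: invertible_det_nz)
qed

context smooth_manifold
begin

lemma smooth_fun_det:
  fixes M :: "'p \<Rightarrow> real ^ 'k ^ 'k"
  assumes "open U" "\<And>i j. smooth_fun \<A> U (\<lambda>q. M q $ i $ j)"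
  shows "smooth_fun \<A> U (\<lambda>q. det (M q))"
  unfolding det_def
  by (intro smooth_fun_sum smooth_fun_mult smooth_fun_prod smooth_fun_const assms)

end

context metric_bundle_connection
begin

text \<open>The coefficients of \<open>s\<close> in a local frame solve a linear system with smooth coefficients; they are
  smooth by Cramer's rule.\<close>

lemma sec_dual:
  assumes pos: "\<And>p u. u \<noteq> 0 \<Longrightarrow> h p u u > 0" and "open U"
    and s: "\<And>W s'. open W \<Longrightarrow> W \<subseteq> U \<Longrightarrow> sec W s' \<Longrightarrow> smooth_fun \<A> W (\<lambda>q. h q (s q) (s' q))"
  shows "sec U s"
proof (rule sec_local)
  fix p assume "p \<in> U"
  obtain t where t: "t \<in> \<V>" "p \<in> fst t" by (rule ex_triv)
  let ?W = "U \<inter> fst t"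
  have ot: "open (fst t)" and oW: "open ?W" using open_triv[OF t(1)] assms(2) by auto
  define e where "e = triv_frame t"
  have e: "sec ?W (e i)" for i
    unfolding e_def by (rule sec_subset[OF sec_triv_frame[OF t(1)]]) auto
  define M where "M q = (\<chi> i j. h q (e j q) (e i q))" for q
  define r where "r q = (\<chi> i. h q (s q) (e i q))" for q
  define x where "x q = snd t q (s q)" for q
  have lh: "linear (\<lambda>u. h q u v)" for q v using h_bilinear unfolding bilinear_def by auto
  have x: "s q = (\<Sum>i\<in>UNIV. x q $ i *\<^sub>R e i q)" if "q \<in> ?W" for q
    unfolding x_def e_def by (rule triv_frame_expand[OF t(1)]) (use that in auto)
  have Mx: "M q *v x q = r q" if "q \<in> ?W" for q
    unfolding M_def r_def vec_eq_iff x[OF that] linear_sum[OF lh]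
    by (simp add: matrix_vector_mult_def h_simps mult.commute)
  have gen: "y = 0" if q: "q \<in> ?W" and y: "(\<Sum>i\<in>UNIV. y $ i *\<^sub>R e i q) = 0" for q and y :: "real ^ 'm"
  proof -
    have l: "linear (snd t q)" and b: "bij (snd t q)" using linear_triv bij_triv t q by auto
    have "snd t q (\<Sum>i\<in>UNIV. y $ i *\<^sub>R e i q) = (\<Sum>i\<in>UNIV. y $ i *\<^sub>R axis i 1)"
      unfolding e_def triv_frame_def
      by (simp add: linear_sum[OF l] linear_cmul[OF l] bij_is_surj[OF b] surj_f_inv_f)
    then have "(\<Sum>i\<in>UNIV. y $ i *\<^sub>R axis i (1::real)) = 0" unfolding y by (simp add: linear_0[OF l])
    then show ?thesis using basis_expansion[of y] by (simp add: scalar_mult_eq_scaleR)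
  qed
  have det_nz: "det (M q) \<noteq> 0" if "q \<in> ?W" for q
    unfolding M_def by (rule positive_definite_gram_det[OF h_bilinear pos gen[OF that]])
  have M_smooth: "smooth_fun \<A> ?W (\<lambda>q. M q $ i $ j)" for i j
    unfolding M_def using h_smooth[OF oW e e] by simp
  have r_smooth: "smooth_fun \<A> ?W (\<lambda>q. r q $ i)" for i
    unfolding r_def using s[OF oW _ e] by simp
  have x_smooth: "smooth_fun \<A> ?W (\<lambda>q. x q $ i)" for i
  proof -
    let ?D = "\<lambda>q. det (\<chi> k l. if l = i then r q $ k else M q $ k $ l)"
    have "smooth_fun \<A> ?W (\<lambda>q. ?D q * inverse (det (M q)))"
    proof (intro smooth_fun_mult oW smooth_fun_inverse det_nz smooth_fun_det M_smooth)
      show "smooth_fun \<A> ?W (\<lambda>q. (\<chi> k l. if l = i then r q $ k else M q $ k $ l) $ k $ l)" for k l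
        using r_smooth M_smooth by (cases "l = i") simp_all
    qed
    then show ?thesis
      by (rule iffD1[OF smooth_fun_cong[OF oW], rotated])
        (use Mx cramer[OF det_nz] in \<open>simp add: divide_inverse\<close>)
  qed
  have "sec ?W s"
    by (rule sec_cong[OF oW _ x[symmetric]]) (intro sec_sum sec_scaleR oW x_smooth e)
  then show "\<exists>W. open W \<and> p \<in> W \<and> sec (U \<inter> W) s" using ot t(2) by blast
qed

end

section \<open>Spacelike immersions of codimension two with a pair of lightlike normal fields\<close>

locale lightlike_pair = pullback_levi_civita \<A> \<B> \<Psi> G DN D k l
  for \<A> :: "('p::{t2_space,second_countable_topology}, 'n::finite) chart set"
    and \<B> :: "('q::{t2_space,second_countable_topology}, 'm::finite) chart set"
    and \<Psi> :: "'p \<Rightarrow> 'q"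
    and G :: "'q \<Rightarrow> real ^ 'm \<Rightarrow> real ^ 'm \<Rightarrow> real"
    and DN :: "'q \<Rightarrow> real ^ 'm \<Rightarrow> ('q \<Rightarrow> real ^ 'm) \<Rightarrow> real ^ 'm"
    and D :: "'p \<Rightarrow> real ^ 'n \<Rightarrow> ('p \<Rightarrow> real ^ 'm) \<Rightarrow> real ^ 'm"
    and k l :: nat +
  fixes DM :: "'p \<Rightarrow> real ^ 'n \<Rightarrow> ('p \<Rightarrow> real ^ 'n) \<Rightarrow> real ^ 'n"
    and \<xi> \<eta> :: "'p \<Rightarrow> real ^ 'm"
  assumes codimension: "CARD('m) = CARD('n) + 2"
    and riemannian: "riemannian_metric \<A> (induced_metric \<A> \<B> \<Psi> G)"
    and DM: "levi_civita \<A> (induced_metric \<A> \<B> \<Psi> G) DM"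
    and \<xi>: "lightlike_normal_field \<A> \<B> G \<Psi> \<xi>"
    and \<eta>: "lightlike_normal_field \<A> \<B> G \<Psi> \<eta>"
    and \<xi>\<eta>: "G (\<Psi> p) (\<xi> p) (\<eta> p) = -1"
begin

abbreviation g :: "'p \<Rightarrow> real ^ 'n \<Rightarrow> real ^ 'n \<Rightarrow> real" where
  "g \<equiv> induced_metric \<A> \<B> \<Psi> G"

abbreviation tp :: "'p \<Rightarrow> real ^ 'm \<Rightarrow> real ^ 'n" where
  "tp \<equiv> tangential_part \<A> \<B> G \<Psi>"

abbreviation A\<xi> :: "'p \<Rightarrow> real ^ 'n \<Rightarrow> real ^ 'n" where
  "A\<xi> \<equiv> shape_operator \<A> \<B> G \<Psi> D \<xi>"

abbreviation A\<eta> :: "'p \<Rightarrow> real ^ 'n \<Rightarrow> real ^ 'n" where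
  "A\<eta> \<equiv> shape_operator \<A> \<B> G \<Psi> D \<eta>"

sublocale RM: metric_bundle_connection \<A> "tangent_bundle \<A>" DM g
  using DM riemannian unfolding levi_civita_def riemannian_metric_def
  by (intro metric_bundle_connectionI[OF M.atlas TM.is_bundle]) blast+

lemma DM_torsion: "open U \<Longrightarrow> p \<in> U \<Longrightarrow> TM.sec U X \<Longrightarrow> TM.sec U Y \<Longrightarrow>
    DM p (X p) Y - DM p (Y p) X = lie_bracket \<A> X Y p"
  using conjunct2[OF DM[unfolded levi_civita_def]] by blast

lemma g_eq: "g p u v = G (\<Psi> p) (d\<Psi> p u) (d\<Psi> p v)"
  by (simp add: induced_metric_def)

lemma g_pos: "u \<noteq> 0 \<Longrightarrow> g p u u > 0"
  using riemannian unfolding riemannian_metric_def bundle_metric_def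
  by (intro has_signature_positive_definite) auto

lemma g_eqI: "(\<And>w. g p u w = g p v w) \<Longrightarrow> u = v"
  using g_pos[of "u - v" p] by (force simp: RM.h_simps)

lemma \<xi>_sec: "open U \<Longrightarrow> PB.sec U \<xi>" and \<eta>_sec: "open U \<Longrightarrow> PB.sec U \<eta>"
  using \<xi> \<eta> PB.sec_subset[of UNIV _ U] unfolding lightlike_normal_field_def normal_field_def by auto

lemma \<xi>_nz: "\<xi> p \<noteq> 0"
  and \<xi>\<xi>: "G (\<Psi> p) (\<xi> p) (\<xi> p) = 0" and \<eta>\<eta>: "G (\<Psi> p) (\<eta> p) (\<eta> p) = 0"
  and \<xi>_normal: "G (\<Psi> p) (\<xi> p) (d\<Psi> p v) = 0" and \<eta>_normal: "G (\<Psi> p) (\<eta> p) (d\<Psi> p v) = 0"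
  using \<xi> \<eta> unfolding lightlike_normal_field_def normal_field_def by auto

lemma normal_\<xi>: "G (\<Psi> p) (d\<Psi> p v) (\<xi> p) = 0" and normal_\<eta>: "G (\<Psi> p) (d\<Psi> p v) (\<eta> p) = 0"
  and \<eta>\<xi>: "G (\<Psi> p) (\<eta> p) (\<xi> p) = -1"
  using \<xi>_normal \<eta>_normal \<xi>\<eta> NC.h_sym by metis+

lemmas frame_simps = \<xi>\<xi> \<eta>\<eta> \<xi>\<eta> \<eta>\<xi> \<xi>_normal \<eta>_normal normal_\<xi> normal_\<eta> g_eq[symmetric]

text \<open>Pairing with tangent vectors, \<xi> and \<eta> recovers all three components, so the sum
  map is injective; codimension two makes it surjective by a dimension count.\<close>

lemma ex_decomposition: "\<exists>u a b. w = d\<Psi> p u + a *\<^sub>R \<xi> p + b *\<^sub>R \<eta> p"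
proof -
  define T where "T x = d\<Psi> p (fst x) + fst (snd x) *\<^sub>R \<xi> p + snd (snd x) *\<^sub>R \<eta> p"
    for x :: "(real ^ 'n) \<times> real \<times> real"
  have lin: "linear T"
    unfolding T_def by (rule linearI)
      (simp_all add: linear_add[OF linear_differential] linear_cmul[OF linear_differential] algebra_simps)
  have "x = 0" if "T x = 0" for x
  proof -
    have "G (\<Psi> p) (T x) (d\<Psi> p (fst x)) = 0" "G (\<Psi> p) (T x) (\<xi> p) = 0" "G (\<Psi> p) (T x) (\<eta> p) = 0"
      unfolding that by (simp_all add: NC.h_simps)
    then have "g p (fst x) (fst x) = 0" "snd (snd x) = 0" "fst (snd x) = 0"
      unfolding T_def by (simp_all add: NC.h_simps frame_simps)
    then show ?thesis using g_pos[of "fst x" p] by (cases "fst x = 0") (auto simp: prod_eq_iff)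
  qed
  then have "inj T" using linear_injective_0[OF lin] by blast
  then have "surj T"
    by (rule linear_injective_imp_surjective[OF lin]) (simp add: codimension)
  then obtain x where "w = T x" by (metis surjD)
  then show ?thesis unfolding T_def by blast
qed

text \<open>The decomposition makes the definite description in \<open>tangential_part\<close>
  meaningful. Pairing with \<eta> yields minus the coefficient of \<xi>, and conversely, because the
  product of \<xi> and \<eta> is -1.\<close>

lemma tangential_part_eq: "g p (tp p w) v = G (\<Psi> p) w (d\<Psi> p v)"
  and decomposition: "w = d\<Psi> p (tp p w) - G (\<Psi> p) w (\<eta> p) *\<^sub>R \<xi> p - G (\<Psi> p) w (\<xi> p) *\<^sub>R \<eta> p"
proof -
  obtain u a b where w: "w = d\<Psi> p u + a *\<^sub>R \<xi> p + b *\<^sub>R \<eta> p" using ex_decomposition by blast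
  have "tp p w = u"
    unfolding tangential_part_def
  proof (rule the_equality)
    show "\<forall>v. G (\<Psi> p) (w - d\<Psi> p u) (d\<Psi> p v) = 0"
      unfolding w by (simp add: NC.h_simps frame_simps)
    fix u' assume "\<forall>v. G (\<Psi> p) (w - d\<Psi> p u') (d\<Psi> p v) = 0"
    then have "g p u' v = g p u v" for v
      unfolding w by (simp add: NC.h_simps frame_simps)
    then show "u' = u" by (rule g_eqI)
  qed
  then show "g p (tp p w) v = G (\<Psi> p) w (d\<Psi> p v)"
    "w = d\<Psi> p (tp p w) - G (\<Psi> p) w (\<eta> p) *\<^sub>R \<xi> p - G (\<Psi> p) w (\<xi> p) *\<^sub>R \<eta> p"
    unfolding w by (simp_all add: NC.h_simps frame_simps)
qed

text \<open>Orthogonality to \<xi> removes the \<eta>-component, so only the tangential part can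
  leave the line. This turns the first normality condition into a vanishing tangential part.\<close>

lemma in_span_\<xi>_iff:
  assumes "G (\<Psi> p) w (\<xi> p) = 0"
  shows "w \<in> span {\<xi> p} \<longleftrightarrow> tp p w = 0"
proof
  assume "w \<in> span {\<xi> p}"
  then obtain c where "w = c *\<^sub>R \<xi> p" unfolding span_singleton by auto
  then have "g p (tp p w) v = g p 0 v" for v
    unfolding tangential_part_eq by (simp add: NC.h_simps RM.h_simps frame_simps)
  then show "tp p w = 0" by (rule g_eqI)
next
  assume "tp p w = 0"
  then have "w = - G (\<Psi> p) w (\<eta> p) *\<^sub>R \<xi> p"
    using decomposition[of w p] assms by (simp add: linear_0[OF linear_differential])
  then show "w \<in> span {\<xi> p}" unfolding span_singleton by (metis UNIV_I imageI)
qed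

section \<open>Shape operators, Gauss formula and Gauss equation\<close>

lemma shape_eq: "g p (shape_operator \<A> \<B> G \<Psi> D \<zeta> p v) u = - G (\<Psi> p) (D p v \<zeta>) (d\<Psi> p u)"
  unfolding shape_operator_def by (simp add: RM.h_simps tangential_part_eq)

text \<open>The product of \<zeta> with \<open>d\<Psi> q (Y q)\<close> vanishes identically; its
  derivative along \<open>v\<close> gives the relation.\<close>

lemma second_fundamental_form:
  assumes \<zeta>: "PB.sec UNIV \<zeta>" "\<And>q v. G (\<Psi> q) (\<zeta> q) (d\<Psi> q v) = 0"
    and U: "open U" "p \<in> U" "TM.sec U Y"
  shows "G (\<Psi> p) (D p v (\<lambda>q. d\<Psi> q (Y q))) (\<zeta> p) = g p (shape_operator \<A> \<B> G \<Psi> D \<zeta> p v) (Y p)"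
proof -
  have \<zeta>U: "PB.sec U \<zeta>" using PB.sec_subset[OF \<zeta>(1)] by auto
  have "0 = G (\<Psi> p) (D p v (\<lambda>q. d\<Psi> q (Y q))) (\<zeta> p) + G (\<Psi> p) (d\<Psi> p (Y p)) (D p v \<zeta>)"
    using pullback_metric_compatible[OF U(1,2) sec_differential[OF U(1,3)] \<zeta>U, of v]
      \<zeta>(2) NC.h_sym[of _ "d\<Psi> _ _" "\<zeta> _"] by (simp add: M.dir_deriv_const)
  then show ?thesis unfolding shape_eq using NC.h_sym[of "\<Psi> p" "d\<Psi> p (Y p)"] by simp
qed

text \<open>Exchanging the two fields changes the derivative by the image of a Lie bracket, which is
  tangent and so orthogonal to \<zeta>.\<close>

lemma shape_symmetric:
  assumes \<zeta>: "PB.sec UNIV \<zeta>" "\<And>q v. G (\<Psi> q) (\<zeta> q) (d\<Psi> q v) = 0"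
  shows "g p (shape_operator \<A> \<B> G \<Psi> D \<zeta> p u) v = g p (shape_operator \<A> \<B> G \<Psi> D \<zeta> p v) u"
proof -
  obtain U1 X where X: "open U1" "p \<in> U1" "TM.sec U1 X" "X p = u" by (rule TM.sec_extend)
  obtain U2 Y where Y: "open U2" "p \<in> U2" "TM.sec U2 Y" "Y p = v" by (rule TM.sec_extend)
  let ?U = "U1 \<inter> U2"
  have U: "open ?U" "p \<in> ?U" using X Y by auto
  have X': "TM.sec ?U X" and Y': "TM.sec ?U Y"
    using TM.sec_subset[OF X(3)] TM.sec_subset[OF Y(3)] by auto
  have "G (\<Psi> p) (D p (X p) (\<lambda>q. d\<Psi> q (Y q)) - D p (Y p) (\<lambda>q. d\<Psi> q (X q))) (\<zeta> p) = 0"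
    unfolding D_differential_torsion[OF U X' Y'] using \<zeta>(2) NC.h_sym by metis
  then show ?thesis
    unfolding NC.h_simps second_fundamental_form[OF \<zeta> U X'] second_fundamental_form[OF \<zeta> U Y'] X(4) Y(4)
    by simp
qed

text \<open>Symmetry moves the argument of the operator into the other slot of \<open>g\<close>,
  where linearity is that of the metric.\<close>

lemma linear_shape:
  assumes \<zeta>: "PB.sec UNIV \<zeta>" "\<And>q v. G (\<Psi> q) (\<zeta> q) (d\<Psi> q v) = 0"
  shows "linear (shape_operator \<A> \<B> G \<Psi> D \<zeta> p)"
proof (rule linearI; rule g_eqI[of p])
  note sym = shape_symmetric[OF \<zeta>]
  fix u v w and r :: real
  let ?S = "shape_operator \<A> \<B> G \<Psi> D \<zeta> p"
  show "g p (?S (u + v)) w = g p (?S u + ?S v) w"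
    using sym[of p "u + v" w] sym[of p u w] sym[of p v w] by (simp add: RM.h_simps)
  show "g p (?S (r *\<^sub>R u)) w = g p (r *\<^sub>R ?S u) w"
    using sym[of p "r *\<^sub>R u" w] sym[of p u w] by (simp add: RM.h_simps)
qed

lemmas \<xi>_sec_UNIV = \<xi>_sec[OF open_UNIV] and \<eta>_sec_UNIV = \<eta>_sec[OF open_UNIV]
lemmas A\<xi>_sym = shape_symmetric[OF \<xi>_sec_UNIV \<xi>_normal]
  and A\<eta>_sym = shape_symmetric[OF \<eta>_sec_UNIV \<eta>_normal]
  and A\<xi>_linear = linear_shape[OF \<xi>_sec_UNIV \<xi>_normal]
  and A\<eta>_linear = linear_shape[OF \<eta>_sec_UNIV \<eta>_normal]
  and II_\<xi> = second_fundamental_form[OF \<xi>_sec_UNIV \<xi>_normal]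
  and II_\<eta> = second_fundamental_form[OF \<eta>_sec_UNIV \<eta>_normal]

text \<open>The difference \<open>b\<close> of the two sides is symmetric in the first two arguments because both
  connections are torsion-free, and skew in the last two because both are metric; hence it vanishes.\<close>

lemma gauss_formula:
  assumes U: "open U" "p \<in> U" "TM.sec U Y"
  shows "G (\<Psi> p) (D p v (\<lambda>q. d\<Psi> q (Y q))) (d\<Psi> p w) = g p (DM p v Y) w"
proof -
  obtain U1 X where X: "open U1" "p \<in> U1" "TM.sec U1 X" "X p = v" by (rule TM.sec_extend)
  obtain U2 Z where Z: "open U2" "p \<in> U2" "TM.sec U2 Z" "Z p = w" by (rule TM.sec_extend)
  let ?W = "U \<inter> U1 \<inter> U2"
  have W: "open ?W" "p \<in> ?W" using X Z U by auto
  have sX: "TM.sec ?W X" by (rule TM.sec_subset[OF X(3)]) auto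
  have sY: "TM.sec ?W Y" by (rule TM.sec_subset[OF U(3)]) auto
  have sZ: "TM.sec ?W Z" by (rule TM.sec_subset[OF Z(3)]) auto
  define b where "b X Y Z = G (\<Psi> p) (D p (X p) (\<lambda>q. d\<Psi> q (Y q))) (d\<Psi> p (Z p)) - g p (DM p (X p) Y) (Z p)" for X Y Z
  have b_sym: "b X Y Z = b Y X Z" if "TM.sec ?W X" "TM.sec ?W Y" for X Y Z
  proof -
    have "G (\<Psi> p) (D p (X p) (\<lambda>q. d\<Psi> q (Y q)) - D p (Y p) (\<lambda>q. d\<Psi> q (X q))) (d\<Psi> p (Z p))
        = g p (DM p (X p) Y - DM p (Y p) X) (Z p)"
      unfolding D_differential_torsion[OF W that] DM_torsion[OF W that] g_eq ..
    then show ?thesis unfolding b_def by (simp add: NC.h_simps RM.h_simps)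
  qed
  have b_skew: "b X Y Z = - b X Z Y" if "TM.sec ?W Y" "TM.sec ?W Z" for X Y Z
  proof -
    have "dir_deriv \<A> (\<lambda>q. g q (Y q) (Z q)) p (X p)
        = G (\<Psi> p) (D p (X p) (\<lambda>q. d\<Psi> q (Y q))) (d\<Psi> p (Z p))
        + G (\<Psi> p) (d\<Psi> p (Y p)) (D p (X p) (\<lambda>q. d\<Psi> q (Z q)))"
      unfolding g_eq
      by (rule pullback_metric_compatible[OF W sec_differential[OF W(1) that(1)] sec_differential[OF W(1) that(2)]])
    then show ?thesis
      using RM.D_metric[OF W that, of "X p"] NC.h_sym[of "\<Psi> p" "d\<Psi> p (Y p)"] RM.h_sym[of p "Y p"]
      unfolding b_def by simp
  qed
  \<comment> \<open>Alternating the two rules around the six permutations uses three sign changes,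
    so \<open>b X Y Z\<close> equals its own negative.\<close>
  have "b X Y Z = - b X Z Y" "b X Z Y = b Z X Y" "b Z X Y = - b Z Y X" "b Z Y X = b Y Z X"
    "b Y Z X = - b Y X Z" "b Y X Z = b X Y Z"
    using sX sY sZ by (blast intro: b_sym b_skew)+
  then have "b X Y Z = 0" by linarith
  then show ?thesis unfolding b_def X(4) Z(4) by simp
qed

text \<open>The operator is defined pointwise by a definite description, so smoothness is read off
  from its products with smooth fields.\<close>

lemma shape_smooth:
  assumes "open U" "TM.sec U Y" "PB.sec U \<zeta>"
  shows "TM.sec U (\<lambda>q. shape_operator \<A> \<B> G \<Psi> D \<zeta> q (Y q))"
proof (rule RM.sec_dual[OF g_pos assms(1)])
  fix W Z assume W: "open W" "W \<subseteq> U" "TM.sec W Z"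
  have "PB.sec W (\<lambda>q. D q (Y q) \<zeta>)"
    by (rule PB.sec_subset[OF PC.D_smooth[OF assms] W(2)])
  from pullback_metric_smooth[OF W(1) this sec_differential[OF W(1,3)]]
  show "smooth_fun \<A> W (\<lambda>q. g q (shape_operator \<A> \<B> G \<Psi> D \<zeta> q (Y q)) (Z q))"
    unfolding shape_eq by (rule M.smooth_fun_minus[OF W(1)])
qed

text \<open>In the lightlike basis the second fundamental form has the shape operator of \<eta> as
  coefficient of \<xi> and that of \<xi> as coefficient of \<eta>. Hence every quadratic term pairs
  one operator with the other.\<close>

lemma gauss_equation:
  assumes U: "open U" "p \<in> U" "TM.sec U E" "TM.sec U X" "TM.sec U Z"
  shows "G (\<Psi> p) (curvature \<A> D E X (\<lambda>q. d\<Psi> q (Z q)) p) (d\<Psi> p w)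
    = g p (curvature \<A> DM E X Z p) w
      + (g p (A\<eta> p (X p)) (Z p) * g p (A\<xi> p (E p)) w + g p (A\<xi> p (X p)) (Z p) * g p (A\<eta> p (E p)) w)
      - (g p (A\<eta> p (E p)) (Z p) * g p (A\<xi> p (X p)) w + g p (A\<xi> p (E p)) (Z p) * g p (A\<eta> p (X p)) w)"
proof -
  obtain U' W' where W': "open U'" "p \<in> U'" "TM.sec U' W'" "W' p = w" by (rule TM.sec_extend)
  define V where "V = U \<inter> U'"
  have V: "open V" "p \<in> V" using U W' unfolding V_def by auto
  have sW: "TM.sec V W'" unfolding V_def by (rule TM.sec_subset[OF W'(3)]) auto
  have sZ: "TM.sec V Z" unfolding V_def by (rule TM.sec_subset[OF U(5)]) auto
  have *: "G (\<Psi> p) (D p v (\<lambda>q. D q (Y q) (\<lambda>q. d\<Psi> q (Z q)))) (d\<Psi> p w)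
     = g p (DM p v (\<lambda>q. DM q (Y q) Z)) w
       + (g p (A\<eta> p (Y p)) (Z p) * g p (A\<xi> p v) w + g p (A\<xi> p (Y p)) (Z p) * g p (A\<eta> p v) w)"
    if Y: "TM.sec V Y" for Y v
  proof -
    define S where "S q = D q (Y q) (\<lambda>q. d\<Psi> q (Z q))" for q
    \<comment> \<open>\<open>N\<close> is the second fundamental form evaluated on \<open>Y\<close>
      and \<open>Z\<close>.\<close>
    define N where "N q = S q - d\<Psi> q (DM q (Y q) Z)" for q
    have S: "PB.sec V S" unfolding S_def by (intro PC.D_smooth V Y sec_differential sZ)
    have T: "TM.sec V (\<lambda>q. DM q (Y q) Z)" by (intro RM.D_smooth V Y sZ)
    have sN: "PB.sec V N" unfolding N_def by (intro PB.sec_diff V S sec_differential T)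
    have N_normal: "G (\<Psi> q) (N q) (d\<Psi> q u) = 0" if "q \<in> V" for q u
      unfolding N_def S_def by (simp add: NC.h_simps gauss_formula[OF V(1) that sZ] g_eq)
    have N_p: "N p = - g p (A\<eta> p (Y p)) (Z p) *\<^sub>R \<xi> p - g p (A\<xi> p (Y p)) (Z p) *\<^sub>R \<eta> p"
    proof -
      have "tp p (N p) = 0"
        by (rule g_eqI[of p]) (simp add: tangential_part_eq N_normal[OF V(2)] RM.h_simps)
      moreover have "G (\<Psi> p) (N p) (\<eta> p) = g p (A\<eta> p (Y p)) (Z p)" "G (\<Psi> p) (N p) (\<xi> p) = g p (A\<xi> p (Y p)) (Z p)"
        unfolding N_def S_def by (simp_all add: NC.h_simps frame_simps II_\<eta>[OF V sZ] II_\<xi>[OF V sZ])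
      ultimately show ?thesis
        using decomposition[of "N p" p] by (simp add: linear_0[OF linear_differential])
    qed
    \<comment> \<open>Since \<open>N\<close> stays normal, the tangential part of its derivative is
      obtained by moving the derivative to an extension of \<open>w\<close>; second derivatives of
      \<Psi> alone then suffice.\<close>
    have "0 = dir_deriv \<A> (\<lambda>q. G (\<Psi> q) (N q) (d\<Psi> q (W' q))) p v"
      using M.dir_deriv_cong[OF V, of "\<lambda>q. G (\<Psi> q) (N q) (d\<Psi> q (W' q))" "\<lambda>_. 0" v]
      by (simp add: M.dir_deriv_const N_normal)
    then have "G (\<Psi> p) (D p v N) (d\<Psi> p w) = - G (\<Psi> p) (N p) (D p v (\<lambda>q. d\<Psi> q (W' q)))"
      using pullback_metric_compatible[OF V sN sec_differential[OF V(1) sW], of v] W'(4) by simp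
    also have "\<dots> = g p (A\<eta> p (Y p)) (Z p) * g p (A\<xi> p v) w + g p (A\<xi> p (Y p)) (Z p) * g p (A\<eta> p v) w"
      unfolding N_p using II_\<xi>[OF V sW, of v] II_\<eta>[OF V sW, of v] W'(4)
      by (simp add: NC.h_simps NC.h_sym[of _ "\<xi> p"] NC.h_sym[of _ "\<eta> p"])
    finally have DN_p: "G (\<Psi> p) (D p v N) (d\<Psi> p w)
      = g p (A\<eta> p (Y p)) (Z p) * g p (A\<xi> p v) w + g p (A\<xi> p (Y p)) (Z p) * g p (A\<eta> p v) w" .
    have "D p v S = D p v (\<lambda>q. d\<Psi> q (DM q (Y q) Z) + N q)"
      unfolding N_def by simp
    also have "\<dots> = D p v (\<lambda>q. d\<Psi> q (DM q (Y q) Z)) + D p v N"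
      by (rule PC.D_add[OF V sec_differential[OF V(1) T] sN])
    finally show ?thesis
      using DN_p gauss_formula[OF V T, of v w] by (simp add: NC.h_simps S_def[abs_def])
  qed
  have sE: "TM.sec V E" unfolding V_def by (rule TM.sec_subset[OF U(3)]) auto
  have sX: "TM.sec V X" unfolding V_def by (rule TM.sec_subset[OF U(4)]) auto
  show ?thesis
    unfolding curvature_def
    by (simp add: NC.h_simps RM.h_simps *[OF sE] *[OF sX] gauss_formula[OF V sZ])
qed

end

section \<open>The associated tractor connection\<close>

locale associated_tractor = lightlike_pair \<A> \<B> \<Psi> G DN D k l DM \<xi> \<eta>
  for \<A> :: "('p::{t2_space,second_countable_topology}, 'n::finite) chart set"
    and \<B> :: "('q::{t2_space,second_countable_topology}, 'm::finite) chart set"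
    and \<Psi> :: "'p \<Rightarrow> 'q"
    and G :: "'q \<Rightarrow> real ^ 'm \<Rightarrow> real ^ 'm \<Rightarrow> real"
    and DN :: "'q \<Rightarrow> real ^ 'm \<Rightarrow> ('q \<Rightarrow> real ^ 'm) \<Rightarrow> real ^ 'm"
    and D :: "'p \<Rightarrow> real ^ 'n \<Rightarrow> ('p \<Rightarrow> real ^ 'm) \<Rightarrow> real ^ 'm"
    and k l :: nat
    and DM :: "'p \<Rightarrow> real ^ 'n \<Rightarrow> ('p \<Rightarrow> real ^ 'n) \<Rightarrow> real ^ 'n"
    and \<xi> \<eta> :: "'p \<Rightarrow> real ^ 'm" +
  fixes lam :: "'p \<Rightarrow> real" and \<omega> :: "'p \<Rightarrow> real ^ 'n \<Rightarrow> real"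
  assumes lam_smooth: "smooth_fun \<A> UNIV lam" and lam_nz: "lam p \<noteq> 0"
    and A\<xi>_square: "A\<xi> p (A\<xi> p v) = (lam p)\<^sup>2 *\<^sub>R v"
    and \<omega>_form: "one_form \<A> \<omega>"
    and \<omega>: "normal_connection \<A> \<B> G \<Psi> D p v \<xi> = \<omega> p v *\<^sub>R \<xi> p"
begin

abbreviation P :: "'p \<Rightarrow> real ^ 'n \<Rightarrow> real ^ 'n" where
  "P \<equiv> \<lambda>p v. (1 / lam p) *\<^sub>R A\<xi> p v"

definition codazzi :: "('p \<Rightarrow> real ^ 'n) \<Rightarrow> ('p \<Rightarrow> real ^ 'n) \<Rightarrow> 'p \<Rightarrow> real ^ 'n" where
  "codazzi X Y p = covariant_derivative_endo DM A\<xi> p (X p) Y - covariant_derivative_endo DM A\<xi> p (Y p) X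
     - (\<omega> p (X p) *\<^sub>R A\<xi> p (Y p) - \<omega> p (Y p) *\<^sub>R A\<xi> p (X p))"

section \<open>Curvature applied to the lightlike field\<close>

lemma \<omega>_smooth: "open U \<Longrightarrow> TM.sec U X \<Longrightarrow> smooth_fun \<A> U (\<lambda>p. \<omega> p (X p))"
  using \<omega>_form unfolding one_form_def by blast+

lemma weingarten: "D p v \<xi> = \<omega> p v *\<^sub>R \<xi> p - d\<Psi> p (A\<xi> p v)"
  using \<omega>[of p v] unfolding normal_connection_def normal_part_def shape_operator_def
  by (simp add: linear_neg[OF linear_differential] algebra_simps)

text \<open>By self-adjointness the condition on the square says that \<open>A\<xi>\<close> is a
  homothety of \<open>g\<close>; this is why the tractor metrics are conformal to
  \<open>g\<close>.\<close>

lemma g_A\<xi>_A\<xi>: "g p (A\<xi> p u) (A\<xi> p v) = (lam p)\<^sup>2 * g p u v"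
  using A\<xi>_sym[of p u "A\<xi> p v"] RM.h_sym[of p v u] by (simp add: A\<xi>_square RM.h_simps)

lemma A\<xi>_eq_0: "A\<xi> p v = 0 \<longleftrightarrow> v = 0"
  using A\<xi>_square[of p v] lam_nz[of p] linear_0[OF A\<xi>_linear] by auto

lemma D_D_\<xi>:
  assumes "open U" "p \<in> U" "TM.sec U Y"
  shows "G (\<Psi> p) (D p v (\<lambda>q. D q (Y q) \<xi>)) (d\<Psi> p w)
    = - g p (DM p v (\<lambda>q. A\<xi> q (Y q))) w - \<omega> p (Y p) * g p (A\<xi> p v) w"
proof -
  have AY: "TM.sec U (\<lambda>q. A\<xi> q (Y q))" by (rule shape_smooth[OF assms(1,3) \<xi>_sec[OF assms(1)]])
  note s = PB.sec_scaleR[OF assms(1) \<omega>_smooth[OF assms(1,3)] \<xi>_sec[OF assms(1)]]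
  have "D p v (\<lambda>q. D q (Y q) \<xi>) = D p v (\<lambda>q. \<omega> q (Y q) *\<^sub>R \<xi> q) - D p v (\<lambda>q. d\<Psi> q (A\<xi> q (Y q)))"
    unfolding weingarten by (rule PC.D_diff[OF assms(1,2) s sec_differential[OF assms(1) AY]])
  then show ?thesis
    unfolding PC.D_scaleR[OF assms(1,2) \<omega>_smooth[OF assms(1,3)] \<xi>_sec[OF assms(1)]]
    by (simp add: NC.h_simps gauss_formula[OF assms(1,2) AY] weingarten frame_simps)
qed

lemma curvature_\<xi>:
  assumes "open U" "p \<in> U" "TM.sec U X" "TM.sec U Y"
  shows "G (\<Psi> p) (curvature \<A> D X Y \<xi> p) (\<xi> p) = 0"
    and "tp p (curvature \<A> D X Y \<xi> p) = - codazzi X Y p"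
    and "curvature \<A> D X Y \<xi> p \<in> span {\<xi> p} \<longleftrightarrow> codazzi X Y p = 0"
proof -
  show *: "G (\<Psi> p) (curvature \<A> D X Y \<xi> p) (\<xi> p) = 0"
    using PM.curvature_skew[OF assms \<xi>_sec[OF assms(1)] \<xi>_sec[OF assms(1)]]
      NC.h_sym[of _ "\<xi> p"] by simp
  show tp: "tp p (curvature \<A> D X Y \<xi> p) = - codazzi X Y p"
  proof (rule g_eqI[of p])
    fix w
    \<comment> \<open>Writing the bracket through \<open>DM\<close> supplies exactly the terms that
      complete the derivatives of \<open>A\<xi> Y\<close> and \<open>A\<xi> X\<close> to covariant
      derivatives of the operator.\<close>
    have "G (\<Psi> p) (D p (lie_bracket \<A> X Y p) \<xi>) (d\<Psi> p w) = - g p (A\<xi> p (DM p (X p) Y - DM p (Y p) X)) w"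
      unfolding DM_torsion[OF assms] weingarten by (simp add: NC.h_simps frame_simps)
    then show "g p (tp p (curvature \<A> D X Y \<xi> p)) w = g p (- codazzi X Y p) w"
      unfolding tangential_part_eq curvature_def codazzi_def covariant_derivative_endo_def
      by (simp add: NC.h_simps RM.h_simps D_D_\<xi>[OF assms(1,2,4)] D_D_\<xi>[OF assms(1,2,3)]
          linear_diff[OF A\<xi>_linear])
  qed
  show "curvature \<A> D X Y \<xi> p \<in> span {\<xi> p} \<longleftrightarrow> codazzi X Y p = 0"
    unfolding in_span_\<xi>_iff[OF *] tp by simp
qed

text \<open>Both brackets are differences of covariant derivatives, so the rule is the Leibniz rule
  of \<open>DM\<close>.\<close>

lemma lie_bracket_scaleR:
  assumes "open U" "p \<in> U" "TM.sec U X" "TM.sec U Y" "smooth_fun \<A> U f"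
  shows "lie_bracket \<A> (\<lambda>q. f q *\<^sub>R X q) Y p = f p *\<^sub>R lie_bracket \<A> X Y p - dir_deriv \<A> f p (Y p) *\<^sub>R X p"
  unfolding DM_torsion[OF assms(1-4), symmetric]
    DM_torsion[OF assms(1,2) TM.sec_scaleR[OF assms(1,5,3)] assms(4), symmetric]
    RM.D_scaleR[OF assms(1,2,5,3)] RM.D_lin_simps[OF assms(1,2,4)]
  by (simp add: algebra_simps)

lemma curvature_scaleR_left:
  assumes "open U" "p \<in> U" "TM.sec U X" "TM.sec U Y" "smooth_fun \<A> U f" "PB.sec U s"
  shows "curvature \<A> D (\<lambda>q. f q *\<^sub>R X q) Y s p = f p *\<^sub>R curvature \<A> D X Y s p"
  by (rule PC.curvature_lie_bracket_scaleR[OF assms lie_bracket_scaleR[OF assms(1-5)]])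

text \<open>The vanishing of \<open>codazzi\<close> is known for global fields only, but is needed
  for members of a local frame. A global multiple of \<open>E\<close> is used, and its factor at
  \<open>p\<close> is divided out.\<close>

lemma curvature_\<xi>_local:
  assumes glob: "\<And>X Y p. TM.sec UNIV X \<Longrightarrow> TM.sec UNIV Y \<Longrightarrow> codazzi X Y p = 0"
    and U: "open U" "p \<in> U" "TM.sec U E" and X: "TM.sec UNIV X"
  shows "curvature \<A> D E X \<xi> p \<in> span {\<xi> p}"
proof -
  obtain \<phi> where \<phi>: "smooth_fun \<A> UNIV \<phi>" "\<phi> p \<noteq> 0" "TM.sec UNIV (\<lambda>q. \<phi> q *\<^sub>R E q)"
    by (rule TM.ex_global_multiple[OF U])
  have "\<phi> p *\<^sub>R curvature \<A> D E X \<xi> p = curvature \<A> D (\<lambda>q. \<phi> q *\<^sub>R E q) X \<xi> p"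
    by (rule curvature_scaleR_left[symmetric, OF U TM.sec_subset[OF X] M.smooth_fun_subset[OF \<phi>(1)] \<xi>_sec[OF U(1)]]) auto
  also have "\<dots> \<in> span {\<xi> p}"
    using curvature_\<xi>(3)[OF open_UNIV UNIV_I \<phi>(3) X] glob[OF \<phi>(3) X] by simp
  finally have "inverse (\<phi> p) *\<^sub>R (\<phi> p *\<^sub>R curvature \<A> D E X \<xi> p) \<in> span {\<xi> p}" by (rule span_scale)
  then show ?thesis using \<phi>(2) by simp
qed

section \<open>The trace of the curvature over an orthonormal frame\<close>

definition ricci_defect :: "('n \<Rightarrow> 'p \<Rightarrow> real ^ 'n) \<Rightarrow> ('p \<Rightarrow> real ^ 'n) \<Rightarrow> ('p \<Rightarrow> real ^ 'n) \<Rightarrow> 'p \<Rightarrow> real" where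
  "ricci_defect E X Y p = P_ricci \<A> g DM P E X Y p
     - (- trace (matrix (A\<xi> p \<circ> A\<eta> p)) * g p (X p) (P p (Y p))
        - (real CARD('n) - 2) * lam p * g p (X p) (A\<eta> p (Y p)))"

text \<open>Of the four quadratic terms of the Gauss equation, two contract the frame with itself
  and give the traces of the square of \<open>A\<xi>\<close>, which is \<open>n\<close> times the
  square of \<open>lam\<close>, and of \<open>A\<xi> \<circ> A\<eta>\<close>. The other two both
  contract to the square of \<open>lam\<close> times \<open>g p (X p) (A\<eta> p (Z p))\<close> and
  enter with a minus sign; this is the origin of \<open>n - 2\<close>.\<close>

lemma curvature_trace:
  assumes E: "orthonormal_frame \<A> g U E" and p: "p \<in> U" and X: "TM.sec U X" and Z: "TM.sec U Z"
  shows "(\<Sum>i\<in>UNIV. G (\<Psi> p) (curvature \<A> D (E i) X (\<lambda>q. d\<Psi> q (Z q)) p) (d\<Psi> p (A\<xi> p (E i p))))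
    = lam p * ricci_defect E X Z p"
proof -
  have U: "open U" and sE: "TM.sec U (E i)" for i using E unfolding orthonormal_frame_def by auto
  interpret b: orthonormal_basis_for "g p" "\<lambda>i. E i p"
    using E p unfolding orthonormal_frame_def by unfold_locales (auto simp: RM.h_bilinear RM.h_sym[of p])
  let ?e = "\<lambda>i. E i p" and ?x = "X p" and ?z = "Z p"
  have tr: "trace (matrix (A\<xi> p \<circ> A\<eta> p)) = (\<Sum>i\<in>UNIV. g p (A\<xi> p (A\<eta> p (?e i))) (?e i))"
    using b.trace_eq[OF linear_compose[OF A\<eta>_linear A\<xi>_linear]] by (simp add: o_def)
  have 1: "(\<Sum>i\<in>UNIV. g p (A\<xi> p (?e i)) (A\<xi> p (?e i))) = real CARD('n) * (lam p)\<^sup>2"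
    unfolding g_A\<xi>_A\<xi> using b.orthonormal by simp
  have 2: "(\<Sum>i\<in>UNIV. g p (A\<eta> p (?e i)) (A\<xi> p (?e i))) = trace (matrix (A\<xi> p \<circ> A\<eta> p))"
    unfolding tr using A\<xi>_sym RM.h_sym by (intro sum.cong refl) metis
  have 3: "(\<Sum>i\<in>UNIV. g p (A\<eta> p (?e i)) ?z * g p (A\<xi> p ?x) (A\<xi> p (?e i))) = (lam p)\<^sup>2 * g p ?x (A\<eta> p ?z)"
  proof -
    have "(\<Sum>i\<in>UNIV. g p (A\<eta> p (?e i)) ?z * g p (A\<xi> p ?x) (A\<xi> p (?e i)))
        = (\<Sum>i\<in>UNIV. (lam p)\<^sup>2 * (g p ?x (?e i) * g p (?e i) (A\<eta> p ?z)))"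
      using A\<eta>_sym[of p _ ?z] RM.h_sym[of p "A\<eta> p ?z"] by (simp add: g_A\<xi>_A\<xi> mult_ac)
    then show ?thesis using b.parseval[of ?x "A\<eta> p ?z"] by (simp add: sum_distrib_left)
  qed
  have 4: "(\<Sum>i\<in>UNIV. g p (A\<xi> p (?e i)) ?z * g p (A\<eta> p ?x) (A\<xi> p (?e i))) = (lam p)\<^sup>2 * g p ?x (A\<eta> p ?z)"
  proof -
    have "(\<Sum>i\<in>UNIV. g p (A\<xi> p (?e i)) ?z * g p (A\<eta> p ?x) (A\<xi> p (?e i)))
        = (\<Sum>i\<in>UNIV. g p (A\<xi> p ?z) (?e i) * g p (?e i) (A\<xi> p (A\<eta> p ?x)))"
      using A\<xi>_sym[of p _ ?z] A\<xi>_sym[of p _ "A\<eta> p ?x"] RM.h_sym[of p "A\<eta> p ?x" "A\<xi> p _"]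
        RM.h_sym[of p "A\<xi> p (A\<eta> p ?x)"] by simp
    also have "\<dots> = g p (A\<xi> p ?z) (A\<xi> p (A\<eta> p ?x))" by (rule b.parseval[symmetric])
    also have "\<dots> = (lam p)\<^sup>2 * g p ?x (A\<eta> p ?z)"
      using A\<eta>_sym[of p ?x ?z] RM.h_sym[of p ?z] RM.h_sym[of p ?x] by (simp add: g_A\<xi>_A\<xi>)
    finally show ?thesis .
  qed
  have 5: "lam p * P_ricci \<A> g DM P E X Z p = (\<Sum>i\<in>UNIV. g p (curvature \<A> DM (E i) X Z p) (A\<xi> p (?e i)))"
    unfolding P_ricci_def using lam_nz[of p] by (simp add: RM.h_simps sum_distrib_left)
  have xz: "g p (A\<eta> p ?x) ?z = g p ?x (A\<eta> p ?z)" "g p (A\<xi> p ?x) ?z = g p ?x (A\<xi> p ?z)"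
    using A\<eta>_sym[of p ?x ?z] A\<xi>_sym[of p ?x ?z] RM.h_sym by auto
  have "(\<Sum>i\<in>UNIV. G (\<Psi> p) (curvature \<A> D (E i) X (\<lambda>q. d\<Psi> q (Z q)) p) (d\<Psi> p (A\<xi> p (?e i))))
    = lam p * P_ricci \<A> g DM P E X Z p
      + (g p (A\<eta> p ?x) ?z * (real CARD('n) * (lam p)\<^sup>2) + g p (A\<xi> p ?x) ?z * trace (matrix (A\<xi> p \<circ> A\<eta> p)))
      - ((lam p)\<^sup>2 * g p ?x (A\<eta> p ?z) + (lam p)\<^sup>2 * g p ?x (A\<eta> p ?z))"
    unfolding gauss_equation[OF U p sE X Z] 5 1[symmetric] 2[symmetric]
    \<comment> \<open>Facts \<open>3\<close> and \<open>4\<close> have the same right-hand side;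
      separate single substitutions assign one sum to each of its two occurrences.\<close>
    by (subst 3[symmetric], subst 4[symmetric]) (simp add: sum.distrib sum_subtractf sum_distrib_left)
  also have "\<dots> = lam p * ricci_defect E X Z p"
    unfolding ricci_defect_def xz using lam_nz[of p]
    by (simp add: RM.h_simps power2_eq_square algebra_simps)
  finally show ?thesis .
qed

section \<open>Sections of the lightlike line bundle\<close>

context
  fixes U :: "'p set" and \<sigma> :: "'p \<Rightarrow> real ^ 'm" and f :: "'p \<Rightarrow> real"
  assumes U: "open U" and \<sigma>: "PB.sec U \<sigma>" and f: "smooth_fun \<A> U f"
    and \<sigma>_eq: "\<And>q. q \<in> U \<Longrightarrow> \<sigma> q = f q *\<^sub>R \<xi> q"
begin

lemma D_\<sigma>:
  assumes "p \<in> U"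
  shows "D p v \<sigma> = (f p * \<omega> p v + dir_deriv \<A> f p v) *\<^sub>R \<xi> p - f p *\<^sub>R d\<Psi> p (A\<xi> p v)"
  using PC.D_cong[OF U assms \<sigma> \<sigma>_eq, of v] PC.D_scaleR[OF U assms f \<xi>_sec[OF U], of v]
  by (simp add: weingarten algebra_simps)

lemma tractor_metric_\<sigma>:
  assumes "p \<in> U"
  shows "tractor_metric (\<lambda>p. G (\<Psi> p)) D \<sigma> p u v = (f p * lam p)\<^sup>2 * g p u v"
  unfolding tractor_metric_def D_\<sigma>[OF assms]
  by (simp add: NC.h_simps frame_simps g_A\<xi>_A\<xi> power_mult_distrib power2_eq_square)

text \<open>The \<xi>-part of \<open>D q (Y q) \<sigma>\<close> contributes a multiple of \<xi>,
  which is orthogonal to \<open>D p v \<sigma>\<close>. The \<xi>-part of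
  \<open>D p v \<sigma>\<close> drops out by skewness of the curvature. Both steps rest on
  \<open>span\<close>.\<close>

lemma curvature_D_\<sigma>:
  assumes p: "p \<in> U" and E: "TM.sec U E" and X: "TM.sec U X" and Y: "TM.sec U Y"
    and span: "curvature \<A> D E X \<xi> p \<in> span {\<xi> p}"
  shows "G (\<Psi> p) (curvature \<A> D E X (\<lambda>q. D q (Y q) \<sigma>) p) (D p v \<sigma>)
    = (f p)\<^sup>2 * G (\<Psi> p) (curvature \<A> D E X (\<lambda>q. d\<Psi> q (A\<xi> q (Y q))) p) (d\<Psi> p (A\<xi> p v))"
proof -
  define c where "c q = f q * \<omega> q (Y q) + dir_deriv \<A> f q (Y q)" for q
  define S where "S q = d\<Psi> q (A\<xi> q (Y q))" for q
  have c: "smooth_fun \<A> U c"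
    unfolding c_def by (intro M.smooth_fun_add M.smooth_fun_mult U f \<omega>_smooth Y M.dir_deriv_smooth)
  have S: "PB.sec U S"
    unfolding S_def by (intro sec_differential shape_smooth U Y \<xi>_sec)
  note \<xi>U = \<xi>_sec[OF U] and mf = M.smooth_fun_minus[OF U f]
  have "curvature \<A> D E X (\<lambda>q. D q (Y q) \<sigma>) p = curvature \<A> D E X (\<lambda>q. c q *\<^sub>R \<xi> q + (- f q) *\<^sub>R S q) p"
    by (rule PC.curvature_cong[OF U p E X PC.D_smooth[OF U Y \<sigma>]]) (simp add: D_\<sigma> c_def S_def)
  also have "\<dots> = c p *\<^sub>R curvature \<A> D E X \<xi> p + (- f p) *\<^sub>R curvature \<A> D E X S p"
    unfolding PC.curvature_add[OF U p E X PB.sec_scaleR[OF U c \<xi>U] PB.sec_scaleR[OF U mf S]]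
      PC.curvature_scaleR[OF U p E X c \<xi>U] PC.curvature_scaleR[OF U p E X mf S] ..
  finally have R: "curvature \<A> D E X (\<lambda>q. D q (Y q) \<sigma>) p
      = c p *\<^sub>R curvature \<A> D E X \<xi> p + (- f p) *\<^sub>R curvature \<A> D E X S p" .
  obtain a where a: "curvature \<A> D E X \<xi> p = a *\<^sub>R \<xi> p"
    using span unfolding span_singleton by auto
  have "G (\<Psi> p) (curvature \<A> D E X S p) (\<xi> p) = 0"
    using PM.curvature_skew[OF U p E X S \<xi>U] unfolding a S_def by (simp add: NC.h_simps frame_simps)
  then show ?thesis
    unfolding R a D_\<sigma>[OF p]
    by (simp add: NC.h_simps frame_simps S_def[abs_def] power2_eq_square)
qed

text \<open>Each frame vector enters twice, so rescaling by \<open>f q * lam q\<close> produces the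
  square of this factor. The square of \<open>f\<close> is the one by which
  \<open>curvature_D_\<sigma>\<close> differs; of the powers of \<open>lam\<close>, one remains in
  the denominator. A negative factor is harmless.\<close>

lemma normality_trace:
  assumes p: "p \<in> U" and fnz: "\<And>q. q \<in> U \<Longrightarrow> f q \<noteq> 0"
    and E: "orthonormal_frame \<A> g U (\<lambda>i q. (f q * lam q) *\<^sub>R E i q)" and sE: "\<And>i. TM.sec U (E i)"
    and X: "TM.sec U X" and Y: "TM.sec U Y"
    and span: "\<And>i. curvature \<A> D (E i) X \<xi> p \<in> span {\<xi> p}"
  shows "(\<Sum>i\<in>UNIV. G (\<Psi> p) (curvature \<A> D (E i) X (\<lambda>q. D q (Y q) \<sigma>) p) (D p (E i p) \<sigma>))
    = ricci_defect (\<lambda>i q. (f q * lam q) *\<^sub>R E i q) X (\<lambda>q. A\<xi> q (Y q)) p / lam p"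
proof -
  let ?F = "\<lambda>i q. (f q * lam q) *\<^sub>R E i q" and ?S = "\<lambda>q. d\<Psi> q (A\<xi> q (Y q))"
  have AY: "TM.sec U (\<lambda>q. A\<xi> q (Y q))" by (intro shape_smooth U Y \<xi>_sec)
  have fl: "smooth_fun \<A> U (\<lambda>q. f q * lam q)"
    by (intro M.smooth_fun_mult U f M.smooth_fun_subset[OF lam_smooth]) auto
  have "lam p * ricci_defect ?F X (\<lambda>q. A\<xi> q (Y q)) p
      = (\<Sum>i\<in>UNIV. G (\<Psi> p) (curvature \<A> D (?F i) X ?S p) (d\<Psi> p (A\<xi> p (?F i p))))"
    by (rule curvature_trace[symmetric, OF E p X AY])
  also have "\<dots> = (\<Sum>i\<in>UNIV. (lam p)\<^sup>2 * ((f p)\<^sup>2 * G (\<Psi> p) (curvature \<A> D (E i) X ?S p) (d\<Psi> p (A\<xi> p (E i p)))))"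
    by (intro sum.cong refl)
      (simp add: curvature_scaleR_left[OF U p sE X fl sec_differential[OF U AY]] NC.h_simps
        linear_cmul[OF A\<xi>_linear] linear_cmul[OF linear_differential] power2_eq_square)
  also have "\<dots> = (lam p)\<^sup>2 * (\<Sum>i\<in>UNIV. G (\<Psi> p) (curvature \<A> D (E i) X (\<lambda>q. D q (Y q) \<sigma>) p) (D p (E i p) \<sigma>))"
    by (simp add: curvature_D_\<sigma>[OF p sE X Y span] sum_distrib_left)
  finally show ?thesis using lam_nz[of p] by (simp add: power2_eq_square field_simps)
qed

end

section \<open>The associated bundle with its tractor connection\<close>

abbreviation L :: "'p \<Rightarrow> (real ^ 'm) set" where
  "L \<equiv> \<lambda>p. span {\<xi> p}"

text \<open>Pairing with \<eta> writes the coefficient as minus a product of smooth sections, which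
  gives its smoothness.\<close>

lemma subbundle_section_coefficient:
  assumes "open U" "subbundle_section \<A> (pullback_bundle \<Psi> (tangent_bundle \<B>)) L U \<sigma>"
  obtains f where "smooth_fun \<A> U f" "\<And>q. q \<in> U \<Longrightarrow> \<sigma> q = f q *\<^sub>R \<xi> q"
proof (rule that)
  have \<sigma>: "PB.sec U \<sigma>" "\<And>q. q \<in> U \<Longrightarrow> \<sigma> q \<in> L q" using assms(2) unfolding subbundle_section_def by auto
  show "smooth_fun \<A> U (\<lambda>q. - G (\<Psi> q) (\<sigma> q) (\<eta> q))"
    by (intro M.smooth_fun_minus pullback_metric_smooth assms(1) \<sigma>(1) \<eta>_sec)
  show "\<sigma> q = (- G (\<Psi> q) (\<sigma> q) (\<eta> q)) *\<^sub>R \<xi> q" if q: "q \<in> U" for q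
  proof -
    obtain a where "\<sigma> q = a *\<^sub>R \<xi> q" using \<sigma>(2)[OF q] unfolding span_singleton by auto
    then show ?thesis by (simp add: NC.h_simps frame_simps)
  qed
qed

text \<open>Modulo \<xi> the derivative of \<sigma> is \<open>- f p\<close> times the image of
  \<open>A\<xi>\<close>, so the bijectivity of the quotient map is that of
  \<open>A\<xi>\<close>.\<close>

lemma tractor_connection:
  assumes "k = CARD('n) + 1" "l = 1"
  shows "tractor_connection \<A> (pullback_bundle \<Psi> (tangent_bundle \<B>)) (\<lambda>p. G (\<Psi> p)) L D"
proof -
  have metric: "bundle_metric \<A> (pullback_bundle \<Psi> (tangent_bundle \<B>)) (CARD('n) + 1) 1 (\<lambda>p. G (\<Psi> p))"
    using G assms pullback_metric_smooth unfolding bundle_metric_def by blast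
  have "line_subbundle \<A> (pullback_bundle \<Psi> (tangent_bundle \<B>)) L"
    unfolding line_subbundle_def using \<xi>_sec_UNIV \<xi>_nz open_UNIV by blast
  moreover have "\<forall>p. \<forall>w\<in>L p. G (\<Psi> p) w w = 0"
    unfolding span_singleton by (auto simp: NC.h_simps frame_simps)
  ultimately have tb: "tractor_bundle \<A> (pullback_bundle \<Psi> (tangent_bundle \<B>)) (\<lambda>p. G (\<Psi> p)) L"
    unfolding tractor_bundle_def using metric codimension PB.is_bundle by blast
  have mconn: "metric_connection \<A> (pullback_bundle \<Psi> (tangent_bundle \<B>)) (\<lambda>p. G (\<Psi> p)) D"
    unfolding metric_connection_def using PC.conn pullback_metric_compatible by blast
  have "bij_betw (tractor_beta L D \<sigma> p) UNIV (perp_quotient (\<lambda>p. G (\<Psi> p)) L p)"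
    if U: "open U" and sub: "subbundle_section \<A> (pullback_bundle \<Psi> (tangent_bundle \<B>)) L U \<sigma>"
      and nz: "\<And>q. q \<in> U \<Longrightarrow> \<sigma> q \<noteq> 0" and p: "p \<in> U" for U \<sigma> p
  proof -
    obtain f where f: "smooth_fun \<A> U f" "\<And>q. q \<in> U \<Longrightarrow> \<sigma> q = f q *\<^sub>R \<xi> q"
      using subbundle_section_coefficient[OF U sub] by blast
    have \<sigma>: "PB.sec U \<sigma>" using sub unfolding subbundle_section_def by auto
    have fp: "f p \<noteq> 0" using nz[OF p] f(2)[OF p] by auto
    have D\<sigma>: "D p v \<sigma> = (f p * \<omega> p v + dir_deriv \<A> f p v) *\<^sub>R \<xi> p - f p *\<^sub>R d\<Psi> p (A\<xi> p v)" for v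
      by (rule D_\<sigma>[OF U \<sigma> f p])
    have coset_eq: "coset L p w = coset L p w' \<longleftrightarrow> w - w' \<in> L p" for w w'
    proof
      assume "coset L p w = coset L p w'"
      moreover have "w \<in> coset L p w" unfolding coset_def using span_0 by force
      ultimately obtain t where "w = w' + t" "t \<in> L p" unfolding coset_def by auto
      then show "w - w' \<in> L p" by simp
    next
      have le: "coset L p w \<subseteq> coset L p w'" if "w - w' \<in> L p" for w w'
      proof
        fix x assume "x \<in> coset L p w"
        then obtain t where t: "x = w + t" "t \<in> L p" unfolding coset_def by auto
        then have "x = w' + ((w - w') + t)" "(w - w') + t \<in> L p" using that span_add by auto
        then show "x \<in> coset L p w'" unfolding coset_def by blast
      qed
      assume d: "w - w' \<in> L p"
      then have "w' - w \<in> L p" using span_neg[OF d] by simp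
      then show "coset L p w = coset L p w'" using le d by blast
    qed
    have perp: "(\<forall>t\<in>L p. G (\<Psi> p) w t = 0) \<longleftrightarrow> G (\<Psi> p) w (\<xi> p) = 0" for w
      unfolding span_singleton by (auto simp: NC.h_simps)
    show ?thesis
      unfolding bij_betw_def
    proof
      show "inj (tractor_beta L D \<sigma> p)"
      proof (rule injI)
        fix u v assume "tractor_beta L D \<sigma> p u = tractor_beta L D \<sigma> p v"
        then have *: "D p u \<sigma> - D p v \<sigma> \<in> L p" unfolding tractor_beta_def coset_eq .
        have "G (\<Psi> p) (D p u \<sigma> - D p v \<sigma>) (\<xi> p) = 0"
          by (simp add: D\<sigma> NC.h_simps frame_simps)
        then have tp0: "tp p (D p u \<sigma> - D p v \<sigma>) = 0" using in_span_\<xi>_iff * by blast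
        have "A\<xi> p (u - v) = 0"
        proof (rule g_eqI[of p])
          fix w
          have "0 = g p (tp p (D p u \<sigma> - D p v \<sigma>)) w" unfolding tp0 by (simp add: RM.h_simps)
          also have "\<dots> = - f p * g p (A\<xi> p (u - v)) w"
            unfolding tangential_part_eq D\<sigma>
            by (simp add: NC.h_simps RM.h_simps frame_simps linear_diff[OF A\<xi>_linear] algebra_simps)
          finally show "g p (A\<xi> p (u - v)) w = g p 0 w" using fp by (simp add: RM.h_simps)
        qed
        then show "u = v" using A\<xi>_eq_0 by simp
      qed
      show "range (tractor_beta L D \<sigma> p) = perp_quotient (\<lambda>p. G (\<Psi> p)) L p"
      proof
        show "range (tractor_beta L D \<sigma> p) \<subseteq> perp_quotient (\<lambda>p. G (\<Psi> p)) L p"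
          unfolding perp_quotient_def tractor_beta_def perp D\<sigma>
          by (auto simp: NC.h_simps frame_simps)
        show "perp_quotient (\<lambda>p. G (\<Psi> p)) L p \<subseteq> range (tractor_beta L D \<sigma> p)"
        proof
          fix C assume "C \<in> perp_quotient (\<lambda>p. G (\<Psi> p)) L p"
          then obtain w where w: "C = coset L p w" "G (\<Psi> p) w (\<xi> p) = 0"
            unfolding perp_quotient_def perp by auto
          \<comment> \<open>This solves \<open>- f p *\<^sub>R A\<xi> p v = tp p w\<close>: the
            inverse of \<open>A\<xi>\<close> is \<open>A\<xi>\<close> divided by the square of
            \<open>lam\<close>.\<close>
          define v where "v = (- 1 / (f p * (lam p)\<^sup>2)) *\<^sub>R A\<xi> p (tp p w)"
          have "f p *\<^sub>R A\<xi> p v = - tp p w"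
            unfolding v_def using fp lam_nz[of p] by (simp add: linear_cmul[OF A\<xi>_linear] linear_neg[OF A\<xi>_linear] A\<xi>_square)
          then have "f p *\<^sub>R d\<Psi> p (A\<xi> p v) = - d\<Psi> p (tp p w)"
            by (metis linear_cmul[OF linear_differential] linear_neg[OF linear_differential])
          then have "w - D p v \<sigma> = (- G (\<Psi> p) w (\<eta> p) - (f p * \<omega> p v + dir_deriv \<A> f p v)) *\<^sub>R \<xi> p"
            using decomposition[of w p] w(2) unfolding D\<sigma> by (simp add: algebra_simps)
          then have "w - D p v \<sigma> \<in> L p" by (simp add: span_scale span_base)
          then have "C = tractor_beta L D \<sigma> p v" unfolding w(1) tractor_beta_def coset_eq .
          then show "C \<in> range (tractor_beta L D \<sigma> p)" by blast
        qed
      qed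
    qed
  qed
  then show ?thesis unfolding tractor_connection_def using tb mconn by blast
qed

section \<open>Equivalence of normality with the two conditions\<close>

lemma orthonormal_frame_scale:
  assumes "open U" "\<And>i. TM.sec U (E i)" "smooth_fun \<A> U c"
    and "\<And>q i j. q \<in> U \<Longrightarrow> (c q)\<^sup>2 * g q (E i q) (E j q) = (if i = j then 1 else 0)"
  shows "orthonormal_frame \<A> g U (\<lambda>i q. c q *\<^sub>R E i q)"
  unfolding orthonormal_frame_def
  using assms by (auto intro!: TM.sec_scaleR simp: RM.h_simps power2_eq_square mult.assoc)

theorem normal_iff:
  assumes "k = CARD('n) + 1" "l = 1"
  shows "normal_tractor_connection \<A> (pullback_bundle \<Psi> (tangent_bundle \<B>)) (\<lambda>p. G (\<Psi> p)) L D \<longleftrightarrow>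
    (\<forall>X Y. TM.sec UNIV X \<and> TM.sec UNIV Y \<longrightarrow> (\<forall>p. codazzi X Y p = 0)) \<and>
    (\<forall>X Y. TM.sec UNIV X \<and> TM.sec UNIV Y \<longrightarrow>
      (\<forall>U E. orthonormal_frame \<A> g U E \<longrightarrow> (\<forall>p\<in>U. ricci_defect E X Y p = 0)))"
    (is "?normal \<longleftrightarrow> ?codazzi \<and> ?ricci")
proof
  assume normal: ?normal
  have "codazzi X Y p = 0" if "TM.sec UNIV X" "TM.sec UNIV Y" for X Y p
  proof -
    have "subbundle_section \<A> (pullback_bundle \<Psi> (tangent_bundle \<B>)) L UNIV \<xi>"
      unfolding subbundle_section_def using \<xi>_sec_UNIV span_base by blast
    then have "curvature \<A> D X Y \<xi> p \<in> L p"
      using normal that unfolding normal_tractor_connection_def by blast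
    then show ?thesis using curvature_\<xi>(3)[OF open_UNIV UNIV_I that] by simp
  qed
  then have codazzi: ?codazzi by blast
  moreover have "ricci_defect E X Y p = 0"
    if X: "TM.sec UNIV X" and Y: "TM.sec UNIV Y" and E: "orthonormal_frame \<A> g U E" and p: "p \<in> U" for X Y U E p
  proof -
    have U: "open U" and sE: "TM.sec U (E i)" for i using E unfolding orthonormal_frame_def by auto
    \<comment> \<open>For \<sigma> = \<xi> the tractor metric is \<open>g\<close> times the square
      of \<open>lam\<close>, so \<open>E'\<close> is orthonormal for it. The field \<open>Y'\<close>
      is chosen such that \<open>A\<xi>\<close> maps it to \<open>Y\<close>.\<close>
    define E' where "E' = (\<lambda>i q. inverse (lam q) *\<^sub>R E i q)"
    define Y' where "Y' = (\<lambda>q. (inverse (lam q) * inverse (lam q)) *\<^sub>R A\<xi> q (Y q))"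
    have il: "smooth_fun \<A> UNIV (\<lambda>q. inverse (lam q))"
      by (intro M.smooth_fun_inverse open_UNIV lam_smooth lam_nz)
    have ilU: "smooth_fun \<A> U (\<lambda>q. inverse (lam q))" by (rule M.smooth_fun_subset[OF il]) simp
    have sE': "TM.sec U (E' i)" for i unfolding E'_def by (intro TM.sec_scaleR U ilU sE)
    have Y': "TM.sec UNIV Y'"
      unfolding Y'_def
      by (intro TM.sec_scaleR open_UNIV M.smooth_fun_mult il shape_smooth Y \<xi>_sec)
    have AY': "(\<lambda>q. A\<xi> q (Y' q)) = Y"
    proof
      fix q
      have "inverse (lam q) * inverse (lam q) * (lam q)\<^sup>2 = 1"
        using lam_nz[of q] by (simp add: field_simps power2_eq_square)
      then show "A\<xi> q (Y' q) = Y q"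
        unfolding Y'_def by (simp add: linear_cmul[OF A\<xi>_linear] A\<xi>_square)
    qed
    have EE': "(\<lambda>i q. (1 * lam q) *\<^sub>R E' i q) = E" unfolding E'_def using lam_nz by simp
    have \<xi>1: "\<And>q. q \<in> U \<Longrightarrow> \<xi> q = 1 *\<^sub>R \<xi> q" by simp
    have f1: "smooth_fun \<A> U (\<lambda>q. 1::real)" by (rule M.smooth_fun_const)
    note ctx = U \<xi>_sec[OF U] f1 \<xi>1
    have "orthonormal_frame \<A> (tractor_metric (\<lambda>p. G (\<Psi> p)) D \<xi>) U E'"
      using U sE' E lam_nz unfolding orthonormal_frame_def
      by (auto simp: tractor_metric_\<sigma>[OF ctx] E'_def RM.h_simps power2_eq_square field_simps)
    moreover have "subbundle_section \<A> (pullback_bundle \<Psi> (tangent_bundle \<B>)) L U \<xi>"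
      unfolding subbundle_section_def using \<xi>_sec[OF U] span_base by blast
    ultimately have "(\<Sum>i\<in>UNIV. G (\<Psi> p) (curvature \<A> D (E' i) X (\<lambda>q. D q (Y' q) \<xi>) p) (D p (E' i p) \<xi>)) = 0"
      using normal X Y' U \<xi>_nz p unfolding normal_tractor_connection_def by blast
    moreover have "(\<Sum>i\<in>UNIV. G (\<Psi> p) (curvature \<A> D (E' i) X (\<lambda>q. D q (Y' q) \<xi>) p) (D p (E' i p) \<xi>))
      = ricci_defect (\<lambda>i q. (1 * lam q) *\<^sub>R E' i q) X (\<lambda>q. A\<xi> q (Y' q)) p / lam p"
      by (rule normality_trace[OF ctx p _ _ sE' TM.sec_subset[OF X] TM.sec_subset[OF Y']])
        (use E codazzi in \<open>auto simp: EE'[simplified] intro: curvature_\<xi>_local[OF _ U p sE' X]\<close>)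
    ultimately show ?thesis unfolding AY' EE' using lam_nz[of p] by simp
  qed
  ultimately show "?codazzi \<and> ?ricci" by blast
next
  assume conds: "?codazzi \<and> ?ricci"
  have "curvature \<A> D X Y \<sigma> p \<in> L p"
    if X: "TM.sec UNIV X" and Y: "TM.sec UNIV Y"
      and \<sigma>: "subbundle_section \<A> (pullback_bundle \<Psi> (tangent_bundle \<B>)) L UNIV \<sigma>" for X Y \<sigma> p
  proof -
    obtain f where f: "smooth_fun \<A> UNIV f" "\<And>q. q \<in> UNIV \<Longrightarrow> \<sigma> q = f q *\<^sub>R \<xi> q"
      using subbundle_section_coefficient[OF open_UNIV \<sigma>] by blast
    have "\<sigma> = (\<lambda>q. f q *\<^sub>R \<xi> q)" using f(2) by auto
    then have "curvature \<A> D X Y \<sigma> p = f p *\<^sub>R curvature \<A> D X Y \<xi> p"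
      using PC.curvature_scaleR[OF open_UNIV UNIV_I X Y f(1) \<xi>_sec_UNIV] by simp
    moreover have "curvature \<A> D X Y \<xi> p \<in> L p"
      using curvature_\<xi>(3)[OF open_UNIV UNIV_I X Y] conds X Y by blast
    ultimately show ?thesis by (simp add: span_scale)
  qed
  moreover have "(\<Sum>i\<in>UNIV. G (\<Psi> p) (curvature \<A> D (E i) X (\<lambda>q. D q (Y q) \<sigma>) p) (D p (E i p) \<sigma>)) = 0"
    if X: "TM.sec UNIV X" and Y: "TM.sec UNIV Y" and U: "open U"
      and sub: "subbundle_section \<A> (pullback_bundle \<Psi> (tangent_bundle \<B>)) L U \<sigma>"
      and nz: "\<And>q. q \<in> U \<Longrightarrow> \<sigma> q \<noteq> 0"
      and E: "orthonormal_frame \<A> (tractor_metric (\<lambda>p. G (\<Psi> p)) D \<sigma>) U E" and p: "p \<in> U" for X Y U \<sigma> E p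
  proof -
    obtain f where f: "smooth_fun \<A> U f" "\<And>q. q \<in> U \<Longrightarrow> \<sigma> q = f q *\<^sub>R \<xi> q"
      using subbundle_section_coefficient[OF U sub] by blast
    have \<sigma>: "PB.sec U \<sigma>" using sub unfolding subbundle_section_def by auto
    have fnz: "f q \<noteq> 0" if "q \<in> U" for q using nz[OF that] f(2)[OF that] by auto
    note ctx = U \<sigma> f
    have sE: "TM.sec U (E i)" for i using E unfolding orthonormal_frame_def by auto
    \<comment> \<open>A frame orthonormal for the tractor metric of \<sigma> becomes orthonormal for
      \<open>g\<close> after multiplication with the conformal factor.\<close>
    have F: "orthonormal_frame \<A> g U (\<lambda>i q. (f q * lam q) *\<^sub>R E i q)"
    proof (rule orthonormal_frame_scale[OF U sE])
      show "smooth_fun \<A> U (\<lambda>q. f q * lam q)"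
        by (intro M.smooth_fun_mult U f(1) M.smooth_fun_subset[OF lam_smooth]) simp
      show "(f q * lam q)\<^sup>2 * g q (E i q) (E j q) = (if i = j then 1 else 0)" if "q \<in> U" for q i j
        using E that tractor_metric_\<sigma>[OF ctx that, of "E i q" "E j q"] unfolding orthonormal_frame_def by simp
    qed
    have AY: "TM.sec UNIV (\<lambda>q. A\<xi> q (Y q))" by (intro shape_smooth open_UNIV Y \<xi>_sec)
    \<comment> \<open>The second condition is used at the pair \<open>X\<close> and
      \<open>A\<xi> Y\<close>; the latter is global because \<open>Y\<close> and \<xi> are.\<close>
    have "ricci_defect (\<lambda>i q. (f q * lam q) *\<^sub>R E i q) X (\<lambda>q. A\<xi> q (Y q)) p = 0"
      using conds X AY F p by blast
    moreover have "(\<Sum>i\<in>UNIV. G (\<Psi> p) (curvature \<A> D (E i) X (\<lambda>q. D q (Y q) \<sigma>) p) (D p (E i p) \<sigma>))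
      = ricci_defect (\<lambda>i q. (f q * lam q) *\<^sub>R E i q) X (\<lambda>q. A\<xi> q (Y q)) p / lam p"
      by (rule normality_trace[OF ctx p fnz F sE TM.sec_subset[OF X] TM.sec_subset[OF Y]])
        (use conds in \<open>auto intro: curvature_\<xi>_local[OF _ U p sE X]\<close>)
    ultimately show ?thesis by simp
  qed
  ultimately show ?normal
    unfolding normal_tractor_connection_def using tractor_connection[OF assms] by blast
qed

end

theorem theorem3p4:
  fixes \<A> :: "('p::{t2_space,second_countable_topology}, 'n::finite) chart set"
    and \<B> :: "('q::{t2_space,second_countable_topology}, 'm::finite) chart set"
    and G :: "'q \<Rightarrow> real ^ 'm \<Rightarrow> real ^ 'm \<Rightarrow> real"
    and \<Psi> :: "'p \<Rightarrow> 'q"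
    and g :: "'p \<Rightarrow> real ^ 'n \<Rightarrow> real ^ 'n \<Rightarrow> real"
    and DN :: "'q \<Rightarrow> real ^ 'm \<Rightarrow> ('q \<Rightarrow> real ^ 'm) \<Rightarrow> real ^ 'm"
    and D\<Psi> :: "'p \<Rightarrow> real ^ 'n \<Rightarrow> ('p \<Rightarrow> real ^ 'm) \<Rightarrow> real ^ 'm"
    and DM :: "'p \<Rightarrow> real ^ 'n \<Rightarrow> ('p \<Rightarrow> real ^ 'n) \<Rightarrow> real ^ 'n"
    and \<xi> \<eta> :: "'p \<Rightarrow> real ^ 'm"
    and A\<xi> A\<eta> P :: "'p \<Rightarrow> real ^ 'n \<Rightarrow> real ^ 'n"
    and lam :: "'p \<Rightarrow> real"
    and \<omega> :: "'p \<Rightarrow> real ^ 'n \<Rightarrow> real"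
  assumes n_ge_2: "CARD('n) \<ge> 2" and codimension: "CARD('m) = CARD('n) + 2"
    and manifold_M: "smooth_atlas \<A>" and connected_M: "connected (UNIV :: 'p set)"
    and manifold_N: "smooth_atlas \<B>" and lorentzian: "lorentzian_metric \<B> G"
    and spacelike: "spacelike_immersion \<A> \<B> G \<Psi>"
    and g_eq: "g = induced_metric \<A> \<B> \<Psi> G"
    and DN: "levi_civita \<B> G DN"
    and D\<Psi>: "pullback_connection \<A> \<B> \<Psi> (tangent_bundle \<B>) DN D\<Psi>"
    and DM: "levi_civita \<A> g DM"
    and \<xi>: "lightlike_normal_field \<A> \<B> G \<Psi> \<xi>"
    and A\<xi>_eq: "A\<xi> = shape_operator \<A> \<B> G \<Psi> D\<Psi> \<xi>"
    and lam_smooth: "smooth_fun \<A> UNIV lam" and lam_nonzero: "\<And>p. lam p \<noteq> 0"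
    and A\<xi>_square: "\<And>p v. A\<xi> p (A\<xi> p v) = (lam p)\<^sup>2 *\<^sub>R v"
    and \<eta>: "lightlike_normal_field \<A> \<B> G \<Psi> \<eta>"
    and \<xi>\<eta>: "\<And>p. G (\<Psi> p) (\<xi> p) (\<eta> p) = -1"
    and A\<eta>_eq: "A\<eta> = shape_operator \<A> \<B> G \<Psi> D\<Psi> \<eta>"
    and \<omega>_form: "one_form \<A> \<omega>"
    and \<omega>: "\<And>p v. normal_connection \<A> \<B> G \<Psi> D\<Psi> p v \<xi> = \<omega> p v *\<^sub>R \<xi> p"
    and P_eq: "P = (\<lambda>p v. (1 / lam p) *\<^sub>R A\<xi> p v)"
  shows "normal_tractor_connection \<A> (pullback_bundle \<Psi> (tangent_bundle \<B>))
           (\<lambda>p. G (\<Psi> p)) (\<lambda>p. span {\<xi> p}) D\<Psi> \<longleftrightarrow>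
         (\<forall>X Y. vector_field \<A> UNIV X \<and> vector_field \<A> UNIV Y \<longrightarrow>
            (\<forall>p. covariant_derivative_endo DM A\<xi> p (X p) Y - covariant_derivative_endo DM A\<xi> p (Y p) X
                 = \<omega> p (X p) *\<^sub>R A\<xi> p (Y p) - \<omega> p (Y p) *\<^sub>R A\<xi> p (X p))) \<and>
         (\<forall>X Y. vector_field \<A> UNIV X \<and> vector_field \<A> UNIV Y \<longrightarrow>
            (\<forall>U E. orthonormal_frame \<A> g U E \<longrightarrow>
               (\<forall>p\<in>U. P_ricci \<A> g DM P E X Y p
                  = - trace (matrix (A\<xi> p \<circ> A\<eta> p)) * g p (X p) (P p (Y p))
                    - (real CARD('n) - 2) * lam p * g p (X p) (A\<eta> p (Y p)))))"
proof -
  \<comment> \<open>The ambient Lorentzian signature is stated as \<open>CARD('m) - 1\<close>; by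
    the codimension this is \<open>CARD('n) + 1\<close>, the signature required of a tractor
    bundle.\<close>
  interpret AT: associated_tractor \<A> \<B> \<Psi> G DN D\<Psi> "CARD('m) - 1" 1 DM \<xi> \<eta> lam \<omega>
  proof
    show "smooth_atlas \<A>" "smooth_atlas \<B>" "levi_civita \<B> G DN"
      "pullback_connection \<A> \<B> \<Psi> (tangent_bundle \<B>) DN D\<Psi>" "CARD('m) = CARD('n) + 2"
      "lightlike_normal_field \<A> \<B> G \<Psi> \<xi>" "lightlike_normal_field \<A> \<B> G \<Psi> \<eta>"
      "smooth_fun \<A> UNIV lam" "one_form \<A> \<omega>"
      by fact+
    show "smooth_map \<A> \<B> \<Psi>" "riemannian_metric \<A> (induced_metric \<A> \<B> \<Psi> G)"
      using spacelike unfolding spacelike_immersion_def immersion_def by blast+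
    show "bundle_metric \<B> (tangent_bundle \<B>) (CARD('m) - 1) 1 G"
      using lorentzian unfolding lorentzian_metric_def .
    show "levi_civita \<A> (induced_metric \<A> \<B> \<Psi> G) DM" using DM unfolding g_eq .
    show "G (\<Psi> p) (\<xi> p) (\<eta> p) = -1" "lam p \<noteq> 0" for p by fact+
    show "shape_operator \<A> \<B> G \<Psi> D\<Psi> \<xi> p (shape_operator \<A> \<B> G \<Psi> D\<Psi> \<xi> p v) = (lam p)\<^sup>2 *\<^sub>R v" for p v
      using A\<xi>_square unfolding A\<xi>_eq .
    show "normal_connection \<A> \<B> G \<Psi> D\<Psi> p v \<xi> = \<omega> p v *\<^sub>R \<xi> p" for p v by (rule \<omega>)
  qed
  show ?thesis
    unfolding P_eq A\<xi>_eq A\<eta>_eq g_eq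
    using AT.normal_iff codimension by (simp add: AT.codazzi_def AT.ricci_defect_def)
qed

end
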